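(* Let $n\ge4$ and let $\mathbf r=(r_1,\dots,r_n)$ be any $n$-tuple of positive numbers. Let $N$ be a singular fiber of the system of bending flows $F:\mathcal M_{\mathbf r}\to\mathbb R^{n-3}$ defined by any family of $n-3$ distinct pairwise disjoint diagonals. Then $N$ carries the same structure as the moduli space $\mathcal M_{\mathbf r}$ containing it: $N$ is a manifold if $\mathbf r$ is generic (so that $\mathcal M_{\mathbf r}$ is a manifold), and $N$ is an orbispace if $\mathbf r$ is not generic (so that $\mathcal M_{\mathbf r}$ is an orbispace). Moreover, the symplectic structure $\omega$ of $\mathcal M_{\mathbf r}$ vanishes on $N$: for every $[\mathbf u]\in N^{\mathrm{nd}}$ and all $X,Y\in T_{[\mathbf u]}N^{\mathrm{nd}}$, $\omega_{[\mathbf u]}(X,Y)=0$.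
   Context: For positive numbers $\mathbf r=(r_1,\dots,r_n)$, $\tilde{\mathcal M}_{\mathbf r}=\{\mathbf u=(u^1,\dots,u^n)\in (S^2)^n : r_1u^1+\cdots+r_nu^n=0\}$ is the space of polygons in $\mathbb R^3$ with side lengths $\mathbf r$. The group $SO(3)$ acts diagonally, and $\mathcal M_{\mathbf r}=\tilde{\mathcal M}_{\mathbf r}/SO(3)$. The tuple $\mathbf r$ is generic if $\sum_i\varepsilon_ir_i\neq0$ for all signs $\varepsilon_i\in\{\pm1\}$. If $\mathbf r$ is generic, $SO(3)$ acts freely and $\mathcal M_{\mathbf r}$ is a smooth manifold. If $\mathbf r$ is not generic, $\mathcal M_{\mathbf r}$ is regarded as an orbispace (a space locally given as the quotient $\tilde U/G$ by a proper Lie group action), with the single chart $\tilde{\mathcal M}_{\mathbf r}\to\mathcal M_{\mathbf r}$ and group $SO(3)$. A polygon $\mathbf u$ is degenerate if $u^1,\dots,u^n$ lie on a common line, nondegenerate otherwise. $\mathcal M_{\mathbf r}^{\mathrm{nd}}$ (resp. $\mathcal M_{\mathbf r}^{\mathrm{d}}$) is the set of classes of nondegenerate (resp. degenerate) polygons; $\mathcal M_{\mathbf r}^{\mathrm{nd}}$ is a manifold, equal to $\mathcal M_{\mathbf r}$ if $\mathbf r$ is generic. For $N\subset\mathcal M_{\mathbf r}$, $N^{\mathrm{nd}}=N\cap\mathcal M_{\mathbf r}^{\mathrm{nd}}$. On $(S^2)^n$ let $\omega=\sum_ir_i\omega_i$, where $\omega_i$ is the pull-back by the $i$-th projection of the canonical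 $SO(3)$-invariant area form of $S^2$; $\omega$ also denotes the symplectic form it induces on $\mathcal M_{\mathbf r}^{\mathrm{nd}}$ by reduction (the $SO(3)$-action is Hamiltonian with momentum map $\sum_ir_iu^i$). For $1\le i<j\le n$ let $\mu_{i,j}(\mathbf u)=r_iu^i+\cdots+r_{j-1}u^{j-1}$, and $\mu_{j,i}=-\mu_{i,j}$. It is a side if the vertices $i,j$ are cyclically adjacent, and a diagonal otherwise. Diagonals are considered up to orientation (sign). Two diagonals are disjoint if the corresponding diagonals of a convex planar $n$-gon do not intersect in its interior. Given $n-3$ distinct pairwise disjoint diagonals $d_1,\dots,d_{n-3}$, the system of bending flows is $F=(F_1,\dots,F_{n-3})$, $F_k([\mathbf u])=\frac12\|d_k(\mathbf u)\|^2$. For $i<j<k$ the face $\Delta_{i,j,k}=(\mu_{i,j},\mu_{j,k},\mu_{k,i})$ is adapted if each of its components is, up to sign, a side or one of $d_1,\dots,d_{n-3}$; it is degenerate at $\mathbf u$ if its three components are linearly dependent in the sense of being collinear vectors. A point $[\mathbf u]$ is a singular point of $F$ if $dF_1,\dots,dF_{n-3}$ are linearly dependent there (classes of degenerate polygons being singular); equivalently, some adapted face is degenerate at $\mathbf u$. A singular fiber is a fiber $F^{-1}(c_1,\dots,c_{n-3})$ containing a singular point. *)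

theory Defs
  imports "HOL-Analysis.Analysis"
begin

section \<open>Smooth maps and smooth manifolds in Euclidean spaces\<close>

primrec Ck_on :: "nat \<Rightarrow> ('a::euclidean_space \<Rightarrow> 'b::euclidean_space) \<Rightarrow> 'a set \<Rightarrow> bool" where
  "Ck_on 0 f S \<longleftrightarrow> continuous_on S f"
| "Ck_on (Suc k) f S \<longleftrightarrow>
     (\<forall>x\<in>S. f differentiable (at x)) \<and>
     (\<forall>v. Ck_on k (\<lambda>x. frechet_derivative f (at x) v) S)"

definition smooth_on :: "('a::euclidean_space \<Rightarrow> 'b::euclidean_space) \<Rightarrow> 'a set \<Rightarrow> bool" where
  "smooth_on f S \<longleftrightarrow> open S \<and> (\<forall>k. Ck_on k f S)"

text \<open>Smoothness on an arbitrary subset of a Euclidean space means that the map extends, locally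
  around each point, to a smooth map on an open set (Milnor's convention).\<close>

definition smooth_map :: "'a::euclidean_space set \<Rightarrow> ('a \<Rightarrow> 'b::euclidean_space) \<Rightarrow> bool" where
  "smooth_map S f \<longleftrightarrow> (\<forall>x\<in>S. \<exists>U g. x \<in> U \<and> smooth_on g U \<and> (\<forall>y\<in>U \<inter> S. g y = f y))"

text \<open>Embedded smooth submanifolds of dimension \<open>m\<close>. The dimension is not a type, so the model
  space \<open>R^m\<close> is an \<open>m\<close>-dimensional linear subspace \<open>E\<close> of the ambient space; this
  is no restriction, since \<open>m\<close> never exceeds the dimension of the ambient space.\<close>

definition smooth_manifold :: "nat \<Rightarrow> 'a::euclidean_space set \<Rightarrow> bool" where
  "smooth_manifold m M \<longleftrightarrow>
     (\<forall>x\<in>M. \<exists>U E V f g. openin (top_of_set M) U \<and> x \<in> U \<and>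
        subspace E \<and> dim (E :: 'a set) = m \<and> openin (top_of_set E) V \<and>
        homeomorphism U V f g \<and> smooth_map U f \<and> smooth_map V g)"

definition tangent_space :: "'a::euclidean_space set \<Rightarrow> 'a \<Rightarrow> 'a set" where
  "tangent_space M x =
     {v. \<exists>\<gamma> e. 0 < e \<and> smooth_on \<gamma> {-e<..<e} \<and> \<gamma> ` {-e<..<e} \<subseteq> M \<and> \<gamma> 0 = x \<and>
           (\<gamma> has_vector_derivative v) (at (0::real))}"


section \<open>Orbispace charts\<close>

text \<open>A closed subgroup of the general linear group.\<close>

definition matrix_lie_group :: "(real^'m^'m::finite) set \<Rightarrow> bool" where
  "matrix_lie_group G \<longleftrightarrow>
     mat 1 \<in> G \<and> (\<forall>A\<in>G. \<forall>B\<in>G. A ** B \<in> G) \<and>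
     (\<forall>A\<in>G. invertible A \<and> matrix_inv A \<in> G) \<and>
     closedin (top_of_set {A. invertible A}) G"

text \<open>The open subset \<open>U\<close> of \<open>X\<close> is presented, through \<open>q\<close>, as the quotient of \<open>M\<close> by the
  proper smooth action \<open>act\<close> of the Lie group \<open>G\<close>. The chart domain \<open>M\<close> is not
  required to be a manifold.\<close>

definition orbispace_chart ::
  "'x topology \<Rightarrow> 'x set \<Rightarrow> 'a::euclidean_space set \<Rightarrow> (real^'m^'m::finite) set \<Rightarrow>
   (real^'m^'m \<Rightarrow> 'a \<Rightarrow> 'a) \<Rightarrow> ('a \<Rightarrow> 'x) \<Rightarrow> bool" where
  "orbispace_chart X U M G act q \<longleftrightarrow>
     openin X U \<and> matrix_lie_group G \<and>
     (\<forall>A\<in>G. \<forall>x\<in>M. act A x \<in> M) \<and>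
     (\<forall>x\<in>M. act (mat 1) x = x) \<and>
     (\<forall>A\<in>G. \<forall>B\<in>G. \<forall>x\<in>M. act (A ** B) x = act A (act B x)) \<and>
     smooth_map (G \<times> M) (\<lambda>(A, x). act A x) \<and>
     proper_map (top_of_set (G \<times> M)) (top_of_set (M \<times> M)) (\<lambda>(A, x). (act A x, x)) \<and>
     quotient_map (top_of_set M) (subtopology X U) q \<and>
     (\<forall>x\<in>M. \<forall>y\<in>M. q x = q y \<longleftrightarrow> (\<exists>A\<in>G. y = act A x))"


section \<open>Moduli spaces of polygons\<close>

text \<open>The index set \<open>{1,\<dots>,n}\<close> is a finite linearly ordered type \<open>'n\<close>, with \<open>n = CARD('n)\<close>.
  A configuration of \<open>n\<close> vectors of \<open>R^3\<close> has type \<open>real^3^'n\<close>.\<close>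

definition generic :: "real^'n::finite \<Rightarrow> bool" where
  "generic r \<longleftrightarrow> (\<forall>\<epsilon>. (\<forall>i. \<epsilon> i \<in> {-1, 1}) \<longrightarrow> (\<Sum>i\<in>UNIV. \<epsilon> i * r $ i) \<noteq> 0)"

definition polygons :: "real^'n::finite \<Rightarrow> (real^3^'n) set" where
  "polygons r = {u. (\<forall>i. norm (u $ i) = 1) \<and> (\<Sum>i\<in>UNIV. r $ i *\<^sub>R u $ i) = 0}"

definition SO3 :: "(real^3^3) set" where
  "SO3 = {A. rotation_matrix A}"

definition rotate_polygon :: "real^3^3 \<Rightarrow> real^3^'n::finite \<Rightarrow> real^3^'n" where
  "rotate_polygon A u = (\<chi> i. A *v (u $ i))"

text \<open>Points of the moduli space are the \<open>SO(3)\<close>-orbits themselves.\<close>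

definition polygon_class :: "real^3^'n::finite \<Rightarrow> (real^3^'n) set" where
  "polygon_class u = (\<lambda>A. rotate_polygon A u) ` SO3"

definition moduli :: "real^'n::finite \<Rightarrow> (real^3^'n) set set" where
  "moduli r = polygon_class ` polygons r"

text \<open>The quotient topology.\<close>

definition moduli_top :: "real^'n::finite \<Rightarrow> (real^3^'n) set topology" where
  "moduli_top r = topology (\<lambda>V. V \<subseteq> moduli r \<and>
     openin (top_of_set (polygons r)) {u \<in> polygons r. polygon_class u \<in> V})"

lemma openin_moduli_top:
  "openin (moduli_top r) V \<longleftrightarrow> V \<subseteq> moduli r \<and>
     openin (top_of_set (polygons r)) {u \<in> polygons r. polygon_class u \<in> V}"
proof -
  let ?P = "\<lambda>V. {u \<in> polygons r. polygon_class u \<in> V}"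
  have 1: "?P (S \<inter> T) = ?P S \<inter> ?P T" for S T by auto
  have 2: "?P (\<Union>\<K>) = (\<Union>K\<in>\<K>. ?P K)" for \<K> by auto
  have "istopology (\<lambda>V. V \<subseteq> moduli r \<and> openin (top_of_set (polygons r)) (?P V))"
    unfolding istopology_def 1 2 by (auto intro!: openin_Union)
  then show ?thesis
    by (simp add: moduli_top_def)
qed

lemma quotient_map_polygon_class:
  "quotient_map (top_of_set (polygons r)) (moduli_top r) polygon_class"
proof -
  have "openin (moduli_top r) (moduli r)"
    by (simp add: openin_moduli_top) (metis (no_types, lifting) Collect_cong Collect_mem_eq
        image_eqI moduli_def openin_subtopology_self)
  then have "topspace (moduli_top r) = moduli r"
    by (meson openin_moduli_top openin_subset openin_topspace subset_antisym)
  then show ?thesis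
    by (auto simp: quotient_map_def openin_moduli_top moduli_def)
qed

definition lift :: "(real^3^'n::finite) set set \<Rightarrow> (real^3^'n) set" where
  "lift N = {u. polygon_class u \<in> N}"

definition degenerate :: "real^3^'n::finite \<Rightarrow> bool" where
  "degenerate u \<longleftrightarrow> collinear (insert 0 (range (\<lambda>i. u $ i)))"

definition moduli_nd :: "real^'n::finite \<Rightarrow> (real^3^'n) set set" where
  "moduli_nd r = polygon_class ` {u \<in> polygons r. \<not> degenerate u}"

text \<open>Smooth submanifolds of dimension \<open>m\<close> of the moduli space, whose smooth structure is the
  one that makes the projection \<open>polygon_class\<close> a submersion: a map \<open>\<phi>\<close> out of a subset is
  smooth if \<open>\<phi> \<circ> polygon_class\<close> is smooth on the preimage, and a map \<open>\<psi>\<close> into the moduli space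
  is smooth if it lifts locally to a smooth map \<open>s\<close> into the space of polygons. As in
  \<open>smooth_manifold\<close>, each point has a neighbourhood \<open>U\<close> in \<open>N\<close> that is
  diffeomorphic to an open subset \<open>V\<close> of an \<open>m\<close>-dimensional vector space \<open>E\<close>.\<close>

definition moduli_submanifold :: "real^'n::finite \<Rightarrow> nat \<Rightarrow> (real^3^'n) set set \<Rightarrow> bool" where
  "moduli_submanifold r m N \<longleftrightarrow>
     N \<subseteq> moduli_nd r \<and>
     Hausdorff_space (subtopology (moduli_top r) N) \<and>
     second_countable (subtopology (moduli_top r) N) \<and>
     (\<forall>p\<in>N. \<exists>U E V \<phi> \<psi>. openin (subtopology (moduli_top r) N) U \<and> p \<in> U \<and>
        subspace E \<and> dim (E :: (real^3^'n) set) = m \<and> openin (top_of_set E) V \<and>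
        homeomorphic_maps (subtopology (moduli_top r) U) (top_of_set V) \<phi> \<psi> \<and>
        smooth_map (lift U) (\<phi> \<circ> polygon_class) \<and>
        (\<forall>y\<in>V. \<exists>V' s. openin (top_of_set V) V' \<and> y \<in> V' \<and> smooth_map V' s \<and>
           (\<forall>z\<in>V'. s z \<in> polygons r \<and> polygon_class (s z) = \<psi> z)))"


section \<open>Tangent spaces and the reduced symplectic form\<close>

definition orbit_tangent :: "real^3^'n::finite \<Rightarrow> (real^3^'n) set" where
  "orbit_tangent u = range (\<lambda>\<xi>. \<chi> i. cross3 \<xi> (u $ i))"

text \<open>The tangent space at the class of a nondegenerate polygon \<open>u\<close> to a submanifold \<open>N\<close> of the
  moduli space is the quotient of the tangent space at \<open>u\<close> to the preimage of \<open>N\<close> by the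
  tangent space to the \<open>SO(3)\<close>-orbit of \<open>u\<close>. Tangent vectors are thus cosets, and
  \<open>v \<mapsto> v + orbit_tangent u\<close> is the differential of the projection.\<close>

definition moduli_tangent :: "(real^3^'n::finite) set set \<Rightarrow> real^3^'n \<Rightarrow> (real^3^'n) set set" where
  "moduli_tangent N u =
     (\<lambda>v. (\<lambda>w. v + w) ` orbit_tangent u) ` tangent_space (lift N) u"

text \<open>The area form of the unit sphere at \<open>a\<close> is \<open>(x, y) \<mapsto> a \<bullet> (x \<times> y)\<close>.\<close>

definition symplectic_form ::
  "real^'n::finite \<Rightarrow> real^3^'n \<Rightarrow> real^3^'n \<Rightarrow> real^3^'n \<Rightarrow> real" where
  "symplectic_form r u x y = (\<Sum>i\<in>UNIV. r $ i * (u $ i \<bullet> cross3 (x $ i) (y $ i)))"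

text \<open>On cosets of vectors tangent to \<open>polygons r\<close>, the value of \<open>symplectic_form\<close> does not
  depend on the representatives; \<open>the_elem\<close> picks that common value, here and below.\<close>

definition reduced_form ::
  "real^'n::finite \<Rightarrow> real^3^'n \<Rightarrow> (real^3^'n) set \<Rightarrow> (real^3^'n) set \<Rightarrow> real" where
  "reduced_form r u X Y = the_elem {symplectic_form r u x y |x y. x \<in> X \<and> y \<in> Y}"


section \<open>Bending flows\<close>

text \<open>A diagonal is a pair \<open>(i, j)\<close> with \<open>i < j\<close>, which fixes its orientation.\<close>

definition is_diagonal :: "'n::{finite,linorder} \<times> 'n \<Rightarrow> bool" where
  "is_diagonal = (\<lambda>(i, j). i < j \<and> {i<..<j} \<noteq> {} \<and> \<not> ({..<i} = {} \<and> {j<..} = {}))"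

text \<open>Disjointness is tested in the regular \<open>n\<close>-gon. The interior part of a diagonal of a convex
  polygon is the open segment between its end points.\<close>

definition ngon_vertex :: "'n::{finite,linorder} \<Rightarrow> complex" where
  "ngon_vertex i = cis (2 * pi * real (card {..<i}) / real CARD('n))"

definition disjoint_diagonals :: "'n::{finite,linorder} \<times> 'n \<Rightarrow> 'n \<times> 'n \<Rightarrow> bool" where
  "disjoint_diagonals = (\<lambda>(i, j) (k, l).
     open_segment (ngon_vertex i) (ngon_vertex j) \<inter>
     open_segment (ngon_vertex k) (ngon_vertex l) = {})"

definition diagonal_vector ::
  "real^'n::{finite,linorder} \<Rightarrow> 'n \<times> 'n \<Rightarrow> real^3^'n::{finite,linorder} \<Rightarrow> real^3" where
  "diagonal_vector r = (\<lambda>(i, j) u. \<Sum>k\<in>{i..<j}. r $ k *\<^sub>R u $ k)"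

definition bending_lift ::
  "real^'n::{finite,linorder} \<Rightarrow> 'n \<times> 'n \<Rightarrow> real^3^'n::{finite,linorder} \<Rightarrow> real" where
  "bending_lift r e u = (norm (diagonal_vector r e u))\<^sup>2 / 2"

definition bending ::
  "real^'n::{finite,linorder} \<Rightarrow> 'n \<times> 'n \<Rightarrow> (real^3^'n::{finite,linorder}) set \<Rightarrow> real" where
  "bending r e p = the_elem (bending_lift r e ` p)"

definition bending_differential ::
  "real^'n::{finite,linorder} \<Rightarrow> 'n \<times> 'n \<Rightarrow> real^3^'n::{finite,linorder} \<Rightarrow> (real^3^'n::{finite,linorder}) set \<Rightarrow> real" where
  "bending_differential r e u X =
     the_elem (frechet_derivative (bending_lift r e) (at u) ` X)"

text \<open>The diagonals are \<open>d 1, \<dots>, d (n - 3)\<close>; other values of \<open>d\<close> are irrelevant.\<close>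

definition bending_system :: "(nat \<Rightarrow> 'n::{finite,linorder} \<times> 'n) \<Rightarrow> bool" where
  "bending_system d \<longleftrightarrow>
     (\<forall>k\<in>{1..CARD('n) - 3}. is_diagonal (d k)) \<and>
     inj_on d {1..CARD('n) - 3} \<and>
     (\<forall>k\<in>{1..CARD('n) - 3}. \<forall>l\<in>{1..CARD('n) - 3}. k \<noteq> l \<longrightarrow> disjoint_diagonals (d k) (d l))"

definition singular_point ::
  "real^'n::{finite,linorder} \<Rightarrow> (nat \<Rightarrow> 'n \<times> 'n) \<Rightarrow> (real^3^'n::{finite,linorder}) set \<Rightarrow> bool" where
  "singular_point r d p \<longleftrightarrow> p \<in> moduli r \<and>
     (\<exists>u\<in>p. degenerate u \<or>
        (\<exists>a. (\<exists>k\<in>{1..CARD('n) - 3}. a k \<noteq> 0) \<and>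
             (\<forall>X\<in>moduli_tangent (moduli_nd r) u.
                (\<Sum>k\<in>{1..CARD('n) - 3}. a k * bending_differential r (d k) u X) = 0)))"

definition bending_fiber ::
  "real^'n::{finite,linorder} \<Rightarrow> (nat \<Rightarrow> 'n \<times> 'n) \<Rightarrow> (nat \<Rightarrow> real) \<Rightarrow> (real^3^'n::{finite,linorder}) set set" where
  "bending_fiber r d c = {p \<in> moduli r. \<forall>k\<in>{1..CARD('n) - 3}. bending r (d k) p = c k}"

definition singular_fiber ::
  "real^'n::{finite,linorder} \<Rightarrow> (nat \<Rightarrow> 'n \<times> 'n) \<Rightarrow> (real^3^'n::{finite,linorder}) set set \<Rightarrow> bool" where
  "singular_fiber r d N \<longleftrightarrow>
     (\<exists>c. N = bending_fiber r d c) \<and> (\<exists>p\<in>N. singular_point r d p)"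

end

theory Submission
  imports Defs
begin

text \<open>
  The idea is to read a fibre as a space of mechanisms. The \<open>n - 3\<close> disjoint diagonals cut the polygon
  into triangles, and fixing the bending Hamiltonians fixes the lengths of all their edges. So the
  preimage \<open>M\<close> of the fibre in the space of polygons consists of the ways to hinge together
  rigid triangles along their common edges, following a binary tree
  (\<open>bending_system_triangulation\<close>, \<open>isometry_class_bending\<close>). Each triangle has a
  configuration space that is homogeneous under the rotations: \<open>SO(3)\<close> if it is not flat, a sphere if it
  is flat, a point if it has shrunk to one. The same holds for each edge, so that restricting from a
  triangle to an edge is a submersion, and the fibre product \<open>M\<close> is a manifold although the
  length functions defining it have critical points.

  In place of fibre products the proof uses a retraction. Going down the tree, each triangle is solved
  for the lower edges nearest to given ones (\<open>place\<close>, \<open>fit\<close>); this is an explicit smooth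
  idempotent map near \<open>M\<close> with image \<open>M\<close> (\<open>fit_closed_retract\<close>). The image of a smooth
  idempotent map is a manifold, whose dimension is the rank of the derivative (\<open>smooth_retract_chart\<close>). This rank is locally constant, and \<open>M\<close> is connected,
  because the parts of the polygon on the two sides of an edge can be bent independently
  (\<open>connected_isometry_class\<close>).

  The group \<open>SO(3)\<close> is compact and acts on the compact set \<open>M\<close>, which gives the orbispace chart
  (\<open>orbispace_chart_lift\<close>). At a nondegenerate polygon two sides are linearly independent; turning
  them to a standard position is a smooth invariant idempotent map (\<open>align\<close>). Composed with the
  retraction onto \<open>M\<close>, it is a retraction onto a slice of dimension \<open>dim M - 3\<close>
  (\<open>aligned_retract\<close>), and the slices are charts of the quotient
  (\<open>moduli_submanifold_of_retract\<close>). If \<open>r\<close> is generic, all polygons are nondegenerate.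

  For the symplectic form, give an edge \<open>v\<close> with velocities \<open>a, b\<close> the number
  \<open>v \<bullet> (a \<times> b) / (v \<bullet> v)\<close>. The form \<open>\<omega>\<close> is its sum over the sides
  \<open>r\<^sub>i u\<^sub>i\<close>. In a rigid triangle the velocities are infinitesimal rotations and the numbers of its three edges add up to
  \<open>0\<close> (\<open>edge_form_additive\<close>). Summing over all triangles, the diagonals cancel, being traversed
  once in each direction, and \<open>\<omega>\<close> vanishes (\<open>symplectic_form_vanishes\<close>).
\<close>

section \<open>Calculus of smooth maps\<close>

lemma Ck_on_cong:
  assumes "open S" "\<And>x. x \<in> S \<Longrightarrow> f x = g x" "Ck_on k f S"
  shows "Ck_on k g S"
  using assms(2,3)
proof (induction k arbitrary: f g)
  case 0
  then show ?case by (metis Ck_on.simps(1) continuous_on_cong)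
next
  case (Suc k)
  have d: "(g has_derivative frechet_derivative f (at x)) (at x)" if "x \<in> S" for x
  proof (rule has_derivative_transform_within_open)
    show "(f has_derivative frechet_derivative f (at x)) (at x)"
      using Suc.prems(2) that by (simp add: frechet_derivative_works)
  qed (use assms(1) that Suc.prems(1) in auto)
  have e: "frechet_derivative g (at x) = frechet_derivative f (at x)" if "x \<in> S" for x
    using frechet_derivative_at[OF d[OF that]] by simp
  show ?case
    unfolding Ck_on.simps
  proof (intro conjI ballI allI)
    show "g differentiable at x" if "x \<in> S" for x
      using d[OF that] by (auto simp: differentiable_def)
    show "Ck_on k (\<lambda>x. frechet_derivative g (at x) v) S" for v
      using Suc.IH[of "\<lambda>x. frechet_derivative f (at x) v"] Suc.prems(2) e by simp
  qed
qed

lemma Ck_on_SucI: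
  assumes "open S" "\<And>x. x \<in> S \<Longrightarrow> (f has_derivative f' x) (at x)"
    and "\<And>v. Ck_on k (\<lambda>x. f' x v) S"
  shows "Ck_on (Suc k) f S"
  unfolding Ck_on.simps
proof (intro conjI ballI allI)
  show "f differentiable at x" if "x \<in> S" for x
    using assms(2)[OF that] by (auto simp: differentiable_def)
  show "Ck_on k (\<lambda>x. frechet_derivative f (at x) v) S" for v
    by (rule Ck_on_cong[OF assms(1) _ assms(3)[of v]])
       (metis frechet_derivative_at assms(2))
qed

lemma Ck_on_SucD:
  assumes "Ck_on (Suc k) f S" "x \<in> S"
  shows "(f has_derivative frechet_derivative f (at x)) (at x)"
  using assms by (simp add: frechet_derivative_works)

lemma Ck_on_Suc_imp: "Ck_on (Suc k) f S \<Longrightarrow> Ck_on k f S"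
proof (induction k arbitrary: f)
  case 0
  then show ?case
    by (simp add: continuous_at_imp_continuous_on differentiable_imp_continuous_within)
next
  case (Suc k)
  then show ?case by (metis Ck_on.simps(2))
qed

lemma Ck_on_subset: "Ck_on k f S \<Longrightarrow> T \<subseteq> S \<Longrightarrow> Ck_on k f T"
proof (induction k arbitrary: f)
  case 0
  then show ?case using continuous_on_subset by auto
next
  case (Suc k)
  then show ?case by (metis Ck_on.simps(2) subsetD)
qed

lemma Ck_on_const: "open S \<Longrightarrow> Ck_on k (\<lambda>x. c) S"
proof (induction k arbitrary: c)
  case (Suc k)
  show ?case
    by (rule Ck_on_SucI[where f'="\<lambda>x v. 0"]) (use Suc in auto)
qed auto

lemma Ck_on_linear:
  assumes "open S" "bounded_linear f"
  shows "Ck_on k f S"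
proof (cases k)
  case 0
  then show ?thesis
    using assms(2) linear_continuous_on by auto
next
  case (Suc j)
  show ?thesis
    unfolding Suc
    by (rule Ck_on_SucI[where f'="\<lambda>x. f"])
       (use assms bounded_linear_imp_has_derivative Ck_on_const in auto)
qed

lemma Ck_on_add:
  assumes "open S" "Ck_on k f S" "Ck_on k g S"
  shows "Ck_on k (\<lambda>x. f x + g x) S"
  using assms(2,3)
proof (induction k arbitrary: f g)
  case 0
  then show ?case by (auto intro: continuous_on_add)
next
  case (Suc k)
  show ?case
  proof (rule Ck_on_SucI[OF assms(1)])
    show "((\<lambda>x. f x + g x) has_derivative
        (\<lambda>v. frechet_derivative f (at x) v + frechet_derivative g (at x) v)) (at x)" if "x \<in> S" for x
      using Suc.prems that by (auto intro!: has_derivative_add Ck_on_SucD)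
    show "Ck_on k (\<lambda>x. frechet_derivative f (at x) v + frechet_derivative g (at x) v) S" for v
      using Suc.prems by (intro Suc.IH) auto
  qed
qed

text \<open>By the product rule the derivative is a sum of products of the same kind, with one factor
  differentiated.\<close>

lemma Ck_on_bilinear:
  assumes "open S" "bounded_bilinear B" "Ck_on k f S" "Ck_on k g S"
  shows "Ck_on k (\<lambda>x. B (f x) (g x)) S"
  using assms(3,4)
proof (induction k arbitrary: f g)
  case 0
  then show ?case using bounded_bilinear.continuous_on[OF assms(2)] by auto
next
  case (Suc k)
  show ?case
  proof (rule Ck_on_SucI[OF assms(1)])
    show "((\<lambda>x. B (f x) (g x)) has_derivative
        (\<lambda>v. B (f x) (frechet_derivative g (at x) v) + B (frechet_derivative f (at x) v) (g x)))
        (at x)" if "x \<in> S" for x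
      using Suc.prems that by (auto intro!: bounded_bilinear.FDERIV[OF assms(2)] Ck_on_SucD)
    show "Ck_on k (\<lambda>x. B (f x) (frechet_derivative g (at x) v) +
         B (frechet_derivative f (at x) v) (g x)) S" for v
      using Suc.prems Suc.prems[THEN Ck_on_Suc_imp]
      by (intro Ck_on_add Suc.IH assms(1)) auto
  qed
qed

lemma Ck_on_sum:
  assumes "open S" "\<And>i. i \<in> I \<Longrightarrow> Ck_on k (f i) S"
  shows "Ck_on k (\<lambda>x. \<Sum>i\<in>I. f i x) S"
  using assms(2)
  by (induction I rule: infinite_finite_induct) (auto intro: Ck_on_add Ck_on_const assms(1))

lemma Ck_on_compose:
  assumes "open S" "open T" "f ` S \<subseteq> T" "Ck_on k f S" "Ck_on k g T"
  shows "Ck_on k (\<lambda>x. g (f x)) S"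
  using assms(4,5)
proof (induction k arbitrary: g)
  case 0
  then show ?case
    using assms(3) by (auto intro: continuous_on_compose2)
next
  case (Suc k)
  have f: "Ck_on k f S" using Suc.prems Ck_on_Suc_imp by blast
  show ?case
  proof (rule Ck_on_SucI[OF assms(1)])
    fix x assume x: "x \<in> S"
    then have fx: "f x \<in> T" using assms(3) by auto
    have g: "(g has_derivative frechet_derivative g (at (f x))) (at (f x))"
      using Ck_on_SucD[OF Suc.prems(2) fx] .
    have "((\<lambda>x. g (f x)) has_derivative
        (\<lambda>v. frechet_derivative g (at (f x)) (frechet_derivative f (at x) v))) (at x)"
      using has_derivative_compose[OF Ck_on_SucD[OF Suc.prems(1) x]] g by auto
    moreover have "frechet_derivative g (at (f x)) w =
        (\<Sum>b\<in>Basis. (w \<bullet> b) *\<^sub>R frechet_derivative g (at (f x)) b)" for w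
    proof -
      interpret bounded_linear "frechet_derivative g (at (f x))"
        using g by (rule has_derivative_bounded_linear)
      have "frechet_derivative g (at (f x)) (\<Sum>b\<in>Basis. (w \<bullet> b) *\<^sub>R b) =
          (\<Sum>b\<in>Basis. (w \<bullet> b) *\<^sub>R frechet_derivative g (at (f x)) b)"
        by (simp only: sum scaleR)
      then show ?thesis by (simp only: euclidean_representation)
    qed
    \<comment> \<open>expanded in the basis, the chain rule is a sum of products, and so open to induction\<close>
    ultimately show "((\<lambda>x. g (f x)) has_derivative
        (\<lambda>v. \<Sum>b\<in>Basis. (frechet_derivative f (at x) v \<bullet> b) *\<^sub>R
          frechet_derivative g (at (f x)) b)) (at x)"
      by (rule has_derivative_eq_rhs[OF _ ext])
  next
    fix v
    show "Ck_on k (\<lambda>x. \<Sum>b\<in>Basis. (frechet_derivative f (at x) v \<bullet> b) *\<^sub>R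
          frechet_derivative g (at (f x)) b) S"
    proof (intro Ck_on_sum Ck_on_bilinear[OF _ bounded_bilinear_scaleR]
        Ck_on_bilinear[OF _ bounded_bilinear_inner] Ck_on_const assms(1))
      show "Ck_on k (\<lambda>x. frechet_derivative f (at x) v) S"
        using Suc.prems by simp
      show "Ck_on k (\<lambda>x. frechet_derivative g (at (f x)) b) S" for b
        using Suc.IH[of "\<lambda>y. frechet_derivative g (at y) b"] f Suc.prems by simp
    qed
  qed
qed

lemma Ck_on_inverse:
  assumes "open S" "0 \<notin> S"
  shows "Ck_on k (inverse :: real \<Rightarrow> real) S"
proof (induction k)
  case 0
  show ?case using assms by (auto intro!: continuous_on_inverse)
next
  case (Suc k)
  show ?case
  proof (rule Ck_on_SucI[OF assms(1)])
    show "(inverse has_derivative (\<lambda>v. - (inverse x * v * inverse x))) (at x)" if "x \<in> S" for x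
      by (rule has_derivative_inverse') (use assms(2) that in metis)
    have b: "Ck_on k (\<lambda>x. inverse x * v) S" for v
      by (rule Ck_on_bilinear[OF assms(1) bounded_bilinear_mult Suc Ck_on_const[OF assms(1)]])
    have m: "Ck_on k (\<lambda>x. - 1 * (inverse x * v * inverse x)) S" for v
      by (rule Ck_on_bilinear[OF assms(1) bounded_bilinear_mult Ck_on_const[OF assms(1)]
            Ck_on_bilinear[OF assms(1) bounded_bilinear_mult b Suc]])
    show "Ck_on k (\<lambda>x. - (inverse x * v * inverse x)) S" for v
      using m[of v] by simp
  qed
qed

lemma Ck_on_sqrt:
  assumes "open S" "S \<subseteq> {0<..}"
  shows "Ck_on k sqrt S"
proof (induction k)
  case 0
  show ?case
    using continuous_on_real_sqrt[OF continuous_on_id[of S]] by simp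
next
  case (Suc k)
  have i: "Ck_on k (inverse :: real \<Rightarrow> real) {0<..}"
    by (rule Ck_on_inverse) auto
  have c: "Ck_on k (\<lambda>x. inverse (sqrt x)) S"
    by (rule Ck_on_compose[OF assms(1) _ _ Suc i]) (use assms(2) in auto)
  show ?case
  proof (rule Ck_on_SucI[OF assms(1)])
    show "(sqrt has_derivative (\<lambda>v. inverse (sqrt x) / 2 * v)) (at x)" if "x \<in> S" for x
    proof -
      have "x > 0" using assms that by auto
      then have "(sqrt has_real_derivative (inverse (sqrt x) / 2)) (at x)"
        by (rule DERIV_real_sqrt)
      then show ?thesis
        unfolding has_field_derivative_def by (simp only:)
    qed
    have "Ck_on k (\<lambda>x. inverse (sqrt x) * (v / 2)) S" for v
      by (rule Ck_on_bilinear[OF assms(1) bounded_bilinear_mult c Ck_on_const[OF assms(1)]])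
    then show "Ck_on k (\<lambda>x. inverse (sqrt x) / 2 * v) S" for v
      by simp
  qed
qed

lemma Ck_on_locally:
  assumes "\<And>x. x \<in> S \<Longrightarrow> \<exists>U. x \<in> U \<and> open U \<and> Ck_on k f U"
  shows "Ck_on k f S"
  using assms
proof (induction k arbitrary: f)
  case 0
  show ?case
    unfolding Ck_on.simps
  proof (rule continuous_at_imp_continuous_on, rule ballI)
    fix x assume "x \<in> S"
    from 0[OF this] obtain U where "x \<in> U" "open U" "Ck_on 0 f U" by blast
    then show "isCont f x" by (simp add: continuous_on_eq_continuous_at)
  qed
next
  case (Suc k)
  show ?case
    unfolding Ck_on.simps
  proof (intro conjI ballI allI)
    show "f differentiable at x" if x: "x \<in> S" for x
    proof -
      obtain U where "x \<in> U" "Ck_on (Suc k) f U" using Suc.prems[OF x] by blast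
      then show ?thesis by simp
    qed
    show "Ck_on k (\<lambda>x. frechet_derivative f (at x) v) S" for v
    proof (rule Suc.IH)
      fix x assume "x \<in> S"
      from Suc.prems[OF this] obtain U where U: "x \<in> U" "open U" "Ck_on (Suc k) f U" by blast
      then show "\<exists>U. x \<in> U \<and> open U \<and> Ck_on k (\<lambda>x. frechet_derivative f (at x) v) U"
        by (intro exI[of _ U]) simp
    qed
  qed
qed

text \<open>Smoothness at a point, that is on some neighbourhood of it. Working with germs spares the
  bookkeeping of domains: the operations below only ask for conditions at the point itself.\<close>

definition smooth_at :: "('a::euclidean_space \<Rightarrow> 'b::euclidean_space) \<Rightarrow> 'a \<Rightarrow> bool" where
  "smooth_at f x \<longleftrightarrow> (\<exists>U. x \<in> U \<and> smooth_on f U)"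

lemma smooth_on_imp_continuous_on: "smooth_on f S \<Longrightarrow> continuous_on S f"
  unfolding smooth_on_def using Ck_on.simps(1)[of f S] by blast

lemma smooth_on_imp_at: "smooth_on f U \<Longrightarrow> x \<in> U \<Longrightarrow> smooth_at f x"
  by (auto simp: smooth_at_def)

lemma smooth_at_imp_on:
  assumes "open S" "\<And>x. x \<in> S \<Longrightarrow> smooth_at f x"
  shows "smooth_on f S"
  unfolding smooth_on_def
proof (intro conjI allI assms(1) Ck_on_locally)
  show "\<exists>U. x \<in> U \<and> open U \<and> Ck_on k f U" if "x \<in> S" for x k
    using assms(2)[OF that] by (auto simp: smooth_at_def smooth_on_def)
qed

lemma smooth_on_iff: "smooth_on f S \<longleftrightarrow> open S \<and> (\<forall>x\<in>S. smooth_at f x)"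
  by (meson smooth_at_imp_on smooth_on_def smooth_on_imp_at)

lemma eventually_smooth_at: "smooth_at f x \<Longrightarrow> eventually (smooth_at f) (nhds x)"
  unfolding eventually_nhds smooth_at_def using smooth_on_def by auto

lemma smooth_at_cong:
  assumes "smooth_at f x" "eventually (\<lambda>y. f y = g y) (nhds x)"
  shows "smooth_at g x"
proof -
  obtain U where U: "x \<in> U" "smooth_on f U" using assms(1) by (auto simp: smooth_at_def)
  obtain V where V: "open V" "x \<in> V" "\<And>y. y \<in> V \<Longrightarrow> f y = g y"
    using assms(2) by (auto simp: eventually_nhds)
  have "smooth_on g (U \<inter> V)"
    unfolding smooth_on_def
  proof (intro conjI allI)
    show o: "open (U \<inter> V)" using U V by (auto simp: smooth_on_def)
    show "Ck_on k g (U \<inter> V)" for k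
      by (rule Ck_on_cong[OF o, of f]) (use U V in \<open>auto simp: smooth_on_def intro: Ck_on_subset\<close>)
  qed
  then show ?thesis using U V by (auto simp: smooth_at_def)
qed

lemma smooth_at_has_derivative:
  "smooth_at f x \<Longrightarrow> (f has_derivative frechet_derivative f (at x)) (at x)"
  unfolding smooth_at_def smooth_on_def using Ck_on_SucD by blast

lemma smooth_at_isCont: "smooth_at f x \<Longrightarrow> isCont f x"
  using smooth_at_has_derivative has_derivative_continuous by blast

lemma smooth_at_const [intro, simp]: "smooth_at (\<lambda>x. c) x"
  unfolding smooth_at_def smooth_on_def by (rule exI[of _ UNIV]) (auto intro: Ck_on_const)

lemma smooth_at_linear: "bounded_linear f \<Longrightarrow> smooth_at f x"
  unfolding smooth_at_def smooth_on_def by (rule exI[of _ UNIV]) (auto intro: Ck_on_linear)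

lemma smooth_at_ident [intro, simp]: "smooth_at (\<lambda>x. x) x"
  by (rule smooth_at_linear) (rule bounded_linear_ident)

lemma smooth_at_compose:
  assumes "smooth_at f x" "smooth_at g (f x)"
  shows "smooth_at (\<lambda>x. g (f x)) x"
proof -
  obtain U where U: "x \<in> U" "smooth_on f U" using assms(1) by (auto simp: smooth_at_def)
  obtain V where V: "f x \<in> V" "smooth_on g V" using assms(2) by (auto simp: smooth_at_def)
  have "continuous_on U f" using U(2) unfolding smooth_on_def by (metis Ck_on.simps(1))
  then have o: "open (U \<inter> f -` V)"
    using U(2) V(2) by (simp add: continuous_open_preimage smooth_on_def)
  have "smooth_on (\<lambda>x. g (f x)) (U \<inter> f -` V)"
    unfolding smooth_on_def
  proof (intro conjI allI o)
    fix k
    have "Ck_on k f (U \<inter> f -` V)"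
      by (rule Ck_on_subset[of k f U]) (use U(2) in \<open>auto simp: smooth_on_def\<close>)
    show "Ck_on k (\<lambda>x. g (f x)) (U \<inter> f -` V)"
      by (rule Ck_on_compose[OF o _ _ \<open>Ck_on k f _\<close>, where T=V]) (use V(2) in \<open>auto simp: smooth_on_def\<close>)
  qed
  then show ?thesis using U V unfolding smooth_at_def by (intro exI[of _ "U \<inter> f -` V"]) auto
qed

lemma smooth_at_compose_linear:
  "bounded_linear g \<Longrightarrow> smooth_at f x \<Longrightarrow> smooth_at (\<lambda>x. g (f x)) x"
  by (rule smooth_at_compose) (auto intro: smooth_at_linear)

lemma smooth_at_bilinear:
  assumes "bounded_bilinear B" "smooth_at f x" "smooth_at g x"
  shows "smooth_at (\<lambda>x. B (f x) (g x)) x"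
proof -
  obtain U V where "x \<in> U" "smooth_on f U" "x \<in> V" "smooth_on g V"
    using assms by (auto simp: smooth_at_def)
  then have "smooth_on (\<lambda>x. B (f x) (g x)) (U \<inter> V)" "x \<in> U \<inter> V"
    unfolding smooth_on_def
    by (auto intro!: Ck_on_bilinear[OF _ assms(1)] intro: Ck_on_subset[of _ f U] Ck_on_subset[of _ g V])
  then show ?thesis by (auto simp: smooth_at_def)
qed

lemma smooth_at_add [intro]:
  assumes "smooth_at f x" "smooth_at g x"
  shows "smooth_at (\<lambda>x. f x + g x) x"
proof -
  obtain U V where "x \<in> U" "smooth_on f U" "x \<in> V" "smooth_on g V"
    using assms by (auto simp: smooth_at_def)
  then have "smooth_on (\<lambda>x. f x + g x) (U \<inter> V)" "x \<in> U \<inter> V"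
    unfolding smooth_on_def
    by (auto intro!: Ck_on_add intro: Ck_on_subset[of _ f U] Ck_on_subset[of _ g V])
  then show ?thesis by (auto simp: smooth_at_def)
qed

lemmas smooth_at_scaleR [intro] = smooth_at_bilinear[OF bounded_bilinear_scaleR]
lemma smooth_at_mult [intro]:
  fixes f :: "'a::euclidean_space \<Rightarrow> real"
  shows "smooth_at f x \<Longrightarrow> smooth_at g x \<Longrightarrow> smooth_at (\<lambda>x. f x * g x) x"
  by (rule smooth_at_bilinear[OF bounded_bilinear_mult])

lemmas smooth_at_inner [intro] = smooth_at_bilinear[OF bounded_bilinear_inner]
lemmas smooth_at_cross [intro] =
  smooth_at_bilinear[OF bilinear_conv_bounded_bilinear[THEN iffD1, OF bilinear_cross]]

lemma smooth_at_minus [intro]: "smooth_at f x \<Longrightarrow> smooth_at (\<lambda>x. - f x) x"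
  by (rule smooth_at_compose_linear) (auto intro: bounded_linear_minus bounded_linear_ident)

lemma smooth_at_diff [intro]: "smooth_at f x \<Longrightarrow> smooth_at g x \<Longrightarrow> smooth_at (\<lambda>x. f x - g x) x"
  using smooth_at_add[OF _ smooth_at_minus, of f x g] by simp

lemma smooth_at_sum [intro]:
  "(\<And>i. i \<in> I \<Longrightarrow> smooth_at (f i) x) \<Longrightarrow> smooth_at (\<lambda>x. \<Sum>i\<in>I. f i x) x"
  by (induction I rule: infinite_finite_induct) auto

lemma smooth_at_inverse [intro]:
  fixes f :: "'a::euclidean_space \<Rightarrow> real"
  shows "smooth_at f x \<Longrightarrow> f x \<noteq> 0 \<Longrightarrow> smooth_at (\<lambda>x. inverse (f x)) x"
  by (erule smooth_at_compose)
     (auto simp: smooth_at_def smooth_on_def intro!: exI[of _ "- {0}"] Ck_on_inverse)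

lemma smooth_at_divide [intro]:
  fixes f :: "'a::euclidean_space \<Rightarrow> real"
  shows "smooth_at f x \<Longrightarrow> smooth_at g x \<Longrightarrow> g x \<noteq> 0 \<Longrightarrow> smooth_at (\<lambda>x. f x / g x) x"
  unfolding divide_inverse by auto

lemma smooth_at_norm [intro]:
  assumes "smooth_at f x" "f x \<noteq> 0"
  shows "smooth_at (\<lambda>x. norm (f x)) x"
proof -
  have "smooth_at sqrt (f x \<bullet> f x)"
    unfolding smooth_at_def smooth_on_def using assms(2)
    by (intro exI[of _ "{0<..}"]) (auto intro: Ck_on_sqrt)
  then show ?thesis
    unfolding norm_eq_sqrt_inner using assms(1)
    by (intro smooth_at_compose[of "\<lambda>x. f x \<bullet> f x" x sqrt]) auto
qed

lemma smooth_at_sgn [intro]: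
  assumes "smooth_at f x" "f x \<noteq> 0"
  shows "smooth_at (\<lambda>x. sgn (f x)) x"
  unfolding sgn_div_norm using assms by (intro smooth_at_scaleR smooth_at_inverse smooth_at_norm) auto

lemma smooth_at_vec_nth [intro]:
  fixes f :: "'a::euclidean_space \<Rightarrow> ('b::euclidean_space)^'n"
  shows "smooth_at f x \<Longrightarrow> smooth_at (\<lambda>x. f x $ i) x"
  by (rule smooth_at_compose_linear) (auto intro: bounded_linear_vec_nth)

lemma smooth_at_vec_lambda [intro]:
  fixes f :: "'n::finite \<Rightarrow> 'a::euclidean_space \<Rightarrow> 'b::euclidean_space"
  assumes "\<And>i. smooth_at (f i) x"
  shows "smooth_at (\<lambda>x. \<chi> i. f i x) x"
proof -
  have "(\<lambda>x. \<chi> i. f i x) = (\<lambda>x. \<Sum>i\<in>UNIV. axis i (f i x))"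
    by (auto simp: fun_eq_iff vec_eq_iff axis_def sum.delta')
  moreover have "bounded_linear (axis i :: 'b \<Rightarrow> 'b^'n)" for i
    by (rule bounded_linearI') (auto simp: vec_eq_iff axis_def)
  ultimately show ?thesis
    using assms by (auto intro!: smooth_at_sum intro: smooth_at_compose_linear)
qed

section \<open>Smooth inverse functions and smooth retractions\<close>

text \<open>Where a factor vanishes, the derivative of the other one does not enter the product rule. This
  gives the first derivative of the inverse of a family of linear maps, of which only the continuity is known
  at that stage.\<close>

lemma has_derivative_mult_vanishing:
  fixes \<phi> :: "'a::real_normed_vector \<Rightarrow> real" and F :: "'a \<Rightarrow> 'b::real_normed_vector"
  assumes \<phi>: "(\<phi> has_derivative \<phi>') (at y)" and z: "\<phi> y = 0" and F: "isCont F y"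
  shows "((\<lambda>x. \<phi> x *\<^sub>R F x) has_derivative (\<lambda>v. \<phi>' v *\<^sub>R F y)) (at y)"
proof -
  have 1: "((\<lambda>x. \<phi> x *\<^sub>R F y) has_derivative (\<lambda>v. \<phi>' v *\<^sub>R F y)) (at y)"
    using \<phi> by (auto intro!: derivative_eq_intros)
  have 2: "((\<lambda>x. \<phi> x *\<^sub>R (F x - F y)) has_derivative (\<lambda>v. 0)) (at y)"
    unfolding has_derivative_at
  proof (intro conjI bounded_linear_zero)
    obtain K where K: "\<And>v. norm (\<phi>' v) \<le> norm v * K"
      using \<phi> has_derivative_bounded_linear bounded_linear.bounded by blast
    have l: "((\<lambda>h. norm (\<phi> (y + h) - \<phi> y - \<phi>' h) / norm h) \<longlongrightarrow> 0) (at 0)"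
      using \<phi> by (simp add: has_derivative_at)
    have c: "((\<lambda>h. norm (F (y + h) - F y)) \<longlongrightarrow> 0) (at 0)"
    proof -
      have "((\<lambda>h. F (y + h)) \<longlongrightarrow> F y) (at 0)"
        using F by (simp add: isCont_iff)
      then show ?thesis
        by (simp add: LIM_zero tendsto_norm_zero)
    qed
    show "((\<lambda>h. norm (\<phi> (y + h) *\<^sub>R (F (y + h) - F y) - \<phi> y *\<^sub>R (F y - F y) - 0) / norm h)
        \<longlongrightarrow> 0) (at 0)"
    proof (rule Lim_null_comparison)
      show "((\<lambda>h. (norm (\<phi> (y + h) - \<phi> y - \<phi>' h) / norm h + K) * norm (F (y + h) - F y))
          \<longlongrightarrow> 0) (at 0)"
        by (rule tendsto_eq_intros l c tendsto_const | simp)+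
      show "\<forall>\<^sub>F h in at 0. norm (norm (\<phi> (y + h) *\<^sub>R (F (y + h) - F y) - \<phi> y *\<^sub>R (F y - F y) - 0)
          / norm h) \<le> (norm (\<phi> (y + h) - \<phi> y - \<phi>' h) / norm h + K) * norm (F (y + h) - F y)"
      proof (rule eventually_at_filter[THEN iffD2], rule always_eventually, intro allI impI)
        fix h :: 'a assume "h \<noteq> 0"
        have "norm (\<phi> (y + h)) \<le> norm (\<phi> (y + h) - \<phi> y - \<phi>' h) + norm (\<phi>' h)"
          using z norm_triangle_ineq[of "\<phi> (y + h) - \<phi>' h" "\<phi>' h"] by simp
        also have "\<dots> \<le> norm (\<phi> (y + h) - \<phi> y - \<phi>' h) + norm h * K" using K[of h] by simp
        finally have "norm (\<phi> (y + h)) / norm h \<le> norm (\<phi> (y + h) - \<phi> y - \<phi>' h) / norm h + K"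
          using \<open>h \<noteq> 0\<close> by (simp add: divide_simps mult.commute)
        from mult_right_mono[OF this, of "norm (F (y + h) - F y)"]
        show "norm (norm (\<phi> (y + h) *\<^sub>R (F (y + h) - F y) - \<phi> y *\<^sub>R (F y - F y) - 0)
          / norm h) \<le> (norm (\<phi> (y + h) - \<phi> y - \<phi>' h) / norm h + K) * norm (F (y + h) - F y)"
          by simp
      qed
    qed
  qed
  show ?thesis
    using has_derivative_add[OF 1 2] by (simp add: scaleR_right_diff_distrib)
qed

text \<open>Inverting a smooth family of linear maps. Expanding \<open>L y (w y) = v\<close> gives the derivative
  of \<open>w y = L y\<^sup>-\<^sup>1 v\<close> in terms of the derivative of \<open>L\<close> and of \<open>L y\<^sup>-\<^sup>1\<close> again, so
  that the order of differentiability climbs by induction. The lower bound on \<open>L y\<close>, uniform in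
  \<open>y\<close>, starts the induction with the continuity of \<open>w\<close>.\<close>

lemma Ck_on_linear_inverse:
  fixes L M :: "'a::euclidean_space \<Rightarrow> 'b::euclidean_space \<Rightarrow> 'b"
  assumes S: "open S"
    and lin: "\<And>y. y \<in> S \<Longrightarrow> linear (L y)" "\<And>y. y \<in> S \<Longrightarrow> linear (M y)"
    and LM: "\<And>y v. y \<in> S \<Longrightarrow> L y (M y v) = v" "\<And>y v. y \<in> S \<Longrightarrow> M y (L y v) = v"
    and bd: "\<And>y v. y \<in> S \<Longrightarrow> norm v \<le> C * norm (L y v)"
    and L: "\<And>b. Ck_on k (\<lambda>y. L y b) S"
  shows "Ck_on k (\<lambda>y. M y v) S"
  using L
proof (induction k arbitrary: v)
  have exp: "M y w = (\<Sum>b\<in>Basis. (w \<bullet> b) *\<^sub>R M y b)" if "y \<in> S" for y w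
  proof -
    have "M y (\<Sum>b\<in>Basis. (w \<bullet> b) *\<^sub>R b) = (\<Sum>b\<in>Basis. (w \<bullet> b) *\<^sub>R M y b)"
      by (simp only: linear_sum[OF lin(2)[OF that]] linear_scale[OF lin(2)[OF that]])
    then show ?thesis by (simp only: euclidean_representation)
  qed
  have cont: "isCont (\<lambda>y. M y v) y" if y: "y \<in> S" and c: "\<And>b. continuous_on S (\<lambda>y. L y b)" for y v
  proof -
    have Ly: "isCont (\<lambda>x. L x (M y v)) y"
      using c[of "M y v"] S y continuous_on_eq_continuous_at by blast
    have "((\<lambda>x. M x v - M y v) \<longlongrightarrow> 0) (at y)"
    proof (rule Lim_null_comparison)
      show "((\<lambda>x. C * norm (L y (M y v) - L x (M y v))) \<longlongrightarrow> 0) (at y)"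
        using Ly unfolding isCont_def by (auto intro!: tendsto_eq_intros)
      show "\<forall>\<^sub>F x in at y. norm (M x v - M y v) \<le> C * norm (L y (M y v) - L x (M y v))"
        unfolding eventually_at_topological
      proof (intro exI[of _ S] conjI S y ballI impI)
        fix x assume "x \<in> S"
        then show "norm (M x v - M y v) \<le> C * norm (L y (M y v) - L x (M y v))"
          using bd[of x "M x v - M y v"] y by (simp add: linear_diff[OF lin(1)] LM)
      qed
    qed
    then show ?thesis unfolding isCont_def by (simp add: LIM_zero_iff)
  qed
  {
    case 0
    then show ?case
      using cont by (auto intro: continuous_at_imp_continuous_on)
  next
    case (Suc k)
    have IH: "Ck_on k (\<lambda>y. M y v) S" for v
      using Suc.IH Suc.prems Ck_on_Suc_imp by blast
    define D where "D b y z = frechet_derivative (\<lambda>y. L y b) (at y) z" for b y z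
    have c: "continuous_on S (\<lambda>y. L y b)" for b
      by (intro continuous_at_imp_continuous_on ballI has_derivative_continuous[OF Ck_on_SucD[OF Suc.prems]])
    have D: "((\<lambda>y. L y w) has_derivative D w y) (at y)" if "y \<in> S" for y w
      using Ck_on_SucD[OF Suc.prems that] by (simp add: D_def[abs_def])
    show ?case
    proof (rule Ck_on_SucI[OF S])
      fix y assume y: "y \<in> S"
      let ?w = "M y v"
      have "((\<lambda>x. ?w + (\<Sum>b\<in>Basis. ((L y ?w - L x ?w) \<bullet> b) *\<^sub>R M x b)) has_derivative
          (\<lambda>z. \<Sum>b\<in>Basis. ((- D ?w y z) \<bullet> b) *\<^sub>R M y b)) (at y)"
        by (rule derivative_eq_intros has_derivative_mult_vanishing cont[OF y c] D[OF y] refl | simp)+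
      then have 1: "((\<lambda>x. M x v) has_derivative
          (\<lambda>z. \<Sum>b\<in>Basis. ((- D ?w y z) \<bullet> b) *\<^sub>R M y b)) (at y)"
      proof (rule has_derivative_transform_within_open[OF _ S y])
        show "?w + (\<Sum>b\<in>Basis. ((L y ?w - L x ?w) \<bullet> b) *\<^sub>R M x b) = M x v" if "x \<in> S" for x
          unfolding exp[OF that, symmetric]
          by (simp add: LM that y linear_diff[OF lin(2)])
      qed
      have 2: "D ?w y z = (\<Sum>b\<in>Basis. (?w \<bullet> b) *\<^sub>R D b y z)" for z
      proof -
        have "((\<lambda>x. \<Sum>b\<in>Basis. (?w \<bullet> b) *\<^sub>R L x b) has_derivative
            (\<lambda>z. \<Sum>b\<in>Basis. (?w \<bullet> b) *\<^sub>R D b y z)) (at y)"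
          by (auto intro!: derivative_eq_intros D y)
        then have "((\<lambda>x. L x ?w) has_derivative
            (\<lambda>z. \<Sum>b\<in>Basis. (?w \<bullet> b) *\<^sub>R D b y z)) (at y)"
        proof (rule has_derivative_transform_within_open[OF _ S y])
          show "(\<Sum>b\<in>Basis. (?w \<bullet> b) *\<^sub>R L x b) = L x ?w" if "x \<in> S" for x
          using linear_sum[OF lin(1)[OF that], of "\<lambda>b. (?w \<bullet> b) *\<^sub>R b" Basis]
          by (simp add: linear_scale[OF lin(1)[OF that]] euclidean_representation)
        qed
        then show ?thesis using has_derivative_unique[OF D[OF y]] by metis
      qed
      show "((\<lambda>x. M x v) has_derivative (\<lambda>z. \<Sum>b\<in>Basis. ((- 1 *\<^sub>R
          (\<Sum>c\<in>Basis. (M y v \<bullet> c) *\<^sub>R D c y z)) \<bullet> b) *\<^sub>R M y b)) (at y)"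
        using 1 unfolding 2 by simp
    next
      fix z
      have "Ck_on k (\<lambda>y. D b y z) S" for b
        using Suc.prems[of b] by (simp add: D_def)
      then show "Ck_on k (\<lambda>y. \<Sum>b\<in>Basis. ((- 1 *\<^sub>R
          (\<Sum>c\<in>Basis. (M y v \<bullet> c) *\<^sub>R D c y z)) \<bullet> b) *\<^sub>R M y b) S"
        by (intro Ck_on_sum[OF S] Ck_on_bilinear[OF S bounded_bilinear_scaleR]
            Ck_on_bilinear[OF S bounded_bilinear_inner] Ck_on_const[OF S] IH)
    qed
  }
qed

lemma continuous_frechet_blinfun:
  assumes "smooth_on f U"
  obtains f' where "\<And>x. x \<in> U \<Longrightarrow> (f has_derivative blinfun_apply (f' x)) (at x)"
    "continuous_on U f'"
proof
  let ?f' = "\<lambda>x. Blinfun (frechet_derivative f (at x))"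
  have d: "(f has_derivative frechet_derivative f (at x)) (at x)" if "x \<in> U" for x
    using assms smooth_at_has_derivative smooth_on_imp_at that by blast
  show d': "(f has_derivative blinfun_apply (?f' x)) (at x)" if "x \<in> U" for x
    using d[OF that] has_derivative_bounded_linear bounded_linear_Blinfun_apply by metis
  have a: "blinfun_apply (?f' x) = frechet_derivative f (at x)" if "x \<in> U" for x
    using d[OF that] has_derivative_bounded_linear bounded_linear_Blinfun_apply by blast
  show "continuous_on U ?f'"
  proof (rule continuous_on_blinfun_componentwise)
    fix i
    have "Ck_on (Suc 0) f U" using assms unfolding smooth_on_def by blast
    then have "continuous_on U (\<lambda>x. frechet_derivative f (at x) i)" by simp
    then show "continuous_on U (\<lambda>x. blinfun_apply (?f' x) i)"
      by (rule continuous_on_eq) (simp add: a)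
  qed
qed

text \<open>The derivative of the inverse is the inverse of the derivative, so that smoothness follows from the
  \<open>C\<^sup>1\<close> inverse function theorem by means of \<open>Ck_on_linear_inverse\<close>. The neighbourhood is taken
  so small that the derivative of \<open>h\<close> is at distance at most \<open>1/2\<close> from the identity, hence bounded
  below. The predicate \<open>P\<close> stands for further conditions on the neighbourhood.\<close>

lemma smooth_inverse_function:
  fixes h :: "'a::euclidean_space \<Rightarrow> 'a"
  assumes h: "smooth_at h x0" and id: "(h has_derivative (\<lambda>v. v)) (at x0)"
    and ev: "eventually P (nhds x0)"
  obtains U V g where "open U" "x0 \<in> U" "open V" "h x0 \<in> V" "homeomorphism U V h g"
    "smooth_on g V" "\<And>x. x \<in> U \<Longrightarrow> P x"
proof -
  obtain O1 where O1: "x0 \<in> O1" "smooth_on h O1" using h by (auto simp: smooth_at_def)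
  obtain O2 where O2: "open O2" "x0 \<in> O2" "\<And>x. x \<in> O2 \<Longrightarrow> P x"
    using ev by (auto simp: eventually_nhds)
  obtain h' where h': "\<And>x. x \<in> O1 \<Longrightarrow> (h has_derivative blinfun_apply (h' x)) (at x)"
    "continuous_on O1 h'" using continuous_frechet_blinfun[OF O1(2)] by blast
  have h0: "h' x0 = id_blinfun"
    by (rule blinfun_eqI) (metis h'(1)[OF O1(1)] id has_derivative_unique blinfun_apply_id_blinfun id_apply)
  have o1: "open O1" using O1(2) by (simp add: smooth_on_def)
  define B where "B = O1 \<inter> O2 \<inter> {x\<in>O1. h' x \<in> ball id_blinfun (1/2)}"
  have "open {x\<in>O1. h' x \<in> ball id_blinfun (1/2)}"
    using continuous_open_preimage[OF h'(2) o1 open_ball] by (simp only: vimage_def Int_def mem_Collect_eq)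
  then have B: "open B" "x0 \<in> B" "B \<subseteq> O1"
    unfolding B_def using o1 O1 O2 h0 by auto
  obtain U V g g' where g: "open U" "U \<subseteq> B" "x0 \<in> U" "open V" "h x0 \<in> V" "homeomorphism U V h g"
    "\<And>y. y \<in> V \<Longrightarrow> (g has_derivative (g' y)) (at y)"
    "\<And>y. y \<in> V \<Longrightarrow> g' y = inv (blinfun_apply (h' (g y)))"
    "\<And>y. y \<in> V \<Longrightarrow> bij (blinfun_apply (h' (g y)))"
    by (rule inverse_function_theorem[of B h h' x0 id_blinfun])
       (use B h' h0 continuous_on_subset in \<open>auto simp: blinfun_eqI\<close>)
  have gU: "g y \<in> U" if "y \<in> V" for y
    using g(6) that by (auto simp: homeomorphism_def)
  have bd: "norm v \<le> 2 * norm (h' (g y) v)" if "y \<in> V" for y v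
  proof -
    have "norm (id_blinfun - h' (g y)) \<le> 1/2"
      using gU[OF that] g(2) by (auto simp: B_def dist_norm less_imp_le)
    then have "norm ((id_blinfun - h' (g y)) v) \<le> 1/2 * norm v"
      by (meson norm_blinfun order_trans mult_right_mono norm_ge_zero)
    then have "norm (v - h' (g y) v) \<le> 1/2 * norm v"
      by (simp add: blinfun.diff_left)
    then show ?thesis using norm_triangle_ineq[of "v - h' (g y) v" "h' (g y) v"] by simp
  qed
  have Ck: "Ck_on k g V" for k
  proof (induction k)
    case 0
    then show ?case using g(6) by (simp add: homeomorphism_def)
  next
    case (Suc k)
    show ?case
    proof (rule Ck_on_SucI[OF g(4) g(7)])
      show "Ck_on k (\<lambda>y. g' y v) V" for v
      proof (rule Ck_on_linear_inverse[OF g(4), where L="\<lambda>y. blinfun_apply (h' (g y))"])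
        fix y assume y: "y \<in> V"
        show "linear (blinfun_apply (h' (g y)))" by (rule bounded_linear.linear[OF blinfun.bounded_linear_right])
        show "linear (g' y)" using g(7)[OF y] has_derivative_linear by blast
        show "h' (g y) (g' y v) = v" for v
          using g(8,9)[OF y] by (simp add: bij_is_surj surj_f_inv_f)
        show "g' y (h' (g y) v) = v" for v
          using g(8,9)[OF y] by (simp add: bij_is_inj inv_f_f)
        show "norm v \<le> 2 * norm (h' (g y) v)" for v using bd[OF y] .
      next
        fix b
        have "Ck_on k (\<lambda>y. frechet_derivative h (at (g y)) b) V"
        proof (rule Ck_on_compose[OF g(4) o1 _ Suc])
          show "g ` V \<subseteq> O1" using gU g(2) B(3) by auto
          have "Ck_on (Suc k) h O1" using O1(2) unfolding smooth_on_def by blast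
          then show "Ck_on k (\<lambda>x. frechet_derivative h (at x) b) O1" by simp
        qed
        then show "Ck_on k (\<lambda>y. h' (g y) b) V"
        proof (rule Ck_on_cong[OF g(4), rotated])
          fix y assume "y \<in> V"
          then show "frechet_derivative h (at (g y)) b = h' (g y) b"
            using gU g(2) B(3) by (metis frechet_derivative_at h'(1) subsetD)
        qed
      qed
    qed
  qed
  show ?thesis
    by (rule that[OF g(1,3,4,5,6)]) (use g Ck in \<open>auto simp: smooth_on_def B_def intro: O2(3)\<close>)
qed

text \<open>A retraction as a germ: near \<open>x\<close>, the set \<open>M\<close> is the image of the smooth idempotent map
  \<open>\<rho>\<close>, of which nothing is asked away from \<open>x\<close>.\<close>

definition smooth_retract_at :: "('a::euclidean_space \<Rightarrow> 'a) \<Rightarrow> 'a set \<Rightarrow> 'a \<Rightarrow> bool" where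
  "smooth_retract_at \<rho> M x \<longleftrightarrow> x \<in> M \<and> smooth_at \<rho> x \<and>
     (\<forall>\<^sub>F y in nhds x. \<rho> y \<in> M) \<and> (\<forall>\<^sub>F y in nhds x. y \<in> M \<longrightarrow> \<rho> y = y)"

lemma smooth_retract_at_fixed: "smooth_retract_at \<rho> M x \<Longrightarrow> \<rho> x = x"
  unfolding smooth_retract_at_def using eventually_nhds_x_imp_x by fastforce

lemma tendsto_nhds_nhds: "smooth_at f x \<Longrightarrow> filterlim f (nhds (f x)) (nhds x)"
  using smooth_at_isCont unfolding isCont_def tendsto_at_iff_tendsto_nhds by blast

lemma smooth_retract_derivative_idempotent:
  assumes "smooth_retract_at \<rho> M x" "(\<rho> has_derivative A) (at x)"
  shows "A (A v) = A v"
proof -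
  note a = assms(1)[unfolded smooth_retract_at_def]
  have r0: "\<rho> x = x" using assms(1) by (rule smooth_retract_at_fixed)
  have "eventually (\<lambda>y. \<rho> (\<rho> y) = \<rho> y) (nhds x)"
    using a tendsto_nhds_nhds[of \<rho> x, THEN filterlim_iff[THEN iffD1], rule_format,
        of "\<lambda>y. y \<in> M \<longrightarrow> \<rho> y = y"] r0
    by (auto elim: eventually_elim2)
  then have "eventually (\<lambda>y. (\<rho> \<circ> \<rho>) y = \<rho> y) (at x)"
    by (auto simp: eventually_at_filter elim: eventually_mono)
  moreover have "(\<rho> \<circ> \<rho> has_derivative A \<circ> A) (at x)"
    using diff_chain_at[OF assms(2), of \<rho> A] assms(2) r0 by simp
  ultimately have "(\<rho> has_derivative A \<circ> A) (at x)"
    using has_derivative_transform_eventually[of "\<rho> \<circ> \<rho>" _ x UNIV \<rho>] r0 by simp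
  then have "A \<circ> A = A" using assms(2) has_derivative_unique by blast
  then show ?thesis by (metis comp_apply)
qed

text \<open>A set that is locally the image of a smooth idempotent map is a manifold. With
  \<open>A = D\<rho>(x\<^sub>0)\<close>, itself idempotent, the map \<open>h x = A (\<rho> x) + (1 - A) (x - \<rho> x)\<close> has derivative
  \<open>A A + (1 - A) (1 - A) = 1\<close> at \<open>x\<^sub>0\<close>; it is \<open>A\<close> on the fixed points of \<open>\<rho>\<close>, and
  \<open>\<rho> \<circ> h\<^sup>-\<^sup>1\<close> is inverse to it on the range of \<open>A\<close>.\<close>

lemma smooth_retract_chart:
  fixes \<rho> :: "'a::euclidean_space \<Rightarrow> 'a"
  assumes ret: "smooth_retract_at \<rho> M x0" and der: "(\<rho> has_derivative A) (at x0)"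
  obtains U V g where "openin (top_of_set M) U" "x0 \<in> U" "openin (top_of_set (range A)) V"
    "homeomorphism U V A g" "smooth_map V g"
proof -
  have x0: "x0 \<in> M" and sm: "smooth_at \<rho> x0"
    and into: "eventually (\<lambda>x. \<rho> x \<in> M) (nhds x0)"
    and fixed: "eventually (\<lambda>x. x \<in> M \<longrightarrow> \<rho> x = x) (nhds x0)"
    using ret by (auto simp: smooth_retract_at_def)
  have linA: "bounded_linear A" using der by (rule has_derivative_bounded_linear)
  interpret A: bounded_linear A by (rule linA)
  have AA: "A (A v) = A v" for v by (rule smooth_retract_derivative_idempotent[OF ret der])
  define h where "h x = A (\<rho> x) + (x - \<rho> x) - A (x - \<rho> x)" for x
  have sh: "smooth_at h x0"
    unfolding h_def by (intro smooth_at_add smooth_at_diff smooth_at_compose_linear[OF linA] sm smooth_at_ident)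
  have dA: "((\<lambda>x. A (f x)) has_derivative (\<lambda>v. A (f' v))) (at x0)"
    if "(f has_derivative f') (at x0)" for f f' using A.has_derivative[OF that] .
  have dh: "(h has_derivative (\<lambda>v. v)) (at x0)"
  proof -
    have "(h has_derivative (\<lambda>v. A (A v) + (v - A v) - A (v - A v))) (at x0)"
      unfolding h_def[abs_def] by (intro has_derivative_add has_derivative_diff dA der has_derivative_ident)
    then show ?thesis by (simp add: A.diff AA)
  qed
  have ev: "eventually (\<lambda>x. \<rho> x \<in> M \<and> (x \<in> M \<longrightarrow> \<rho> x = x) \<and> smooth_at \<rho> x) (nhds x0)"
    using into fixed eventually_smooth_at[OF sm] by eventually_elim auto
  obtain U' V' g where g: "open U'" "x0 \<in> U'" "open V'" "h x0 \<in> V'" "homeomorphism U' V' h g"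
    "smooth_on g V'" and U': "\<And>x. x \<in> U' \<Longrightarrow> \<rho> x \<in> M \<and> (x \<in> M \<longrightarrow> \<rho> x = x) \<and> smooth_at \<rho> x"
    by (rule smooth_inverse_function[OF sh dh ev]) blast
  have hA: "h x = A x" if "x \<in> M \<inter> U'" for x
    using U'[of x] that by (simp add: h_def A.diff)
  have gU: "g y \<in> U'" if "y \<in> V'" for y using g(5) that by (auto simp: homeomorphism_def)
  have hg: "h (g y) = y" if "y \<in> V'" for y using g(5) that by (auto simp: homeomorphism_def)
  have gh: "g (h x) = x" if "x \<in> U'" for x using g(5) that by (auto simp: homeomorphism_def)
  have hV: "h x \<in> V'" if "x \<in> U'" for x using g(5) that by (auto simp: homeomorphism_def)
  have sg: "smooth_on (\<lambda>y. \<rho> (g y)) V'"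
    using g(3) by (intro smooth_at_imp_on) (auto intro!: smooth_at_compose[of g] smooth_on_imp_at[OF g(6)] simp: U' gU)
  have cg: "continuous_on V' (\<lambda>y. \<rho> (g y))"
    using sg unfolding smooth_on_def by (metis Ck_on.simps(1))
  define V where "V = {e \<in> range A. e \<in> V' \<and> \<rho> (g e) \<in> U'}"
  have Vo: "openin (top_of_set (range A)) V"
  proof -
    have "open (V' \<inter> (\<lambda>y. \<rho> (g y)) -` U')"
      by (rule continuous_open_preimage[OF cg g(3,1)])
    moreover have "V = range A \<inter> (V' \<inter> (\<lambda>y. \<rho> (g y)) -` U')" by (auto simp: V_def)
    ultimately show ?thesis by (auto simp: openin_open)
  qed
  have 1: "A x \<in> V" "\<rho> (g (A x)) = x" if "x \<in> M \<inter> U'" for x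
    using that hA[OF that] gh[of x] hV[of x] U'[of x] by (auto simp: V_def)
  have 2: "\<rho> (g e) \<in> M \<inter> U'" "A (\<rho> (g e)) = e" if "e \<in> V" for e
  proof -
    have e: "e \<in> V'" "\<rho> (g e) \<in> U'" "A e = e" using that AA by (auto simp: V_def)
    then show "\<rho> (g e) \<in> M \<inter> U'" using U' gU by auto
    have "A (h (g e)) = A (\<rho> (g e))" by (simp add: h_def A.diff A.add AA)
    then show "A (\<rho> (g e)) = e" using e hg by simp
  qed
  show ?thesis
  proof (rule that[of "M \<inter> U'" V "\<lambda>e. \<rho> (g e)"])
    show "openin (top_of_set M) (M \<inter> U')" using g(1) by (auto simp: openin_open)
    show "homeomorphism (M \<inter> U') V A (\<lambda>e. \<rho> (g e))"
    proof (rule homeomorphismI)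
      show "continuous_on (M \<inter> U') A" using linA linear_continuous_on by blast
      show "continuous_on V (\<lambda>e. \<rho> (g e))"
        by (rule continuous_on_subset[OF cg]) (auto simp: V_def)
    qed (use 1 2 in auto)
    show "smooth_map V (\<lambda>e. \<rho> (g e))"
      unfolding smooth_map_def using sg by (auto simp: V_def)
  qed (use x0 g Vo in auto)
qed

text \<open>Two projections at distance less than \<open>1\<close> have the same rank, so that the rank of
  \<open>D\<rho>\<close> is locally constant on \<open>M\<close>.\<close>

lemma rank_le_of_close_idempotent:
  fixes P Q :: "'a::euclidean_space \<Rightarrow> 'a"
  assumes "linear P" "linear Q" "\<And>v. Q (Q v) = Q v"
    and "\<And>v. v \<noteq> 0 \<Longrightarrow> norm (Q v - P v) < norm v"
  shows "dim (range Q) \<le> dim (range P)"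
proof -
  have "inj_on P (span (range Q))"
  proof -
    have s: "span (range Q) = range Q"
      by (simp add: assms(2) linear_subspace_image span_eq_iff[THEN iffD2] subspace_UNIV)
    show ?thesis
      unfolding s linear_inj_on_iff_eq_0[OF assms(1) linear_subspace_image[OF assms(2) subspace_UNIV]]
    proof (intro ballI impI, rule ccontr)
      fix v assume "v \<in> range Q" "P v = 0" "v \<noteq> 0"
      then have "Q v = v" using assms(3) by auto
      then show False using assms(4)[OF \<open>v \<noteq> 0\<close>] \<open>P v = 0\<close> by simp
    qed
  qed
  then have "dim (P ` range Q) = dim (range Q)"
    by (rule dim_image_eq[OF assms(1)])
  then show ?thesis
    using dim_subset[of "P ` range Q" "range P"] by auto
qed

lemma smooth_retract_rank_constant:
  assumes "connected M" and ret: "\<And>x. x \<in> M \<Longrightarrow> smooth_retract_at \<rho> M x"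
  obtains m where "\<And>x. x \<in> M \<Longrightarrow> dim (range (frechet_derivative \<rho> (at x))) = m"
proof -
  let ?r = "\<lambda>x. dim (range (frechet_derivative \<rho> (at x)))"
  have "?r x = ?r y" if "x \<in> M" "y \<in> M" for x y
  proof (rule connected_local_const[OF assms(1) that], rule ballI)
    fix x assume x: "x \<in> M"
    obtain U where U: "x \<in> U" "smooth_on \<rho> U"
      using ret[OF x] by (auto simp: smooth_retract_at_def smooth_at_def)
    obtain h' where h': "\<And>x. x \<in> U \<Longrightarrow> (\<rho> has_derivative blinfun_apply (h' x)) (at x)"
      "continuous_on U h'" using continuous_frechet_blinfun[OF U(2)] by blast
    have fd: "frechet_derivative \<rho> (at y) = blinfun_apply (h' y)" if "y \<in> U" for y
      using h'(1)[OF that] by (metis frechet_derivative_at)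
    have op: "open U" using U(2) by (simp add: smooth_on_def)
    then have c: "isCont h' x" using h'(2) U(1) continuous_on_eq_continuous_at by blast
    have "eventually (\<lambda>y. dist (h' y) (h' x) < 1) (at x within M)"
      using c[unfolded isCont_def] tendstoD[of h' "h' x" "at x" 1]
      by (auto elim: filter_leD[OF at_le, rotated])
    moreover have "eventually (\<lambda>y. y \<in> U) (at x within M)"
      using op U(1) eventually_at_topological by blast
    moreover have "eventually (\<lambda>y. y \<in> M) (at x within M)"
      by (simp add: eventually_at_filter)
    ultimately show "eventually (\<lambda>y. ?r x = ?r y) (at x within M)"
    proof eventually_elim
      case (elim y)
      have lin: "linear (blinfun_apply (h' z))" for z
        by (rule bounded_linear.linear[OF blinfun.bounded_linear_right])
      have idem: "h' z (h' z v) = h' z v" if "z \<in> M" "z \<in> U" for z v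
        by (rule smooth_retract_derivative_idempotent[OF ret h'(1)]) (use that in auto)
      have close: "norm (h' y v - h' x v) < norm v" if "v \<noteq> 0" for v
      proof -
        have "norm ((h' y - h' x) v) \<le> norm (h' y - h' x) * norm v" by (rule norm_blinfun)
        also have "\<dots> < 1 * norm v"
          by (rule mult_strict_right_mono) (use elim that in \<open>auto simp: dist_norm\<close>)
        finally show ?thesis by (simp add: blinfun.diff_left)
      qed
      show ?case
        unfolding fd[OF U(1)] fd[OF elim(2)]
        by (intro antisym rank_le_of_close_idempotent lin idem x U(1) elim(2,3) close)
           (use close in \<open>simp add: norm_minus_commute\<close>)
    qed
  qed
  then show ?thesis using that by metis
qed

unbundle cross3_syntax

section \<open>Rotations of three-dimensional space\<close>

text \<open>Rodrigues' formula for the rotation by the angle \<open>\<theta>\<close> about the unit vector \<open>n\<close>.\<close>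

definition rotation :: "real \<Rightarrow> real^3 \<Rightarrow> real^3 \<Rightarrow> real^3" where
  "rotation \<theta> n x = cos \<theta> *\<^sub>R x + sin \<theta> *\<^sub>R (n \<times> x) + ((1 - cos \<theta>) * (n \<bullet> x)) *\<^sub>R n"

lemma rotation_linear: "linear (rotation \<theta> n)"
  by (rule linearI) (auto simp: rotation_def algebra_simps cross_add_right cross_mult_right)

lemma rotation_zero [simp]: "rotation 0 n x = x"
  by (simp add: rotation_def)

lemma cross_self_cross: "norm n = 1 \<Longrightarrow> n \<times> (n \<times> x) = (n \<bullet> x) *\<^sub>R n - x"
  by (simp add: Lagrange dot_square_norm)

lemma rotation_inner:
  assumes n: "norm n = 1"
  shows "rotation \<theta> n x \<bullet> rotation \<theta> n y = x \<bullet> y"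
proof -
  have nn: "n \<bullet> n = 1" using n by (simp add: dot_square_norm)
  have c: "(n \<times> x) \<bullet> (n \<times> y) = x \<bullet> y - (n \<bullet> x) * (n \<bullet> y)"
    by (subst dot_cross) (simp add: nn inner_commute)
  have s: "x \<bullet> (n \<times> y) = - ((n \<times> x) \<bullet> y)"
    by (simp add: cross3_simps)
  have p: "sin \<theta> * sin \<theta> = 1 - cos \<theta> * cos \<theta>"
    using sin_cos_squared_add[of \<theta>] by (simp add: power2_eq_square)
  have "rotation \<theta> n x \<bullet> rotation \<theta> n y =
      cos \<theta> * cos \<theta> * (x \<bullet> y) + sin \<theta> * sin \<theta> * (x \<bullet> y - (n \<bullet> x) * (n \<bullet> y))
      + (2 * cos \<theta> * (1 - cos \<theta>) + (1 - cos \<theta>) * (1 - cos \<theta>)) * (n \<bullet> x) * (n \<bullet> y)"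
    unfolding rotation_def
    by (simp add: inner_add_left inner_add_right c s nn dot_cross_self inner_commute[of x n] algebra_simps)
  also have "\<dots> = x \<bullet> y" unfolding p by (simp add: algebra_simps)
  finally show ?thesis .
qed

lemma rotation_norm: "norm n = 1 \<Longrightarrow> norm (rotation \<theta> n x) = norm x"
  by (simp add: norm_eq_sqrt_inner rotation_inner)

lemma rotation_axis: "norm n = 1 \<Longrightarrow> rotation \<theta> n (c *\<^sub>R n) = c *\<^sub>R n"
  by (simp add: rotation_def cross_mult_right dot_square_norm algebra_simps flip: scaleR_add_left)

lemma rotation_double:
  assumes n: "norm n = 1"
  shows "rotation \<theta> n (rotation \<theta> n x) = rotation (2 * \<theta>) n x"
proof -
  have nn: "n \<bullet> n = 1" using n by (simp add: dot_square_norm)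
  have p: "sin \<theta> * sin \<theta> = 1 - cos \<theta> * cos \<theta>"
    using sin_cos_squared_add[of \<theta>] by (simp add: power2_eq_square)
  have i: "n \<bullet> rotation \<theta> n x = n \<bullet> x"
    by (simp add: rotation_def inner_add_right nn dot_cross_self algebra_simps)
  have ii: "n \<times> rotation \<theta> n x = cos \<theta> *\<^sub>R (n \<times> x) + sin \<theta> *\<^sub>R ((n \<bullet> x) *\<^sub>R n - x)"
    by (simp add: rotation_def cross_add_right cross_mult_right cross_self_cross[OF n])
  have "rotation \<theta> n (rotation \<theta> n x) =
      (cos \<theta> * cos \<theta> - sin \<theta> * sin \<theta>) *\<^sub>R x + (sin \<theta> * cos \<theta> + sin \<theta> * cos \<theta>) *\<^sub>R (n \<times> x)
      + ((cos \<theta> * (1 - cos \<theta>) + sin \<theta> * sin \<theta> + (1 - cos \<theta>)) * (n \<bullet> x)) *\<^sub>R n"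
  proof -
    define w where "w = n \<times> x"
    show ?thesis
      unfolding rotation_def[of \<theta> n "rotation \<theta> n x"] i ii
      unfolding rotation_def[of \<theta> n x] w_def[symmetric]
      by (simp add: vec_eq_iff algebra_simps)
  qed
  also have "\<dots> = rotation (2 * \<theta>) n x"
    unfolding rotation_def cos_double sin_double power2_eq_square p
    by (simp add: vec_eq_iff algebra_simps)
  finally show ?thesis .
qed

text \<open>A rotation is the square of the rotation by half the angle, so its determinant is a square.\<close>

lemma rotation_SO3:
  assumes n: "norm n = 1"
  shows "matrix (rotation \<theta> n) \<in> SO3"
proof -
  have o: "orthogonal_transformation (rotation \<theta> n)" for \<theta>
    unfolding orthogonal_transformation_def using rotation_linear rotation_inner[OF n] by blast
  have om: "orthogonal_matrix (matrix (rotation \<theta> n))" for \<theta>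
    using o orthogonal_transformation_matrix by blast
  have "rotation \<theta> n = rotation (\<theta>/2) n \<circ> rotation (\<theta>/2) n"
    using rotation_double[OF n, of "\<theta>/2"] by (auto simp: fun_eq_iff)
  then have "det (matrix (rotation \<theta> n)) = det (matrix (rotation (\<theta>/2) n)) * det (matrix (rotation (\<theta>/2) n))"
    by (simp add: matrix_compose[OF rotation_linear rotation_linear] det_mul)
  moreover have "det (matrix (rotation (\<theta>/2) n)) \<in> {1, -1}"
    using det_orthogonal_matrix[OF om] by blast
  ultimately show ?thesis
    using om by (auto simp: SO3_def rotation_matrix_def)
qed

lemma rotation_matrix_mult: "matrix (rotation \<theta> n) *v x = rotation \<theta> n x"
  by (simp add: matrix_works rotation_linear)

text \<open>The rotations about \<open>n\<close> act transitively on the circles with axis \<open>n\<close>.\<close>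

lemma rotation_transitive_about_axis:
  assumes n: "norm n = 1" and xy: "norm x = norm y" "n \<bullet> x = n \<bullet> y"
  obtains \<theta> where "rotation \<theta> n x = y"
proof -
  define a where "a = x - (n \<bullet> x) *\<^sub>R n"
  define b where "b = y - (n \<bullet> y) *\<^sub>R n"
  have nn: "n \<bullet> n = 1" using n by (simp add: dot_square_norm)
  have na: "n \<bullet> a = 0" "n \<bullet> b = 0" by (auto simp: a_def b_def inner_diff_right nn)
  have "a \<bullet> a = x \<bullet> x - (n \<bullet> x) * (n \<bullet> x)" "b \<bullet> b = y \<bullet> y - (n \<bullet> y) * (n \<bullet> y)"
    by (auto simp: a_def b_def inner_diff_right inner_diff_left nn inner_commute)
  then have ab: "a \<bullet> a = b \<bullet> b" using xy by (simp add: norm_eq)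
  show ?thesis
  proof (cases "a = 0")
    case True
    then have "b = 0" using ab by simp
    then have "x = y" using True xy by (simp add: a_def b_def)
    then show ?thesis using that[of 0] by simp
  next
    case False
    then have aa: "a \<bullet> a \<noteq> 0" by simp
    have w: "a \<times> b = (n \<bullet> (a \<times> b)) *\<^sub>R n"
    proof -
      have "n \<times> (a \<times> b) = 0" by (simp add: Lagrange na)
      then show ?thesis using cross_self_cross[OF n, of "a \<times> b"] by simp
    qed
    have "(a \<bullet> a) *\<^sub>R b = (a \<bullet> b) *\<^sub>R a + (a \<times> b) \<times> a"
      by (subst cross_skew[of "a \<times> b"]) (simp add: Lagrange)
    also have "(a \<times> b) \<times> a = (n \<bullet> (a \<times> b)) *\<^sub>R (n \<times> a)"
      by (subst w) (simp add: cross_mult_left)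
    finally have e: "(a \<bullet> a) *\<^sub>R b = (a \<bullet> b) *\<^sub>R a + (n \<bullet> (a \<times> b)) *\<^sub>R (n \<times> a)" .
    define c where "c = (a \<bullet> b) / (a \<bullet> a)"
    define s where "s = (n \<bullet> (a \<times> b)) / (a \<bullet> a)"
    have b: "b = c *\<^sub>R a + s *\<^sub>R (n \<times> a)"
      using arg_cong[OF e, of "\<lambda>v. v /\<^sub>R (a \<bullet> a)"] aa
      by (simp add: c_def s_def scaleR_add_right divide_inverse mult.commute)
    have cr: "(n \<times> a) \<bullet> (n \<times> a) = a \<bullet> a" by (subst dot_cross) (simp add: nn na)
    have "b \<bullet> b = (c * c + s * s) * (a \<bullet> a)"
      unfolding b by (simp add: inner_add_left inner_add_right cr dot_cross_self algebra_simps)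
    then have "c\<^sup>2 + s\<^sup>2 = 1" using ab aa by (simp add: power2_eq_square)
    then obtain \<theta> where t: "c = cos \<theta>" "s = sin \<theta>" using sincos_total_2pi by metis
    have "rotation \<theta> n x = rotation \<theta> n a + rotation \<theta> n ((n \<bullet> x) *\<^sub>R n)"
      by (simp add: a_def flip: linear_add[OF rotation_linear])
    also have "\<dots> = b + (n \<bullet> x) *\<^sub>R n"
      by (simp add: rotation_axis[OF n]) (simp add: rotation_def na b t)
    also have "\<dots> = y" using xy by (simp add: b_def)
    finally show ?thesis using that by blast
  qed
qed

text \<open>If \<open>v = 0\<close>, any axis orthogonal to \<open>x\<close> and \<open>y\<close> serves; otherwise the axis
  is \<open>v\<close>.\<close>

lemma rotation_transitive:
  fixes v x y :: "real^3"
  assumes "norm x = norm y" "v \<bullet> x = v \<bullet> y"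
  obtains \<theta> n where "norm n = 1" "rotation \<theta> n x = y" "\<And>t. rotation t n v = v"
proof (cases "v = 0")
  case False
  define n where "n = v /\<^sub>R norm v"
  have n: "norm n = 1" using False by (simp add: n_def)
  obtain \<theta> where "rotation \<theta> n x = y"
    by (rule rotation_transitive_about_axis[OF n assms(1)]) (use assms in \<open>auto simp: n_def\<close>)
  moreover have "rotation t n v = v" for t
    using rotation_axis[OF n, of t "norm v"] False by (simp add: n_def)
  ultimately show ?thesis using that n by blast
next
  case True
  have "dim {x, y} < DIM(real^3)"
    using dim_le_card'[of "{x, y}"] card_insert_le_m1[of 2 "{y}" x] by simp
  then obtain m where m: "m \<noteq> 0" "\<And>z. z \<in> span {x, y} \<Longrightarrow> orthogonal m z"
    using orthogonal_to_subspace_exists by blast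
  define n where "n = m /\<^sub>R norm m"
  have n: "norm n = 1" using m by (simp add: n_def)
  have "n \<bullet> x = 0" "n \<bullet> y = 0"
    using m(2)[of x] m(2)[of y] by (auto simp: n_def orthogonal_def span_base)
  then obtain \<theta> where "rotation \<theta> n x = y"
    by (metis rotation_transitive_about_axis n assms(1))
  then show ?thesis using that n True by (simp add: linear_0[OF rotation_linear])
qed

lemma continuous_on_rotation [continuous_intros]:
  fixes S :: "real set"
  shows "continuous_on S f \<Longrightarrow> continuous_on S (\<lambda>s. rotation (f s) n x)"
  unfolding rotation_def by (intro continuous_intros)

section \<open>Solving a triangle\<close>

text \<open>Given a triangle \<open>x\<^sub>0 + y\<^sub>0 = v\<^sub>0\<close>, possibly degenerate, and a vector \<open>v\<close> of the length
  of \<open>v\<^sub>0\<close>, the vector \<open>place x\<^sub>0 y\<^sub>0 v x\<close> is, for \<open>x\<close> off the line of \<open>v\<close>, the point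
  nearest to \<open>x\<close> among the first sides of the triangles with third side \<open>v\<close> that are congruent to the
  given one. The summand along \<open>v\<close> is determined by the lengths. The other one is free on a
  circle if \<open>v\<^sub>0 \<noteq> 0\<close>, and on a sphere if \<open>v\<^sub>0 = 0\<close>: division by zero then makes
  the first summand vanish and \<open>across v x\<close> equal to \<open>x\<close>. Circle and sphere shrink to a point if
  the given triangle is flat, respectively a point.\<close>

definition across :: "real^3 \<Rightarrow> real^3 \<Rightarrow> real^3" where
  "across v x = x - ((x \<bullet> v) / (v \<bullet> v)) *\<^sub>R v"

definition place :: "real^3 \<Rightarrow> real^3 \<Rightarrow> real^3 \<Rightarrow> real^3 \<Rightarrow> real^3" where
  "place x0 y0 v x =
     ((x0 \<bullet> (x0 + y0)) / ((x0 + y0) \<bullet> (x0 + y0))) *\<^sub>R v + norm (across (x0 + y0) x0) *\<^sub>R sgn (across v x)"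

lemma across_inner: "across v x \<bullet> v = 0"
  by (cases "v = 0") (auto simp: across_def inner_diff_left)

lemma norm_across: "(norm (across v x))\<^sup>2 = (norm x)\<^sup>2 - (x \<bullet> v)\<^sup>2 / (norm v)\<^sup>2"
proof -
  have "(norm (across v x))\<^sup>2 = across v x \<bullet> x"
    using across_inner[of v x] unfolding power2_norm_eq_inner
    by (metis (no_types, lifting) across_def diff_zero inner_diff_right inner_scaleR_right mult_zero_right)
  also have "\<dots> = x \<bullet> x - (x \<bullet> v)\<^sup>2 / (v \<bullet> v)"
    by (simp add: across_def inner_diff_left inner_commute[of v x] power2_eq_square)
  finally show ?thesis unfolding power2_norm_eq_inner .
qed

lemma inner_sum_from_norms:
  fixes x y :: "'a::real_inner"
  shows "x \<bullet> (x + y) = ((norm (x + y))\<^sup>2 + (norm x)\<^sup>2 - (norm y)\<^sup>2) / 2"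
  by (simp add: power2_norm_eq_inner inner_add_left inner_add_right inner_commute)

text \<open>The three lengths determine \<open>x \<bullet> v\<close>, hence the component of \<open>x\<close> along \<open>v\<close> and the length
  of the component across.\<close>

lemma place_fixed:
  assumes "norm v = norm (x0 + y0)" "norm x = norm x0" "norm (v - x) = norm y0"
  shows "place x0 y0 v x = x" and "norm (across v x) = norm (across (x0 + y0) x0)"
proof -
  have i: "x \<bullet> v = x0 \<bullet> (x0 + y0)"
    using inner_sum_from_norms[of x "v - x"] inner_sum_from_norms[of x0 y0] assms by simp
  have "(norm (across v x))\<^sup>2 = (norm (across (x0 + y0) x0))\<^sup>2"
    unfolding norm_across i using assms by simp
  then show n: "norm (across v x) = norm (across (x0 + y0) x0)" by simp
  have "(x0 + y0) \<bullet> (x0 + y0) = v \<bullet> v" using assms(1) by (simp add: norm_eq)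
  then have "place x0 y0 v x = ((x \<bullet> v) / (v \<bullet> v)) *\<^sub>R v + norm (across v x) *\<^sub>R sgn (across v x)"
    unfolding place_def n i by simp
  also have "norm (across v x) *\<^sub>R sgn (across v x) = across v x"
    by (cases "across v x = 0") (auto simp: sgn_div_norm)
  finally show "place x0 y0 v x = x" by (simp add: across_def)
qed

lemma place_lengths:
  assumes v: "norm v = norm (x0 + y0)" and w: "across (x0 + y0) x0 \<noteq> 0 \<Longrightarrow> across v x \<noteq> 0"
  shows "norm (place x0 y0 v x) = norm x0" "norm (v - place x0 y0 v x) = norm y0"
proof -
  let ?v = "x0 + y0" and ?p = "place x0 y0 v x"
  have vv: "?v \<bullet> ?v = v \<bullet> v" using v by (simp add: norm_eq)
  have s: "sgn (across v x) \<bullet> v = 0" by (simp add: sgn_div_norm across_inner)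
  have pv: "?p \<bullet> v = x0 \<bullet> ?v"
  proof (cases "v = 0")
    case True
    then have "?v = 0" using v by simp
    then show ?thesis using True by (simp only: inner_zero_right)
  next
    case False
    then show ?thesis unfolding place_def vv by (simp add: inner_add_left s)
  qed
  have sg: "(norm (across ?v x0))\<^sup>2 * (sgn (across v x) \<bullet> sgn (across v x)) = (norm (across ?v x0))\<^sup>2"
    using w by (cases "across ?v x0 = 0") (auto simp: norm_sgn dot_square_norm)
  have "(norm ?p)\<^sup>2 = (x0 \<bullet> ?v)\<^sup>2 / (norm v)\<^sup>2 + (norm (across ?v x0))\<^sup>2"
  proof -
    define c where "c = (x0 \<bullet> ?v) / (v \<bullet> v)"
    define \<beta> where "\<beta> = norm (across ?v x0)"
    define s where "s = sgn (across v x)"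
    have sv: "s \<bullet> v = 0" "v \<bullet> s = 0" using s by (auto simp: s_def inner_commute)
    have "(norm ?p)\<^sup>2 = c * c * (v \<bullet> v) + (norm (across ?v x0))\<^sup>2 * (sgn (across v x) \<bullet> sgn (across v x))"
      unfolding power2_norm_eq_inner[of ?p] unfolding place_def vv c_def[symmetric] \<beta>_def[symmetric] s_def[symmetric]
      by (simp add: inner_add_left inner_add_right sv power2_eq_square)
    moreover have "c * c * (v \<bullet> v) = (x0 \<bullet> ?v)\<^sup>2 / (norm v)\<^sup>2"
      unfolding c_def power2_norm_eq_inner by (simp add: power2_eq_square)
    ultimately show ?thesis using sg by simp
  qed
  also have "\<dots> = (norm x0)\<^sup>2" unfolding norm_across v by simp
  finally show p: "norm ?p = norm x0" by simp
  have "(norm (v - ?p))\<^sup>2 = (norm v)\<^sup>2 - 2 * (?p \<bullet> v) + (norm ?p)\<^sup>2"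
    unfolding power2_norm_eq_inner by (simp add: inner_diff_left inner_diff_right inner_commute)
  also have "\<dots> = (norm y0)\<^sup>2"
    unfolding pv p v inner_sum_from_norms by (simp add: field_simps)
  finally show "norm (v - ?p) = norm y0" by simp
qed

text \<open>The length of \<open>v u\<close> has to be constant because \<open>across v x\<close> is not continuous at \<open>v = 0\<close>.\<close>

lemma smooth_at_across:
  assumes x: "smooth_at x u0" and v: "smooth_at v u0"
    and nv: "eventually (\<lambda>u. norm (v u) = c) (nhds u0)"
  shows "smooth_at (\<lambda>u. across (v u) (x u)) u0"
proof (cases "c = 0")
  case True
  have "eventually (\<lambda>u. x u = across (v u) (x u)) (nhds u0)"
    using nv by eventually_elim (use True in \<open>simp add: across_def\<close>)
  then show ?thesis by (rule smooth_at_cong[OF x])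
next
  case False
  have "v u0 \<noteq> 0" using eventually_nhds_x_imp_x[OF nv] False by auto
  then show ?thesis
    unfolding across_def by (intro smooth_at_diff smooth_at_scaleR smooth_at_divide smooth_at_inner x v) auto
qed

text \<open>If the given triangle is a point, or flat with \<open>v\<^sub>0 \<noteq> 0\<close>, the factor in front of \<open>sgn\<close> is
  \<open>0\<close>, and \<open>sgn\<close> may fail to be smooth there.\<close>

lemma smooth_at_place:
  assumes x: "smooth_at x u0" and v: "smooth_at v u0"
    and nv: "eventually (\<lambda>u. norm (v u) = c) (nhds u0)"
    and w: "across (x0 + y0) x0 \<noteq> 0 \<Longrightarrow> across (v u0) (x u0) \<noteq> 0"
  shows "smooth_at (\<lambda>u. place x0 y0 (v u) (x u)) u0"
proof (cases "across (x0 + y0) x0 = 0")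
  case True
  show ?thesis
    unfolding place_def True by (simp add: smooth_at_scaleR v)
next
  case False
  show ?thesis
    unfolding place_def
    by (intro smooth_at_add smooth_at_scaleR smooth_at_const v smooth_at_sgn smooth_at_across[OF x v nv] w False)
qed

section \<open>The form carried by an edge of a triangle\<close>

text \<open>The area form of the sphere of radius \<open>norm v\<close> at \<open>v\<close>, divided by the radius. For \<open>v = 0\<close>
  it is \<open>0\<close>.\<close>

definition edge_form :: "real^3 \<Rightarrow> real^3 \<Rightarrow> real^3 \<Rightarrow> real" where
  "edge_form v a b = (v \<bullet> (a \<times> b)) / (v \<bullet> v)"

text \<open>The angular velocity \<open>\<xi>\<close> is found in the basis \<open>x, y, n\<close> with \<open>n = x \<times> y\<close>: its components
  along \<open>x\<close> and \<open>y\<close> come from the velocities normal to the triangle, \<open>n \<bullet> b\<close> and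
  \<open>n \<bullet> a\<close>, and its component along \<open>n\<close> from \<open>y \<bullet> a = - x \<bullet> b\<close>.\<close>

lemma rigid_motion_of_triangle:
  fixes x y a b :: "real^3"
  assumes "x \<times> y \<noteq> 0" and "x \<bullet> a = 0" "y \<bullet> b = 0" "(x + y) \<bullet> (a + b) = 0"
  obtains \<xi> where "a = \<xi> \<times> x" "b = \<xi> \<times> y"
proof -
  define n where "n = x \<times> y"
  have nn: "n \<bullet> n \<noteq> 0" using assms by (simp add: n_def)
  have ab: "y \<bullet> a = - (x \<bullet> b)" using assms(2-4) by (simp add: inner_add_left inner_add_right)
  have n0: "n \<bullet> x = 0" "n \<bullet> y = 0" "x \<bullet> n = 0" "y \<bullet> n = 0" by (auto simp: n_def dot_cross_self)
  define \<xi> where "\<xi> = ((n \<bullet> b) *\<^sub>R x - (n \<bullet> a) *\<^sub>R y + (y \<bullet> a) *\<^sub>R n) /\<^sub>R (n \<bullet> n)"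
  have eq: "z = z'" if "z \<bullet> x = z' \<bullet> x" "z \<bullet> y = z' \<bullet> y" "z \<bullet> n = z' \<bullet> n" for z z'
  proof -
    define d where "d = z - z'"
    have d: "d \<bullet> x = 0" "d \<bullet> y = 0" "d \<bullet> n = 0" using that by (auto simp: d_def inner_diff_left)
    have "d \<times> n = 0" unfolding n_def by (simp add: Lagrange d)
    then have "n \<times> (d \<times> n) = 0" by simp
    then have "(n \<bullet> n) *\<^sub>R d = 0" using d by (simp add: Lagrange inner_commute)
    then show ?thesis using nn by (simp add: d_def)
  qed
  have t: "n \<bullet> (y \<times> x) = - (n \<bullet> n)" "n \<bullet> (x \<times> y) = n \<bullet> n"
    by (simp_all add: n_def cross_skew[of y x])
  have tr: "(p \<times> q) \<bullet> q = 0" "(p \<times> q) \<bullet> p = 0" for p q :: "real^3" by (auto simp: dot_cross_self)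
  have nx: "(n \<times> x) \<bullet> y = n \<bullet> n" "(n \<times> y) \<bullet> x = - (n \<bullet> n)"
    unfolding n_def by (simp_all add: cross_triple cross_skew[of y x] inner_commute) (simp_all add: cross3_simps)
  have \<xi>x: "\<xi> \<times> x = (- (n \<bullet> a) *\<^sub>R (y \<times> x) + (y \<bullet> a) *\<^sub>R (n \<times> x)) /\<^sub>R (n \<bullet> n)"
    and \<xi>y: "\<xi> \<times> y = ((n \<bullet> b) *\<^sub>R (x \<times> y) + (y \<bullet> a) *\<^sub>R (n \<times> y)) /\<^sub>R (n \<bullet> n)"
    unfolding \<xi>_def by (simp_all add: cross_mult_left cross_add_left Cross3.left_diff_distrib)
  have orth: "(\<xi> \<times> x) \<bullet> x = 0" "(\<xi> \<times> y) \<bullet> y = 0" by (rule tr)+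
  have yx: "(y \<times> x) \<bullet> y = 0" "(y \<times> x) \<bullet> n = - (n \<bullet> n)" "(n \<times> x) \<bullet> n = 0"
    "(x \<times> y) \<bullet> x = 0" "(x \<times> y) \<bullet> n = n \<bullet> n" "(n \<times> y) \<bullet> n = 0"
    using t by (simp_all only: tr inner_commute[of "y \<times> x" n] inner_commute[of "x \<times> y" n])
  show ?thesis
  proof (rule that[of \<xi>])
    show "a = \<xi> \<times> x"
    proof (rule eq)
      show "a \<bullet> x = (\<xi> \<times> x) \<bullet> x" using assms(2) orth by (simp only: inner_commute[of a x])
      show "a \<bullet> y = (\<xi> \<times> x) \<bullet> y" "a \<bullet> n = (\<xi> \<times> x) \<bullet> n"
        using nn unfolding \<xi>x inner_scaleR_left inner_add_left yx nx
        by (simp_all add: inner_commute[of a])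
    qed
    show "b = \<xi> \<times> y"
    proof (rule eq)
      show "b \<bullet> y = (\<xi> \<times> y) \<bullet> y" using assms(3) orth by (simp only: inner_commute[of b y])
      show "b \<bullet> x = (\<xi> \<times> y) \<bullet> x" "b \<bullet> n = (\<xi> \<times> y) \<bullet> n"
        using nn unfolding \<xi>y inner_scaleR_left inner_add_left yx nx ab
        by (simp_all add: inner_commute[of b])
    qed
  qed
qed

lemma edge_form_rotations:
  assumes "v \<noteq> 0"
  shows "edge_form v (\<xi> \<times> v) (\<eta> \<times> v) = v \<bullet> (\<xi> \<times> \<eta>)"
proof -
  have "v \<bullet> ((\<xi> \<times> v) \<times> (\<eta> \<times> v)) = (v \<bullet> v) * (v \<bullet> (\<xi> \<times> \<eta>))"
  proof -
    have "(\<xi> \<times> v) \<times> (\<eta> \<times> v) = ((\<xi> \<times> v) \<bullet> v) *\<^sub>R \<eta> - ((\<xi> \<times> v) \<bullet> \<eta>) *\<^sub>R v"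
      by (rule Lagrange)
    also have "(\<xi> \<times> v) \<bullet> \<eta> = - (v \<bullet> (\<xi> \<times> \<eta>))" by (simp add: cross3_simps)
    finally show ?thesis by (simp add: dot_cross_self)
  qed
  then show ?thesis using assms by (simp add: edge_form_def)
qed

lemma edge_form_scale: "edge_form (c *\<^sub>R v) (c *\<^sub>R a) (c *\<^sub>R b) = c * edge_form v a b"
  by (cases "c = 0") (auto simp: edge_form_def cross_mult_left cross_mult_right)

text \<open>The equations satisfied by the velocities \<open>a, b\<close> of the sides \<open>x, y\<close> of a triangle that moves
  in its congruence class. For a flat triangle the linearized length equations would be too weak. But it
  stays flat, so that \<open>x\<close> remains the same multiple of \<open>x + y\<close> (and \<open>x + y\<close> remains \<open>0\<close>
  if it is \<open>0\<close>), and these vector equations can be differentiated.\<close>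

definition flexes :: "real^3 \<Rightarrow> real^3 \<Rightarrow> real^3 \<Rightarrow> real^3 \<Rightarrow> bool" where
  "flexes x y a b \<longleftrightarrow>
     (if x \<times> y \<noteq> 0 then x \<bullet> a = 0 \<and> y \<bullet> b = 0 \<and> (x + y) \<bullet> (a + b) = 0
      else if x + y = 0 then a + b = 0
      else a = ((x \<bullet> (x + y)) / ((x + y) \<bullet> (x + y))) *\<^sub>R (a + b))"

lemma flexes_add: "flexes x y a b \<Longrightarrow> flexes x y a' b' \<Longrightarrow> flexes x y (a + a') (b + b')"
proof -
  define \<alpha> where "\<alpha> = (x \<bullet> (x + y)) / ((x + y) \<bullet> (x + y))"
  have 1: "a + a' = \<alpha> *\<^sub>R (a + a' + (b + b'))" if "a = \<alpha> *\<^sub>R (a + b)" "a' = \<alpha> *\<^sub>R (a' + b')"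
  proof -
    have "a + a' = \<alpha> *\<^sub>R (a + b) + \<alpha> *\<^sub>R (a' + b')" by (rule arg_cong2[OF that])
    also have "\<dots> = \<alpha> *\<^sub>R (a + a' + (b + b'))" by (simp add: algebra_simps)
    finally show ?thesis .
  qed
  assume f: "flexes x y a b" "flexes x y a' b'"
  show ?thesis
  proof (cases "x \<times> y = 0")
    case False
    then have e: "x \<bullet> a = 0" "y \<bullet> b = 0" "(x + y) \<bullet> (a + b) = 0"
      "x \<bullet> a' = 0" "y \<bullet> b' = 0" "(x + y) \<bullet> (a' + b') = 0"
      using f by (auto simp: flexes_def)
    have "(x + y) \<bullet> (a + a' + (b + b')) = (x + y) \<bullet> (a + b) + (x + y) \<bullet> (a' + b')"
      by (simp add: inner_add_right)
    then show ?thesis using False e by (simp add: flexes_def inner_add_right)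
  next
    case col: True
    show ?thesis
    proof (cases "x + y = 0")
      case True
      then show ?thesis using f col by (simp add: flexes_def) (metis add.assoc add.left_commute add_0_right)
    next
      case False
      then have "a + a' = \<alpha> *\<^sub>R (a + a' + (b + b'))"
        using f col by (intro 1) (auto simp only: flexes_def \<alpha>_def if_False not_not simp_thms)
      then show ?thesis unfolding flexes_def \<alpha>_def[symmetric] using False col by simp
    qed
  qed
qed

lemma collinear_sum:
  assumes "x \<times> y = 0" "x + y \<noteq> 0"
  shows "x = ((x \<bullet> (x + y)) / ((x + y) \<bullet> (x + y))) *\<^sub>R (x + y)"
proof -
  let ?v = "x + y"
  have "?v \<times> x = 0" using assms(1) by (simp add: cross_add_left cross_skew[of y x])
  then have "?v \<times> (?v \<times> x) = 0" by simp
  then have "(?v \<bullet> ?v) *\<^sub>R x = (?v \<bullet> x) *\<^sub>R ?v" unfolding Lagrange by simp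
  then have "((?v \<bullet> ?v) *\<^sub>R x) /\<^sub>R (?v \<bullet> ?v) = ((?v \<bullet> x) *\<^sub>R ?v) /\<^sub>R (?v \<bullet> ?v)" by simp
  then show ?thesis using assms(2) by (simp add: inner_commute divide_inverse mult.commute)
qed

lemma flexes_rotation: "flexes x y (\<xi> \<times> x) (\<xi> \<times> y)"
proof -
  have s: "\<xi> \<times> x + \<xi> \<times> y = \<xi> \<times> (x + y)" by (simp add: cross_add_right)
  show ?thesis
  proof (cases "x \<times> y = 0")
    case False
    then show ?thesis unfolding flexes_def s by (simp add: dot_cross_self)
  next
    case True
    show ?thesis
    proof (cases "x + y = 0")
      case True
      then show ?thesis using \<open>x \<times> y = 0\<close> unfolding flexes_def s by simp
    next
      case False
      have "\<xi> \<times> x = ((x \<bullet> (x + y)) / ((x + y) \<bullet> (x + y))) *\<^sub>R (\<xi> \<times> (x + y))"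
        by (subst (1) collinear_sum[OF True False]) (simp only: cross_mult_right)
      then show ?thesis using True False unfolding flexes_def s by simp
    qed
  qed
qed

lemma has_vector_derivative_unique_eventually:
  fixes f g :: "real \<Rightarrow> 'a::real_normed_vector"
  assumes f: "(f has_vector_derivative a) (at 0)" and g: "(g has_vector_derivative b) (at 0)"
    and ev: "eventually (\<lambda>t. f t = g t) (nhds 0)"
  shows "a = b"
proof -
  have "f 0 = g 0" using eventually_nhds_x_imp_x[OF ev] .
  moreover have "eventually (\<lambda>t. f t = g t) (at 0)"
    using ev by (auto simp: eventually_at_filter elim: eventually_mono)
  ultimately have "(g has_vector_derivative a) (at 0)"
    using f has_derivative_transform_eventually[of f _ 0 UNIV g] unfolding has_vector_derivative_def
    by simp
  then show ?thesis using g vector_derivative_unique_at by blast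
qed

lemma inner_derivative_of_constant_norm:
  fixes x :: "real \<Rightarrow> 'a::real_inner"
  assumes "(x has_vector_derivative a) (at 0)" "eventually (\<lambda>t. norm (x t) = c) (nhds 0)"
  shows "x 0 \<bullet> a = 0"
proof -
  have d: "((\<lambda>t. x t \<bullet> x t) has_vector_derivative x 0 \<bullet> a + a \<bullet> x 0) (at 0)"
    using assms(1) unfolding has_vector_derivative_def
    by (rule derivative_eq_intros) (use assms(1) in \<open>auto simp: has_vector_derivative_def algebra_simps\<close>)
  have "x 0 \<bullet> a + a \<bullet> x 0 = 0"
    by (rule has_vector_derivative_unique_eventually[OF d has_vector_derivative_const[of "c\<^sup>2"]])
       (use assms(2) in \<open>eventually_elim, auto simp: dot_square_norm\<close>)
  then show ?thesis by (simp add: inner_commute)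
qed

lemma flexes_velocity:
  fixes x y :: "real \<Rightarrow> real^3"
  assumes x: "(x has_vector_derivative a) (at 0)" and y: "(y has_vector_derivative b) (at 0)"
    and n: "eventually (\<lambda>t. norm (x t) = norm (x 0)) (nhds 0)"
      "eventually (\<lambda>t. norm (y t) = norm (y 0)) (nhds 0)"
      "eventually (\<lambda>t. norm (x t + y t) = norm (x 0 + y 0)) (nhds 0)"
  shows "flexes (x 0) (y 0) a b"
proof -
  have xy: "((\<lambda>t. x t + y t) has_vector_derivative a + b) (at 0)"
    using x y by (rule has_vector_derivative_add)
  show ?thesis
  proof (cases "x 0 \<times> y 0 = 0")
    case False
    then show ?thesis
      unfolding flexes_def
      using inner_derivative_of_constant_norm[OF x n(1)] inner_derivative_of_constant_norm[OF y n(2)]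
        inner_derivative_of_constant_norm[OF xy n(3)] by simp
  next
    case col: True
    show ?thesis
    proof (cases "x 0 + y 0 = 0")
      case True
      have "eventually (\<lambda>t. x t + y t = 0) (nhds 0)"
        using n(3) by eventually_elim (simp add: True)
      then have "a + b = 0"
        using has_vector_derivative_unique_eventually[OF xy has_vector_derivative_const] by blast
      then show ?thesis using True col by (simp add: flexes_def)
    next
      case False
      define \<alpha> where "\<alpha> = (x 0 \<bullet> (x 0 + y 0)) / ((x 0 + y 0) \<bullet> (x 0 + y 0))"
      have ac: "across (x 0 + y 0) (x 0) = 0"
        using collinear_sum[OF col False] by (simp add: across_def)
      have "eventually (\<lambda>t. x t = \<alpha> *\<^sub>R (x t + y t)) (nhds 0)"
        using n
      proof eventually_elim
        case (elim t)
        have "place (x 0) (y 0) (x t + y t) (x t) = x t"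
          by (rule place_fixed) (use elim in auto)
        then show ?case unfolding place_def ac \<alpha>_def by simp
      qed
      moreover have "((\<lambda>t. \<alpha> *\<^sub>R (x t + y t)) has_vector_derivative \<alpha> *\<^sub>R (a + b)) (at 0)"
        using xy by (auto intro: derivative_eq_intros)
      ultimately have "a = \<alpha> *\<^sub>R (a + b)"
        using has_vector_derivative_unique_eventually[OF x] by blast
      then show ?thesis using col False by (simp add: flexes_def \<alpha>_def)
    qed
  qed
qed

text \<open>For the triangle with sides \<open>x\<close>, \<open>y\<close> and \<open>- (x + y)\<close> the sum of the three edge forms vanishes
  on velocities: if the triangle is not flat, these are infinitesimal rotations, on which the edge form
  is linear in the edge; if it is flat, the sides and their velocities are the same multiples of those
  of one side.\<close>

lemma edge_form_additive:
  assumes "flexes x y a b" "flexes x y a' b'"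
  shows "edge_form x a a' + edge_form y b b' = edge_form (x + y) (a + b) (a' + b')"
proof (cases "x \<times> y = 0")
  case False
  have nz: "x \<noteq> 0" "y \<noteq> 0" "x + y \<noteq> 0"
    using False by (auto simp: add_eq_0_iff)
  obtain \<xi> where \<xi>: "a = \<xi> \<times> x" "b = \<xi> \<times> y"
    using rigid_motion_of_triangle[OF False] assms(1) False unfolding flexes_def by metis
  obtain \<eta> where \<eta>: "a' = \<eta> \<times> x" "b' = \<eta> \<times> y"
    using rigid_motion_of_triangle[OF False] assms(2) False unfolding flexes_def by metis
  show ?thesis
    unfolding \<xi> \<eta> cross_add_right[symmetric] edge_form_rotations[OF nz(1)]
      edge_form_rotations[OF nz(2)] edge_form_rotations[OF nz(3)] by (simp add: inner_add_left)
next
  case col: True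
  show ?thesis
  proof (cases "x + y = 0")
    case True
    then have "y = (- 1) *\<^sub>R x" "b = (- 1) *\<^sub>R a" "b' = (- 1) *\<^sub>R a'"
      using assms col by (auto simp: flexes_def add_eq_0_iff)
    then have "edge_form y b b' = - 1 * edge_form x a a'"
      by (simp only: edge_form_scale)
    then show ?thesis unfolding True by (simp add: edge_form_def)
  next
    case False
    define \<alpha> where "\<alpha> = (x \<bullet> (x + y)) / ((x + y) \<bullet> (x + y))"
    have x: "x = \<alpha> *\<^sub>R (x + y)" using collinear_sum[OF col False] by (simp add: \<alpha>_def)
    have a: "a = \<alpha> *\<^sub>R (a + b)" "a' = \<alpha> *\<^sub>R (a' + b')"
      using assms col False by (auto simp: flexes_def \<alpha>_def)
    have "edge_form x a a' = \<alpha> * edge_form (x + y) (a + b) (a' + b')"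
      using edge_form_scale[of \<alpha> "x + y" "a + b" "a' + b'"] x a by simp
    moreover have "y = (1 - \<alpha>) *\<^sub>R (x + y)" "b = (1 - \<alpha>) *\<^sub>R (a + b)" "b' = (1 - \<alpha>) *\<^sub>R (a' + b')"
      using x a by (simp_all add: scaleR_diff_left)
    then have "edge_form y b b' = (1 - \<alpha>) * edge_form (x + y) (a + b) (a' + b')"
      using edge_form_scale[of "1 - \<alpha>" "x + y" "a + b" "a' + b'"] by simp
    ultimately show ?thesis by (simp add: algebra_simps)
  qed
qed

section \<open>Polygons cut up into triangles\<close>

text \<open>The binary tree dual to a triangulation of a polygon: the leaves are the sides in a chain, a
  node is a triangle that joins two consecutive subchains, and the edge of the node is the chord under the
  joined chain, given by the vector from its beginning to its end.\<close>

datatype 'n triangulation = Leaf 'n | Node "'n triangulation" "'n triangulation"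

primrec leaves :: "'n triangulation \<Rightarrow> 'n set" where
  "leaves (Leaf i) = {i}"
| "leaves (Node s t) = leaves s \<union> leaves t"

primrec proper :: "'n triangulation \<Rightarrow> bool" where
  "proper (Leaf i) \<longleftrightarrow> True"
| "proper (Node s t) \<longleftrightarrow> proper s \<and> proper t \<and> leaves s \<inter> leaves t = {}"

primrec edge :: "real^'n::finite \<Rightarrow> 'n triangulation \<Rightarrow> real^3^'n \<Rightarrow> real^3" where
  "edge r (Leaf i) u = r $ i *\<^sub>R u $ i"
| "edge r (Node s t) u = edge r s u + edge r t u"

primrec isometric :: "real^'n::finite \<Rightarrow> 'n triangulation \<Rightarrow> real^3^'n \<Rightarrow> real^3^'n \<Rightarrow> bool" where
  "isometric r (Leaf i) p u \<longleftrightarrow> norm (edge r (Leaf i) u) = norm (edge r (Leaf i) p)"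
| "isometric r (Node s t) p u \<longleftrightarrow> norm (edge r (Node s t) u) = norm (edge r (Node s t) p) \<and>
     isometric r s p u \<and> isometric r t p u"

lemma isometric_norm: "isometric r t p u \<Longrightarrow> norm (edge r t u) = norm (edge r t p)"
  by (cases t) auto

lemma edge_eq_sum: "proper t \<Longrightarrow> edge r t u = (\<Sum>i\<in>leaves t. r $ i *\<^sub>R u $ i)"
proof (induction t)
  case (Node s t)
  have "finite (leaves s)" "finite (leaves t)" by auto
  then show ?case using Node by (simp add: sum.union_disjoint)
qed auto

lemma edge_cong: "(\<And>i. i \<in> leaves t \<Longrightarrow> u $ i = w $ i) \<Longrightarrow> edge r t u = edge r t w"
  by (induction t) auto

lemma isometric_cong:
  "(\<And>i. i \<in> leaves t \<Longrightarrow> u $ i = w $ i) \<Longrightarrow> isometric r t p u = isometric r t p w"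
proof (induction t)
  case (Node s t)
  have "edge r (Node s t) u = edge r (Node s t) w" using Node.prems by (rule edge_cong)
  then show ?case using Node by simp
qed simp

lemma edge_linear: "linear (edge r t)"
proof (induction t)
  case (Node s t)
  then show ?case by (auto simp: linear_iff algebra_simps)
qed (auto simp: linear_iff algebra_simps)

lemma edge_bounded_linear: "bounded_linear (edge r t)"
  by (simp add: edge_linear linear_conv_bounded_linear[symmetric])

lemma edge_map:
  assumes "linear f"
  shows "edge r t (\<chi> i. f (u $ i)) = f (edge r t u)"
  by (induction t) (simp_all add: linear_add[OF assms] linear_scale[OF assms])

lemma isometric_map:
  assumes "linear f" "\<And>x. norm (f x) = norm x" "isometric r t p u"
  shows "isometric r t p (\<chi> i. f (u $ i))"
  using assms(3)
proof (induction t)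
  case (Leaf i)
  then show ?case using assms(2) by (simp add: linear_scale[OF assms(1)])
next
  case (Node s t)
  then show ?case by (simp add: edge_map[OF assms(1)] assms(2) flip: linear_add[OF assms(1)])
qed

text \<open>Retraction onto the chains isometric to \<open>p\<close>: from the root downwards, each triangle is
  solved for its lower edges, nearest to those of \<open>u\<close>, given its upper edge \<open>v\<close>.\<close>

primrec fit :: "real^'n::finite \<Rightarrow> 'n triangulation \<Rightarrow> real^3^'n \<Rightarrow> real^3 \<Rightarrow> real^3^'n \<Rightarrow> 'n \<Rightarrow> real^3" where
  "fit r (Leaf i) p v u j = v /\<^sub>R r $ i"
| "fit r (Node s t) p v u j =
     (if j \<in> leaves s then fit r s p (place (edge r s p) (edge r t p) v (edge r s u)) u j
      else fit r t p (v - place (edge r s p) (edge r t p) v (edge r s u)) u j)"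

lemma fit_fixed:
  assumes r: "\<And>i. r $ i > 0"
  shows "proper t \<Longrightarrow> isometric r t p u \<Longrightarrow> j \<in> leaves t \<Longrightarrow> fit r t p (edge r t u) u j = u $ j"
proof (induction t)
  case (Leaf i)
  then show ?case using r[of i] by simp
next
  case (Node s t)
  have iso: "isometric r s p u" "isometric r t p u" using Node.prems by auto
  have "place (edge r s p) (edge r t p) (edge r s u + edge r t u) (edge r s u) = edge r s u"
    by (rule place_fixed) (use Node.prems isometric_norm[OF iso(1)] isometric_norm[OF iso(2)] in auto)
  then show ?case using Node by (cases "j \<in> leaves s") auto
qed

text \<open>The upper edge may depend on \<open>u\<close>, as it does below the root. It has the right length near \<open>u\<^sub>0\<close>, and
  at \<open>u\<^sub>0\<close> the triangle is already solved; so a component across the upper edge that should not vanish does not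
  vanish near \<open>u\<^sub>0\<close>, and the lower edges inherit the hypotheses.\<close>

lemma fit_smooth_and_isometric:
  assumes r: "\<And>i. r $ i > 0"
  shows "proper t \<Longrightarrow> isometric r t p u0 \<Longrightarrow> smooth_at v u0 \<Longrightarrow> v u0 = edge r t u0 \<Longrightarrow>
    eventually (\<lambda>u. norm (v u) = norm (edge r t p)) (nhds u0) \<Longrightarrow>
    (\<forall>j. smooth_at (\<lambda>u. fit r t p (v u) u j) u0) \<and>
    eventually (\<lambda>u. isometric r t p (\<chi> j. fit r t p (v u) u j) \<and>
      edge r t (\<chi> j. fit r t p (v u) u j) = v u) (nhds u0)"
proof (induction t arbitrary: v)
  case (Leaf i)
  have "smooth_at (\<lambda>u. v u /\<^sub>R r $ i) u0" using Leaf by (intro smooth_at_scaleR) auto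
  moreover have "eventually (\<lambda>u. isometric r (Leaf i) p (\<chi> j. fit r (Leaf i) p (v u) u j) \<and>
      edge r (Leaf i) (\<chi> j. fit r (Leaf i) p (v u) u j) = v u) (nhds u0)"
    using Leaf.prems(5) by eventually_elim (use r[of i] in simp)
  ultimately show ?case by simp
next
  case (Node s t)
  let ?x0 = "edge r s p" and ?y0 = "edge r t p"
  define x where "x u = place ?x0 ?y0 (v u) (edge r s u)" for u
  have iso: "isometric r s p u0" "isometric r t p u0" "norm (v u0) = norm (?x0 + ?y0)"
    using Node.prems by auto
  have nv: "eventually (\<lambda>u. norm (v u) = norm (?x0 + ?y0)) (nhds u0)" using Node.prems by simp
  have se: "smooth_at (edge r s) u0" by (rule smooth_at_linear[OF edge_bounded_linear])
  have vx: "norm (edge r s u0) = norm ?x0" "norm (v u0 - edge r s u0) = norm ?y0"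
    using isometric_norm[OF iso(1)] isometric_norm[OF iso(2)] Node.prems(4) by auto
  have x0: "x u0 = edge r s u0"
    unfolding x_def by (rule place_fixed(1)) (use iso vx in auto)
  have ac: "norm (across (v u0) (edge r s u0)) = norm (across (?x0 + ?y0) ?x0)"
    by (rule place_fixed(2)) (use iso vx in auto)
  then have nz: "across (?x0 + ?y0) ?x0 \<noteq> 0 \<Longrightarrow> across (v u0) (edge r s u0) \<noteq> 0" by auto
  have sx: "smooth_at x u0"
    unfolding x_def by (rule smooth_at_place[OF se Node.prems(3) nv nz])
  have sy: "smooth_at (\<lambda>u. v u - x u) u0" using sx Node.prems(3) by auto
  have "eventually (\<lambda>u. across (?x0 + ?y0) ?x0 \<noteq> 0 \<longrightarrow> across (v u) (edge r s u) \<noteq> 0) (nhds u0)"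
  proof (cases "across (?x0 + ?y0) ?x0 = 0")
    case False
    have "filterlim (\<lambda>u. across (v u) (edge r s u)) (nhds (across (v u0) (edge r s u0))) (nhds u0)"
      by (rule tendsto_nhds_nhds[OF smooth_at_across[OF se Node.prems(3) nv]])
    then show ?thesis
      by (rule eventually_mono[OF tendsto_imp_eventually_ne[OF _ nz[OF False]]]) simp
  qed simp
  then have len: "eventually (\<lambda>u. norm (x u) = norm ?x0 \<and> norm (v u - x u) = norm ?y0) (nhds u0)"
    using nv
  proof eventually_elim
    case (elim u)
    then show ?case
      unfolding x_def using place_lengths[of "v u" ?x0 ?y0 "edge r s u"] by blast
  qed
  have nx: "eventually (\<lambda>u. norm (x u) = norm ?x0) (nhds u0)"
    and ny: "eventually (\<lambda>u. norm (v u - x u) = norm ?y0) (nhds u0)"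
    by (rule eventually_mono[OF len]; simp)+
  have S: "(\<forall>j. smooth_at (\<lambda>u. fit r s p (x u) u j) u0) \<and>
    eventually (\<lambda>u. isometric r s p (\<chi> j. fit r s p (x u) u j) \<and>
      edge r s (\<chi> j. fit r s p (x u) u j) = x u) (nhds u0)"
    by (rule Node.IH(1)[OF _ iso(1) sx x0 nx]) (use Node.prems(1) in simp)
  have T: "(\<forall>j. smooth_at (\<lambda>u. fit r t p (v u - x u) u j) u0) \<and>
    eventually (\<lambda>u. isometric r t p (\<chi> j. fit r t p (v u - x u) u j) \<and>
      edge r t (\<chi> j. fit r t p (v u - x u) u j) = v u - x u) (nhds u0)"
    by (rule Node.IH(2)[OF _ iso(2) sy _ ny]) (use Node.prems(1,4) x0 in auto)
  let ?f = "\<lambda>u. \<chi> j. fit r (Node s t) p (v u) u j"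
  have f: "?f u = (\<chi> j. if j \<in> leaves s then fit r s p (x u) u j else fit r t p (v u - x u) u j)" for u
    by (simp add: x_def cong: if_cong)
  have dj: "leaves s \<inter> leaves t = {}" using Node.prems(1) by simp
  have eqs: "edge r s (?f u) = edge r s (\<chi> j. fit r s p (x u) u j)"
    "isometric r s p (?f u) = isometric r s p (\<chi> j. fit r s p (x u) u j)"
    "edge r t (?f u) = edge r t (\<chi> j. fit r t p (v u - x u) u j)"
    "isometric r t p (?f u) = isometric r t p (\<chi> j. fit r t p (v u - x u) u j)" for u
    unfolding f using dj by (auto intro!: edge_cong isometric_cong)
  have "eventually (\<lambda>u. isometric r (Node s t) p (?f u) \<and> edge r (Node s t) (?f u) = v u) (nhds u0)"
    using S[THEN conjunct2] T[THEN conjunct2] nv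
  proof eventually_elim
    case (elim u)
    then show ?case unfolding isometric.simps edge.simps eqs by simp
  qed
  moreover have "smooth_at (\<lambda>u. fit r (Node s t) p (v u) u j) u0" for j
  proof (cases "j \<in> leaves s")
    case True
    then show ?thesis using S[THEN conjunct1, rule_format, of j] by (simp add: x_def)
  next
    case False
    then show ?thesis using T[THEN conjunct1, rule_format, of j] by (simp add: x_def)
  qed
  ultimately show ?case by blast
qed

text \<open>A chain of sides is a closed polygon if its root edge is \<open>0\<close>. This way no side plays a special
  part: the root triangle is flat, and its two lower edges are opposite vectors, free on a sphere.\<close>

definition isometry_class ::
  "real^'n::finite \<Rightarrow> 'n triangulation \<Rightarrow> real^3^'n \<Rightarrow> (real^3^'n) set" where
  "isometry_class r t p = {u. isometric r t p u \<and> edge r t u = 0}"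

lemma fit_closed_retract:
  assumes r: "\<And>i. r $ i > 0" and t: "proper t" "leaves t = UNIV"
    and p: "edge r t p = 0" and u0: "u0 \<in> isometry_class r t p"
  shows "smooth_retract_at (\<lambda>u. \<chi> j. fit r t p 0 u j) (isometry_class r t p) u0"
proof -
  have iso: "isometric r t p u" "0 = edge r t u" if "u \<in> isometry_class r t p" for u
    using that by (auto simp: isometry_class_def)
  have nv: "eventually (\<lambda>u. norm 0 = norm (edge r t p)) (nhds u0)" by (simp add: p)
  note F = fit_smooth_and_isometric[OF r t(1) iso(1)[OF u0] smooth_at_const iso(2)[OF u0] nv]
  have "smooth_at (\<lambda>u. \<chi> j. fit r t p 0 u j) u0"
    using F by (intro smooth_at_vec_lambda) blast
  moreover have "eventually (\<lambda>u. (\<chi> j. fit r t p 0 u j) \<in> isometry_class r t p) (nhds u0)"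
    by (rule eventually_mono[OF F[THEN conjunct2]]) (simp add: isometry_class_def)
  moreover have "(\<chi> j. fit r t p 0 u j) = u" if u: "u \<in> isometry_class r t p" for u
    using fit_fixed[OF r t(1) iso(1)[OF u]] t(2) iso(2)[OF u] by (simp add: vec_eq_iff)
  ultimately show ?thesis using u0 by (simp add: smooth_retract_at_def)
qed

section \<open>Bending along diagonals\<close>

lemma rotation_path:
  "continuous_on {0..1} (\<lambda>s. \<chi> i. rotation (s * \<theta>) n (u $ i) :: real^3^'n::finite)"
  by (intro continuous_intros)

lemma path_componentI:
  assumes "continuous_on {0..1::real} p" "p 0 = x" "p 1 = y" "\<And>s. s \<in> {0..1} \<Longrightarrow> p s \<in> S"
  shows "path_component S x y"
  unfolding path_component_def path_def path_image_def pathstart_def pathfinish_def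
  using assms by blast

text \<open>The configurations with a given root edge and given lengths form a connected set: rotating all of
  one configuration about the root edge makes the two lower edges agree with those of another one, and
  then the two branches are moved independently.\<close>

lemma path_connected_isometric:
  assumes r: "\<And>i. r $ i > 0"
  shows "proper t \<Longrightarrow> path_connected {u. isometric r t p u \<and> edge r t u = v}"
proof (induction t arbitrary: v)
  case (Leaf i)
  have "{u. isometric r (Leaf i) p u \<and> edge r (Leaf i) u = v} =
      (if norm v = norm (edge r (Leaf i) p) then {u. r $ i *\<^sub>R u $ i = v} else {})"
    by auto
  moreover have "convex {u. r $ i *\<^sub>R u $ i = v}"
  proof (rule convexI)
    fix a b :: "real^3^'a" and e f :: real
    assume "a \<in> {u. r $ i *\<^sub>R u $ i = v}" "b \<in> {u. r $ i *\<^sub>R u $ i = v}" "e + f = 1"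
    moreover have "r $ i *\<^sub>R (e *\<^sub>R a + f *\<^sub>R b) $ i = e *\<^sub>R (r $ i *\<^sub>R a $ i) + f *\<^sub>R (r $ i *\<^sub>R b $ i)"
      by (simp add: algebra_simps)
    ultimately show "e *\<^sub>R a + f *\<^sub>R b \<in> {u. r $ i *\<^sub>R u $ i = v}"
      by (simp flip: scaleR_add_left)
  qed
  ultimately show ?case by (simp add: convex_imp_path_connected)
next
  case (Node s t)
  let ?G = "{u. isometric r (Node s t) p u \<and> edge r (Node s t) u = v}"
  show ?case
    unfolding path_connected_component
  proof (intro ballI)
    fix u0 u1 assume u: "u0 \<in> ?G" "u1 \<in> ?G"
    define x where "x = edge r s u1"
    define y where "y = edge r t u1"
    have iso: "isometric r s p u0" "isometric r t p u0" "isometric r s p u1" "isometric r t p u1"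
      using u by auto
    have v: "v = edge r s u0 + edge r t u0" "v = x + y" using u by (auto simp: x_def y_def)
    have nx: "norm (edge r s u0) = norm x"
      using isometric_norm[OF iso(1)] isometric_norm[OF iso(3)] by (simp add: x_def)
    have ny: "norm (edge r t u0) = norm y"
      using isometric_norm[OF iso(2)] isometric_norm[OF iso(4)] by (simp add: y_def)
    have "edge r s u0 \<bullet> v = x \<bullet> v"
      using inner_sum_from_norms[of "edge r s u0" "edge r t u0"] inner_sum_from_norms[of x y]
      by (simp only: v(1)[symmetric] v(2)[symmetric] nx ny)
    then have "v \<bullet> edge r s u0 = v \<bullet> x" by (simp only: inner_commute)
    then obtain \<theta> n where n: "norm n = 1" "rotation \<theta> n (edge r s u0) = x" "\<And>\<theta>. rotation \<theta> n v = v"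
      by (rule rotation_transitive[OF nx]) blast
    \<comment> \<open>turning about \<open>v\<close> until the two lower edges are in place\<close>
    define w where "w s = (\<chi> i. rotation (s * \<theta>) n (u0 $ i))" for s
    have wG: "w c \<in> ?G" for c
    proof -
      have "isometric r (Node s t) p (w c)"
        unfolding w_def by (rule isometric_map[OF rotation_linear rotation_norm[OF n(1)]]) (use u in blast)
      moreover have "edge r (Node s t) (w c) = rotation (c * \<theta>) n (edge r (Node s t) u0)"
        unfolding w_def by (rule edge_map[OF rotation_linear])
      ultimately show ?thesis using u(1) n(3) by (simp only: mem_Collect_eq)
    qed
    have 1: "path_component ?G u0 (w 1)"
    proof (rule path_componentI)
      show "continuous_on {0..1} w" unfolding w_def by (rule rotation_path)
      show "w 0 = u0" by (simp add: w_def)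
    qed (rule refl wG)+
    have wx: "edge r s (w 1) = x" by (simp add: w_def edge_map[OF rotation_linear] n(2))
    have isow: "isometric r s p (w 1)" "isometric r t p (w 1)" "edge r (Node s t) (w 1) = v"
      using wG[of 1] by simp_all
    have wy: "edge r t (w 1) = y" using isow(3) v(2) wx by simp
    have "path_component {u. isometric r s p u \<and> edge r s u = x} (w 1) u1"
      using Node.IH(1)[of x, unfolded path_connected_component] Node.prems isow(1) wx iso(3) x_def
      by simp
    then obtain g where g: "path g" "path_image g \<subseteq> {u. isometric r s p u \<and> edge r s u = x}"
      "pathstart g = w 1" "pathfinish g = u1" unfolding path_component_def by blast
    have "path_component {u. isometric r t p u \<and> edge r t u = y} (w 1) u1"
      using Node.IH(2)[of y, unfolded path_connected_component] Node.prems isow(2) wy iso(4) y_def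
      by simp
    then obtain h where h: "path h" "path_image h \<subseteq> {u. isometric r t p u \<and> edge r t u = y}"
      "pathstart h = w 1" "pathfinish h = u1" unfolding path_component_def by blast
    define q where "q c = (\<chi> i. if i \<in> leaves s then g c $ i else h c $ i)" for c
    have 2: "path_component ?G (w 1) u1"
    proof (rule path_componentI)
      show "continuous_on {0..1} q"
        unfolding q_def
      proof (rule continuous_on_vec_lambda)
        show "continuous_on {0..1} (\<lambda>c. if i \<in> leaves s then g c $ i else h c $ i)" for i
          using g(1) h(1) unfolding path_def by (cases "i \<in> leaves s") (auto intro!: continuous_intros)
      qed
      show "q 0 = w 1" "q 1 = u1"
        using g(3,4) h(3,4) by (auto simp: q_def pathstart_def pathfinish_def vec_eq_iff)
      fix c :: real assume "c \<in> {0..1}"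
      then have "g c \<in> path_image g" "h c \<in> path_image h" unfolding path_image_def by (rule imageI)+
      then have gc: "isometric r s p (g c)" "edge r s (g c) = x"
        and hc: "isometric r t p (h c)" "edge r t (h c) = y"
        using subsetD[OF g(2)] subsetD[OF h(2)] by simp_all
      have qe: "edge r s (q c) = edge r s (g c)" "isometric r s p (q c) = isometric r s p (g c)"
        "edge r t (q c) = edge r t (h c)" "isometric r t p (q c) = isometric r t p (h c)"
        using Node.prems by (auto simp: q_def intro!: edge_cong isometric_cong)
      have "isometric r (Node s t) p u1" "edge r (Node s t) u1 = v" using u(2) by blast+
      then have "norm v = norm (edge r s p + edge r t p)" by (metis isometric_norm edge.simps(2))
      then show "q c \<in> ?G" using gc hc v(2) by (simp add: qe)
    qed
    show "path_component ?G u0 u1" using 1 2 by (rule path_component_trans)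
  qed
qed

lemma connected_isometry_class:
  "(\<And>i. r $ i > 0) \<Longrightarrow> proper t \<Longrightarrow> connected (isometry_class r t p)"
  unfolding isometry_class_def by (intro path_connected_imp_connected path_connected_isometric)

section \<open>Vanishing of the symplectic form\<close>

primrec flexes_tree :: "real^'n::finite \<Rightarrow> 'n triangulation \<Rightarrow> real^3^'n \<Rightarrow> real^3^'n \<Rightarrow> bool" where
  "flexes_tree r (Leaf i) u a \<longleftrightarrow> True"
| "flexes_tree r (Node s t) u a \<longleftrightarrow>
     flexes (edge r s u) (edge r t u) (edge r s a) (edge r t a) \<and> flexes_tree r s u a \<and> flexes_tree r t u a"

lemma flexes_tree_add: "flexes_tree r t u a \<Longrightarrow> flexes_tree r t u b \<Longrightarrow> flexes_tree r t u (a + b)"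
proof (induction t)
  case (Node s t)
  then show ?case
    using flexes_add[of "edge r s u" "edge r t u" "edge r s a" "edge r t a" "edge r s b" "edge r t b"]
    by (simp add: linear_add[OF edge_linear])
qed simp

lemma linear_cross_right: "linear (\<lambda>x. \<xi> \<times> x)"
  by (rule linearI) (auto simp: cross_add_right cross_mult_right)

lemma flexes_tree_rotation: "flexes_tree r t u (\<chi> i. \<xi> \<times> (u $ i))"
proof (induction t)
  case (Node s t)
  have "edge r t (\<chi> i. \<xi> \<times> (u $ i)) = \<xi> \<times> edge r t u" for t
    by (rule edge_map[OF linear_cross_right])
  then show ?case using Node by (simp add: flexes_rotation)
qed simp

lemma flexes_tree_velocity:
  fixes \<gamma> :: "real \<Rightarrow> real^3^'n::finite"
  assumes d: "(\<gamma> has_vector_derivative a) (at 0)"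
    and ev: "eventually (\<lambda>s. isometric r t p (\<gamma> s)) (nhds 0)"
  shows "flexes_tree r t (\<gamma> 0) a"
proof -
  have de: "((\<lambda>s. edge r t (\<gamma> s)) has_vector_derivative edge r t a) (at 0)" for t
    by (rule bounded_linear.has_vector_derivative[OF edge_bounded_linear d])
  show ?thesis
    using ev
  proof (induction t)
    case (Node s t)
    have evs: "eventually (\<lambda>c. isometric r s p (\<gamma> c)) (nhds 0)"
      "eventually (\<lambda>c. isometric r t p (\<gamma> c)) (nhds 0)"
      by (rule eventually_mono[OF Node.prems]; simp)+
    have n: "eventually (\<lambda>c. norm (edge r t (\<gamma> c)) = norm (edge r t (\<gamma> 0))) (nhds 0)"
      if "eventually (\<lambda>c. isometric r t p (\<gamma> c)) (nhds 0)" for t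
    proof -
      have "isometric r t p (\<gamma> 0)" using that by (rule eventually_nhds_x_imp_x)
      then show ?thesis
        by (intro eventually_mono[OF that]) (simp add: isometric_norm)
    qed
    have "flexes (edge r s (\<gamma> 0)) (edge r t (\<gamma> 0)) (edge r s a) (edge r t a)"
      using flexes_velocity[OF de de n[OF evs(1)] n[OF evs(2)]] n[OF Node.prems] by simp
    then show ?case using Node.IH evs by simp
  qed simp
qed

text \<open>Down the tree, the edge form of each triangle's upper edge splits into those of its lower
  edges.\<close>

lemma edge_form_tree:
  "proper t \<Longrightarrow> flexes_tree r t u a \<Longrightarrow> flexes_tree r t u b \<Longrightarrow>
    (\<Sum>i\<in>leaves t. edge_form (r $ i *\<^sub>R u $ i) (r $ i *\<^sub>R a $ i) (r $ i *\<^sub>R b $ i)) =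
    edge_form (edge r t u) (edge r t a) (edge r t b)"
proof (induction t)
  case (Node s t)
  have "finite (leaves s)" "finite (leaves t)" by auto
  then show ?case using Node by (simp add: sum.union_disjoint edge_form_additive)
qed auto

lemma symplectic_form_vanishes:
  assumes t: "proper t" "leaves t = UNIV" and u: "\<And>i. norm (u $ i) = 1" "edge r t u = 0"
    and ab: "flexes_tree r t u a" "flexes_tree r t u b"
  shows "symplectic_form r u a b = 0"
proof -
  have "symplectic_form r u a b =
      (\<Sum>i\<in>leaves t. edge_form (r $ i *\<^sub>R u $ i) (r $ i *\<^sub>R a $ i) (r $ i *\<^sub>R b $ i))"
    unfolding symplectic_form_def edge_form_scale t(2)
    by (simp add: edge_form_def dot_square_norm u)
  also have "\<dots> = 0"
    unfolding edge_form_tree[OF t(1) ab] by (simp add: edge_form_def u)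
  finally show ?thesis .
qed

unbundle no cross3_syntax

section \<open>Chords of the circle that cross\<close>

text \<open>The power of a point with respect to the unit circle, computed on a chord: the points of the line
  inside the circle are those between the end points.\<close>

lemma norm_unit_segment:
  fixes b d :: complex
  assumes "norm b = 1" "norm d = 1"
  shows "(norm ((1 - t) *\<^sub>R b + t *\<^sub>R d))\<^sup>2 = 1 - t * (1 - t) * (norm (d - b))\<^sup>2"
proof -
  have "b \<bullet> b = 1" "d \<bullet> d = 1" using assms by (auto simp: dot_square_norm)
  then show ?thesis
    unfolding power2_norm_eq_inner
    by (simp add: inner_add_left inner_add_right inner_diff_left inner_diff_right inner_commute[of d b] algebra_simps)
qed

lemma cis_diff: "cis x - cis y = 2 * \<i> * complex_of_real (sin ((x - y) / 2)) * cis ((x + y) / 2)"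
proof -
  have "cis x = cis ((x + y) / 2) * cis ((x - y) / 2)" "cis y = cis ((x + y) / 2) * cis (- ((x - y) / 2))"
    by (simp_all add: cis_mult field_simps flip: add_divide_distrib diff_divide_distrib)
  moreover have "cis ((x - y) / 2) - cis (- ((x - y) / 2)) = 2 * \<i> * complex_of_real (sin ((x - y) / 2))"
    by (simp add: complex_eq_iff)
  ultimately show ?thesis by (simp add: algebra_simps flip: right_diff_distrib)
qed

text \<open>The ends \<open>b, d\<close> of the second chord lie on different sides of the line through \<open>a, c\<close>, so the second chord
  meets this line. As a point of the second chord, the meeting point is inside the circle, hence it is on
  the first chord too.\<close>

lemma chords_cross:
  assumes "\<alpha> < \<beta>" "\<beta> < \<gamma>" "\<gamma> < \<delta>" "\<delta> < \<alpha> + 2 * pi"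
  shows "open_segment (cis \<alpha>) (cis \<gamma>) \<inter> open_segment (cis \<beta>) (cis \<delta>) \<noteq> {}"
proof -
  define a where "a = cis \<alpha>"
  define b where "b = cis \<beta>"
  define c where "c = cis \<gamma>"
  define d where "d = cis \<delta>"
  have n: "norm a = 1" "norm b = 1" "norm c = 1" "norm d = 1" by (auto simp: a_def b_def c_def d_def)
  \<comment> \<open>the signed area that tells on which side of the chord \<open>a c\<close> a point lies\<close>
  define f where "f z = Im (cnj (c - a) * (z - a))" for z
  have fcis: "f (cis x) = 4 * sin ((\<gamma> - \<alpha>) / 2) * sin ((x - \<alpha>) / 2) * sin ((x - \<gamma>) / 2)" for x
  proof -
    have "cnj (cis ((\<gamma> + \<alpha>) / 2)) * cis ((x + \<alpha>) / 2) = cis ((x - \<gamma>) / 2)"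
      by (simp add: cis_cnj cis_mult flip: add_divide_distrib diff_divide_distrib)
    moreover have "cnj (c - a) * (cis x - a) = complex_of_real (4 * sin ((\<gamma> - \<alpha>) / 2) * sin ((x - \<alpha>) / 2)) *
        (cnj (cis ((\<gamma> + \<alpha>) / 2)) * cis ((x + \<alpha>) / 2))"
      unfolding a_def c_def cis_diff by simp
    ultimately show ?thesis unfolding f_def by simp
  qed
  have "sin ((\<beta> - \<gamma>) / 2) = - sin ((\<gamma> - \<beta>) / 2)"
    using sin_minus[of "(\<gamma> - \<beta>) / 2"] by (simp only: minus_divide_left minus_diff_eq)
  moreover have "sin ((\<gamma> - \<beta>) / 2) > 0" using assms by (intro sin_gt_zero) auto
  ultimately have fb: "f b < 0"
    unfolding b_def fcis using assms
    by (intro mult_pos_neg mult_pos_pos sin_gt_zero) auto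
  have fd: "f d > 0"
    unfolding d_def fcis using assms
    by (intro mult_pos_pos sin_gt_zero) auto
  define t where "t = - f b / (f d - f b)"
  have t: "0 < t" "t < 1" using fb fd by (auto simp: t_def field_simps)
  define z where "z = (1 - t) *\<^sub>R b + t *\<^sub>R d"
  have "f z = (1 - t) * f b + t * f d"
    by (simp add: f_def z_def algebra_simps)
  also have "\<dots> = 0" using fb fd by (simp add: t_def field_simps)
  finally have fz: "f z = 0" .
  have ac: "c \<noteq> a" using fb by (auto simp: f_def)
  have bd: "b \<noteq> d" using fb fd by auto
  define s where "s = Re (cnj (c - a) * (z - a)) / (norm (c - a))\<^sup>2"
  have "cnj (c - a) * (z - a) = complex_of_real (Re (cnj (c - a) * (z - a)))"
    using fz by (simp add: f_def complex_eq_iff)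
  then have "(c - a) * (cnj (c - a) * (z - a)) = (c - a) * complex_of_real (Re (cnj (c - a) * (z - a)))"
    by metis
  then have "complex_of_real ((norm (c - a))\<^sup>2) * (z - a) = (c - a) * complex_of_real (Re (cnj (c - a) * (z - a)))"
    by (simp only: complex_norm_square mult.assoc)
  then have "z - a = complex_of_real s * (c - a)"
    using ac unfolding s_def by (simp add: field_simps)
  then have zs: "z = (1 - s) *\<^sub>R a + s *\<^sub>R c"
    by (simp add: scaleR_conv_of_real algebra_simps)
  have "t * (1 - t) * (norm (d - b))\<^sup>2 > 0" using t bd by simp
  then have "s * (1 - s) * (norm (c - a))\<^sup>2 > 0"
    using norm_unit_segment[OF n(2,4), of t] norm_unit_segment[OF n(1,3), of s]
    by (simp add: zs[symmetric] z_def[symmetric])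
  then have "s * (1 - s) > 0" using ac by (simp add: zero_less_mult_iff)
  then have "0 < s" "s < 1" by (auto simp: zero_less_mult_iff)
  then have "z \<in> open_segment a c" using zs ac by (auto simp: in_segment)
  moreover have "z \<in> open_segment b d" using z_def t bd by (auto simp: in_segment)
  ultimately show ?thesis by (auto simp: a_def b_def c_def d_def)
qed

section \<open>Maximal families of disjoint diagonals\<close>

definition position :: "'n::{finite,linorder} \<Rightarrow> nat" where
  "position i = card {..<i}"

lemma position_less: "i < j \<Longrightarrow> position i < position j"
  unfolding position_def by (rule psubset_card_mono) auto

lemma position_less_iff: "position i < position j \<longleftrightarrow> i < j"
  by (metis position_less less_asym linorder_less_linear)

lemma position_le_iff: "position i \<le> position j \<longleftrightarrow> i \<le> j"
  using position_less_iff[of j i] by (simp add: not_less[symmetric])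

lemma inj_position: "inj position"
  by (rule injI) (metis position_le_iff order_antisym order_refl)

lemma position_less_card: "position (i :: 'n::{finite,linorder}) < CARD('n)"
  unfolding position_def by (rule psubset_card_mono) auto

lemma range_position: "range (position :: 'n::{finite,linorder} \<Rightarrow> nat) = {..<CARD('n)}"
  by (rule card_subset_eq) (auto simp: position_less_card card_image inj_position)

definition block :: "nat \<Rightarrow> nat \<Rightarrow> 'n::{finite,linorder} set" where
  "block a b = {k. a \<le> position k \<and> position k < b}"

lemma block_position: "block (position i) (position j) = {i..<j}"
  by (auto simp: block_def position_less_iff position_le_iff)

text \<open>Vertices are numbered, and a chord is the pair of its end points. The chord \<open>(a, b)\<close> is admitted: it
  is to become the root edge.\<close>

definition noncrossing :: "nat \<Rightarrow> nat \<Rightarrow> (nat \<times> nat) set \<Rightarrow> bool" where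
  "noncrossing a b F \<longleftrightarrow> (\<forall>(i, j)\<in>F. a \<le> i \<and> i + 2 \<le> j \<and> j \<le> b) \<and>
     (\<forall>(i, j)\<in>F. \<forall>(k, l)\<in>F. \<not> (i < k \<and> k < j \<and> j < l))"

lemma noncrossing_finite: "noncrossing a b F \<Longrightarrow> finite F"
  by (rule finite_subset[of _ "{..b} \<times> {..b}"]) (auto simp: noncrossing_def)

text \<open>Apart from the chord \<open>(a, b)\<close> itself, every chord lies on one side of the end point \<open>m\<close> of
  the longest other chord from \<open>a\<close>, where \<open>m = a + 1\<close> if there is none.\<close>

lemma noncrossing_split:
  assumes F: "noncrossing a b F" and ab: "a + 2 \<le> b"
  obtains m F1 F2 where "a < m" "m < b" "noncrossing a m F1" "noncrossing m b F2"
    "F - {(a, b)} = F1 \<union> F2" "F1 \<inter> F2 = {}"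
proof -
  let ?F = "F - {(a, b)}"
  define S where "S = insert (a + 1) {j. (a, j) \<in> ?F}"
  have Sb: "j < b" "a < j" if "j \<in> S" for j
    using that F ab by (auto simp: S_def noncrossing_def)
  have fin: "finite S" by (rule finite_subset[of _ "{..b}"]) (auto dest: Sb)
  define m where "m = Max S"
  have mS: "m \<in> S" unfolding m_def by (rule Max_in[OF fin]) (simp add: S_def)
  have side: "j \<le> m \<or> m \<le> i" if ij: "(i, j) \<in> ?F" for i j
  proof (rule ccontr)
    assume "\<not> ?thesis"
    then have im: "i < m" "m < j" by auto
    have "i \<noteq> a" using ij im(2) Max_ge[OF fin, of j] by (auto simp: S_def m_def)
    then have "a < i" using F ij by (auto simp: noncrossing_def)
    then have "(a, m) \<in> ?F" using mS im(1) by (auto simp: S_def)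
    then show False using F ij im \<open>a < i\<close> by (force simp: noncrossing_def)
  qed
  show ?thesis
  proof (rule that[of m "{(i, j) \<in> ?F. j \<le> m}" "{(i, j) \<in> ?F. m \<le> i}"])
    show "a < m" "m < b" using Sb[OF mS] by auto
    show "noncrossing a m {(i, j) \<in> ?F. j \<le> m}" "noncrossing m b {(i, j) \<in> ?F. m \<le> i}"
      using F unfolding noncrossing_def by (auto split: prod.splits)
    show "?F = {(i, j) \<in> ?F. j \<le> m} \<union> {(i, j) \<in> ?F. m \<le> i}" using side by auto
    show "{(i, j) \<in> ?F. j \<le> m} \<inter> {(i, j) \<in> ?F. m \<le> i} = {}"
      using F by (force simp: noncrossing_def)
  qed
qed

lemma noncrossing_card: "noncrossing a b F \<Longrightarrow> a < b \<Longrightarrow> card F \<le> b - a - 1"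
proof (induction "b - a" arbitrary: a b F rule: less_induct)
  case less
  show ?case
  proof (cases "a + 2 \<le> b")
    case False
    then have "F = {}" using less.prems by (force simp: noncrossing_def)
    then show ?thesis by simp
  next
    case True
    obtain m F1 F2 where m: "a < m" "m < b" and F: "noncrossing a m F1" "noncrossing m b F2"
      "F - {(a, b)} = F1 \<union> F2" "F1 \<inter> F2 = {}" using noncrossing_split[OF less.prems(1) True] .
    have "card F1 \<le> m - a - 1" "card F2 \<le> b - m - 1"
      using less.hyps[OF _ F(1)] less.hyps[OF _ F(2)] m by auto
    moreover have "card F \<le> Suc (card (F - {(a, b)}))"
      using noncrossing_finite[OF less.prems(1)]
      by (metis card.insert_remove card_mono finite_insert subset_insertI)
    moreover have "card (F - {(a, b)}) \<le> card F1 + card F2" unfolding F(3) by (rule card_Un_le)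
    ultimately show ?thesis using m by linarith
  qed
qed

primrec nodes :: "'n triangulation \<Rightarrow> 'n triangulation set" where
  "nodes (Leaf i) = {}"
| "nodes (Node s t) = insert (Node s t) (nodes s \<union> nodes t)"

text \<open>If the number of chords attains the bound, then both sides of the splitting attain it, and
  \<open>(a, b)\<close> is one of the chords.\<close>

lemma triangulation_of_noncrossing:
  fixes F :: "(nat \<times> nat) set"
  assumes "noncrossing a b F" "a < b" "b \<le> CARD('n::{finite,linorder})" "card F = b - a - 1"
  shows "\<exists>t :: 'n triangulation. proper t \<and> leaves t = block a b \<and>
    leaves ` nodes t = (\<lambda>(i, j). block i j) ` F"
  using assms
proof (induction "b - a" arbitrary: a b F rule: less_induct)
  case less
  show ?case
  proof (cases "a + 2 \<le> b")
    case False
    then have "F = {}" using less.prems(1) by (force simp: noncrossing_def)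
    have b: "b = Suc a" using False less.prems(2) by simp
    have "a \<in> range (position :: 'n \<Rightarrow> nat)" using less.prems(2,3) by (simp add: range_position)
    then obtain i :: 'n where i: "position i = a" by auto
    have "a \<le> position k \<and> position k < Suc a \<longleftrightarrow> k = i" for k
      using i inj_eq[OF inj_position, of k i] by auto
    then have "block a b = {i}" by (simp add: block_def b)
    then show ?thesis using \<open>F = {}\<close> by (intro exI[of _ "Leaf i"]) simp
  next
    case True
    obtain m F1 F2 where m: "a < m" "m < b" and F: "noncrossing a m F1" "noncrossing m b F2"
      "F - {(a, b)} = F1 \<union> F2" "F1 \<inter> F2 = {}" using noncrossing_split[OF less.prems(1) True] .
    have le: "card F1 \<le> m - a - 1" "card F2 \<le> b - m - 1"
      using noncrossing_card[OF F(1) m(1)] noncrossing_card[OF F(2) m(2)] by auto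
    have "card (F - {(a, b)}) = card F1 + card F2"
      unfolding F(3) using F(4) by (intro card_Un_disjoint noncrossing_finite[OF F(1)] noncrossing_finite[OF F(2)])
    moreover have "card (F - {(a, b)}) = (if (a, b) \<in> F then card F - 1 else card F)"
      using noncrossing_finite[OF less.prems(1)] by (simp add: card_Diff_singleton_if)
    ultimately have ab: "(a, b) \<in> F" and eq: "card F1 = m - a - 1" "card F2 = b - m - 1"
      using le less.prems(4) m by (auto split: if_splits)
    have sm: "m - a < b - a" "b - m < b - a" "m \<le> CARD('n)" using m less.prems(3) by linarith+
    obtain s :: "'n triangulation" where s: "proper s" "leaves s = block a m"
      "leaves ` nodes s = (\<lambda>(i, j). block i j) ` F1"
      using less.hyps[OF sm(1) F(1) m(1) sm(3) eq(1)] by blast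
    obtain t :: "'n triangulation" where t: "proper t" "leaves t = block m b"
      "leaves ` nodes t = (\<lambda>(i, j). block i j) ` F2"
      using less.hyps[OF sm(2) F(2) m(2) less.prems(3) eq(2)] by blast
    have "leaves (Node s t) = block a b" using s t m by (auto simp: block_def)
    moreover have "proper (Node s t)" using s t by (auto simp: block_def)
    moreover have "F = insert (a, b) (F1 \<union> F2)" using ab F(3) by blast
    ultimately show ?thesis
      using s(3) t(3) by (intro exI[of _ "Node s t"]) (simp add: image_Un)
  qed
qed

lemma isometric_iff:
  "isometric r t p u \<longleftrightarrow> (\<forall>i\<in>leaves t. norm (r $ i *\<^sub>R u $ i) = norm (r $ i *\<^sub>R p $ i)) \<and>
    (\<forall>s\<in>nodes t. norm (edge r s u) = norm (edge r s p))"
  by (induction t) auto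

lemma nodes_proper: "proper t \<Longrightarrow> s \<in> nodes t \<Longrightarrow> proper s"
  by (induction t) auto

lemma disjoint_diagonals_noncrossing:
  fixes i j k l :: "'n::{finite,linorder}"
  assumes "i < k" "k < j" "j < l"
  shows "\<not> disjoint_diagonals (i, j) (k, l)"
proof -
  let ?x = "\<lambda>i::'n. 2 * pi * real (position i) / real CARD('n)"
  have "?x i < ?x j" if "i < j" for i j :: 'n
    using position_less[OF that] by (intro divide_strict_right_mono) auto
  moreover have "?x l < 2 * pi"
    using position_less_card[of l] by (simp add: divide_simps)
  moreover have "?x i \<ge> 0" by simp
  ultimately show ?thesis
    using chords_cross[of "?x i" "?x k" "?x j" "?x l"] assms
    by (fastforce simp: disjoint_diagonals_def ngon_vertex_def position_def)
qed

text \<open>The \<open>n - 3\<close> diagonals, together with the chord that is the last side, attain the bound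
  for the chords between the vertices \<open>0, \<dots>, n - 1\<close>. One more triangle, of which one
  edge has length \<open>0\<close>, joins the last side \<open>l\<close> to the others.\<close>

lemma bending_system_triangulation:
  fixes d :: "nat \<Rightarrow> 'n::{finite,linorder} \<times> 'n"
  assumes d: "bending_system d" and n: "CARD('n) \<ge> 4"
  obtains t and l :: 'n where "proper t" "leaves t = UNIV"
    "leaves ` nodes t = insert UNIV (insert (- {l}) ((\<lambda>k. {fst (d k)..<snd (d k)}) ` {1..CARD('n) - 3}))"
proof -
  let ?N = "CARD('n)" and ?K = "{1..CARD('n) - 3}"
  have "?N - 1 \<in> range (position :: 'n \<Rightarrow> nat)" using n by (simp add: range_position)
  then obtain l :: 'n where l: "position l = ?N - 1" by auto
  define G where "G = (\<lambda>k. (position (fst (d k)), position (snd (d k)))) ` ?K"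
  define F where "F = insert (0, ?N - 1) G"
  have dg: "is_diagonal (d k)" if "k \<in> ?K" for k using d that by (simp add: bending_system_def)
  have diag: "position i + 2 \<le> position j" "position j \<le> ?N - 1" "\<not> (position i = 0 \<and> position j = ?N - 1)"
    if ij: "is_diagonal (i, j)" for i j :: 'n
  proof -
    obtain k where "i < k" "k < j" using ij by (auto simp: is_diagonal_def)
    then have "position i < position k" "position k < position j" by (auto intro: position_less)
    then show "position i + 2 \<le> position j" by simp
    show "position j \<le> ?N - 1" using position_less_card[of j] by simp
    show "\<not> (position i = 0 \<and> position j = ?N - 1)"
    proof
      assume "position i = 0 \<and> position j = ?N - 1"
      then have r: "position i = 0" "position j = ?N - 1" by auto
      have "{..<i} = {}" using r(1) by (simp add: position_def)
      moreover have "{j<..} = {}"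
      proof -
        have False if "j < k" for k using position_less[OF that] position_less_card[of k] r(2) by simp
        then show ?thesis by auto
      qed
      ultimately show False using ij by (simp add: is_diagonal_def)
    qed
  qed
  have G: "\<exists>i j. e = (position i, position j) \<and> is_diagonal (i, j) \<and> (\<exists>k\<in>?K. d k = (i, j))" if e: "e \<in> G" for e
  proof -
    obtain k where k: "k \<in> ?K" "e = (position (fst (d k)), position (snd (d k)))"
      using e by (auto simp: G_def)
    then show ?thesis
      using dg[OF k(1)] by (intro exI[of _ "fst (d k)"] exI[of _ "snd (d k)"]) auto
  qed
  have "card G = card ?K"
    unfolding G_def
  proof (rule card_image, rule inj_onI)
    fix k m assume k: "k \<in> ?K" "m \<in> ?K"
      and "(position (fst (d k)), position (snd (d k))) = (position (fst (d m)), position (snd (d m)))"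
    then have "d k = d m" by (simp add: prod_eq_iff inj_eq[OF inj_position])
    then show "k = m" using d k by (auto simp: bending_system_def inj_on_def)
  qed
  moreover have "(0, ?N - 1) \<notin> G" using G diag(3) by (metis prod.inject)
  moreover have "finite G" by (simp add: G_def)
  ultimately have cF: "card F = ?N - 1 - 0 - 1" using n by (simp add: F_def)
  have cross: "\<not> (fst e < fst e' \<and> fst e' < snd e \<and> snd e < snd e')" if e: "e \<in> F" "e' \<in> F" for e e'
  proof (cases "e = (0, ?N - 1) \<or> e' = (0, ?N - 1)")
    case True
    have "snd e' \<le> ?N - 1" using e(2) G[of e'] diag(2) by (auto simp: F_def)
    then show ?thesis using True by auto
  next
    case False
    then obtain i j k m where ij: "e = (position i, position j)" "e' = (position k, position m)"
      "\<exists>q\<in>?K. d q = (i, j)" "\<exists>q\<in>?K. d q = (k, m)"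
      using G e unfolding F_def by blast
    have "\<not> (i < k \<and> k < j \<and> j < m)"
    proof
      assume c: "i < k \<and> k < j \<and> j < m"
      obtain q q' where q: "q \<in> ?K" "q' \<in> ?K" "d q = (i, j)" "d q' = (k, m)" using ij by blast
      moreover have "q \<noteq> q'" using q c by auto
      ultimately have "disjoint_diagonals (i, j) (k, m)"
        using d unfolding bending_system_def by metis
      then show False using disjoint_diagonals_noncrossing c by blast
    qed
    then show ?thesis by (simp add: ij position_less_iff)
  qed
  have "0 \<le> fst e \<and> fst e + 2 \<le> snd e \<and> snd e \<le> ?N - 1" if "e \<in> F" for e
    using that G[of e] diag(1,2) n by (auto simp: F_def)
  then have nc: "noncrossing 0 (?N - 1) F"
    using cross unfolding noncrossing_def by (auto simp: case_prod_beta)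
  obtain t :: "'n triangulation" where t: "proper t" "leaves t = block 0 (?N - 1)"
    "leaves ` nodes t = (\<lambda>(i, j). block i j) ` F"
    using triangulation_of_noncrossing[where 'n='n, OF nc _ _ cF] n by auto
  have bl: "block 0 (?N - 1) = - {l}"
  proof -
    have "position k < ?N - 1 \<longleftrightarrow> k \<noteq> l" for k
      using position_less_card[of k] l inj_position[THEN inj_eq, of k l] by linarith
    then show ?thesis by (auto simp: block_def)
  qed
  have "(\<lambda>(i, j). block i j) ` G = (\<lambda>k. {fst (d k)..<snd (d k)}) ` ?K"
    unfolding G_def by (simp add: image_image block_position)
  then show ?thesis
    using t bl by (intro that[of "Node t (Leaf l)" l]) (auto simp: F_def)
qed

text \<open>Among the polygons with side lengths \<open>r\<close>, only the diagonals can have different lengths: the chord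
  under all sides but \<open>l\<close> is as long as the side \<open>l\<close>, and the chord under all sides is \<open>0\<close>.\<close>

lemma isometry_class_bending:
  fixes d :: "nat \<Rightarrow> 'n::{finite,linorder} \<times> 'n"
  assumes t: "proper t" "leaves t = UNIV"
    "leaves ` nodes t = insert UNIV (insert (- {l}) ((\<lambda>k. {fst (d k)..<snd (d k)}) ` {1..CARD('n) - 3}))"
    and r: "\<And>i. r $ i > 0" and p: "p \<in> polygons r"
  shows "isometry_class r t p =
    {u \<in> polygons r. \<forall>k\<in>{1..CARD('n) - 3}. bending_lift r (d k) u = bending_lift r (d k) p}"
proof -
  let ?K = "{1..CARD('n) - 3}"
  define nrm where "nrm A u = norm (\<Sum>i\<in>A. r $ i *\<^sub>R u $ i)" for A :: "'n set" and u :: "real^3^'n::{finite,linorder}"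
  have b: "bending_lift r (d k) u = (nrm {fst (d k)..<snd (d k)} u)\<^sup>2 / 2" for k u
    by (simp add: bending_lift_def diagonal_vector_def nrm_def split: prod.splits)
  have nd: "(\<forall>s\<in>nodes t. norm (edge r s u) = norm (edge r s p)) \<longleftrightarrow>
      (\<forall>A\<in>leaves ` nodes t. nrm A u = nrm A p)" for u
    using edge_eq_sum[OF nodes_proper[OF t(1)]] by (auto simp: nrm_def)
  have iso: "isometric r t p u \<longleftrightarrow> (\<forall>i. norm (u $ i) = norm (p $ i)) \<and>
      nrm UNIV u = nrm UNIV p \<and> nrm (- {l}) u = nrm (- {l}) p \<and>
      (\<forall>k\<in>?K. bending_lift r (d k) u = bending_lift r (d k) p)" for u
  proof -
    have "norm (r $ i *\<^sub>R u $ i) = norm (r $ i *\<^sub>R p $ i) \<longleftrightarrow> norm (u $ i) = norm (p $ i)" for i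
      using r[of i] by simp
    moreover have "nrm A u \<ge> 0" for A u by (simp add: nrm_def)
    ultimately show ?thesis unfolding isometric_iff t(2) b nd t(3) by simp
  qed
  have e: "edge r t u = (\<Sum>i\<in>UNIV. r $ i *\<^sub>R u $ i)" for u
    unfolding edge_eq_sum[OF t(1)] t(2) ..
  have nl: "nrm (- {l}) u = r $ l" and nU: "nrm UNIV u = 0" if u: "u \<in> polygons r" for u
  proof -
    have "(\<Sum>i\<in>UNIV. r $ i *\<^sub>R u $ i) = r $ l *\<^sub>R u $ l + (\<Sum>i\<in>- {l}. r $ i *\<^sub>R u $ i)"
      by (simp add: sum.remove[of UNIV l] Compl_eq_Diff_UNIV)
    then have "(\<Sum>i\<in>- {l}. r $ i *\<^sub>R u $ i) = - (r $ l *\<^sub>R u $ l)"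
      using u by (simp add: polygons_def eq_neg_iff_add_eq_0 add.commute)
    then show "nrm (- {l}) u = r $ l"
      using u r[of l] by (simp add: nrm_def polygons_def)
    show "nrm UNIV u = 0" using u by (simp add: nrm_def polygons_def)
  qed
  show ?thesis
    using nl nU p by (auto simp: isometry_class_def iso e) (auto simp: polygons_def)
qed

section \<open>The rotation group and the moduli space\<close>

lemma SO3_orthogonal: "A \<in> SO3 \<Longrightarrow> orthogonal_matrix A"
  by (simp add: SO3_def rotation_matrix_def)

lemma SO3_one: "mat 1 \<in> SO3"
  by (simp add: SO3_def rotation_matrix_def orthogonal_matrix_id det_I)

lemma SO3_mult: "A \<in> SO3 \<Longrightarrow> B \<in> SO3 \<Longrightarrow> A ** B \<in> SO3"
  by (simp add: SO3_def rotation_matrix_def orthogonal_matrix_mul det_mul)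

lemma SO3_transpose: "A \<in> SO3 \<Longrightarrow> transpose A \<in> SO3"
  by (simp add: SO3_def rotation_matrix_def orthogonal_matrix_transpose)

lemma SO3_transpose_cancel: "A \<in> SO3 \<Longrightarrow> transpose A *v (A *v x) = x"
  using SO3_orthogonal[of A] by (simp add: matrix_vector_mul_assoc orthogonal_matrix_def)

lemma SO3_inner: "A \<in> SO3 \<Longrightarrow> (A *v x) \<bullet> (A *v y) = x \<bullet> y"
  by (metis SO3_transpose_cancel dot_lmul_matrix vector_transpose_matrix)

lemma SO3_norm: "A \<in> SO3 \<Longrightarrow> norm (A *v x) = norm x"
  by (simp add: norm_eq_sqrt_inner SO3_inner)

lemma SO3_sgn: "A \<in> SO3 \<Longrightarrow> sgn (A *v x) = A *v sgn x"
  by (simp add: sgn_div_norm SO3_norm matrix_vector_mult_scaleR)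

lemma SO3_cross: "A \<in> SO3 \<Longrightarrow> cross3 (A *v x) (A *v y) = A *v (cross3 x y)"
  by (simp add: SO3_def cross_rotation_matrix)

lemma compact_SO3: "compact SO3"
proof -
  have eq: "SO3 = {A :: real^3^3. \<forall>i j. (\<Sum>k\<in>UNIV. A $ k $ i * A $ k $ j) = (if i = j then 1 else 0)} \<inter> {A. det A = 1}"
    unfolding SO3_def rotation_matrix_def orthogonal_matrix
    by (auto simp: vec_eq_iff matrix_matrix_mult_def transpose_def mat_def)
  have 1: "closed {A :: real^3^3. \<forall>i j. (\<Sum>k\<in>UNIV. A $ k $ i * A $ k $ j) = (if i = j then 1 else 0)}"
  proof (intro closed_Collect_all)
    show "closed {A :: real^3^3. (\<Sum>k\<in>UNIV. A $ k $ i * A $ k $ j) = (if i = j then 1 else 0)}" for i j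
      by (rule closed_Collect_eq[OF _ continuous_on_const]) (intro continuous_intros)
  qed
  have 2: "closed {A :: real^3^3. det A = 1}"
    unfolding det_3 by (rule closed_Collect_eq[OF _ continuous_on_const]) (intro continuous_intros)
  have "closed SO3" unfolding eq by (rule closed_Int[OF 1 2])
  moreover have "bounded SO3"
    unfolding bounded_iff
  proof (intro exI[of _ 3] ballI)
    fix A :: "real^3^3" assume A: "A \<in> SO3"
    have "norm (A $ i) = 1" for i
    proof -
      have "A ** transpose A = mat 1" using SO3_orthogonal[OF A] by (simp add: orthogonal_matrix_def)
      then have "(A ** transpose A) $ i $ i = 1" by (simp add: mat_def)
      then have "A $ i \<bullet> A $ i = 1" by (simp add: matrix_matrix_mult_def transpose_def inner_vec_def)
      then show ?thesis by (simp add: norm_eq_sqrt_inner)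
    qed
    then show "norm A \<le> 3"
      using L2_set_le_sum[of UNIV "\<lambda>i. norm (A $ i)"] by (simp add: norm_vec_def)
  qed
  ultimately show ?thesis by (simp add: compact_eq_bounded_closed)
qed

lemma matrix_lie_group_SO3: "matrix_lie_group SO3"
  unfolding matrix_lie_group_def
proof (intro conjI ballI)
  fix A :: "real^3^3" assume A: "A \<in> SO3"
  have AA: "A ** transpose A = mat 1" "transpose A ** A = mat 1"
    using SO3_orthogonal[OF A] by (auto simp: orthogonal_matrix_def)
  then show i: "invertible A" unfolding invertible_def by blast
  have "A ** matrix_inv A = mat 1"
    using someI_ex[OF i[unfolded invertible_def]] by (simp add: matrix_inv_def)
  then have "matrix_inv A = transpose A"
    by (metis AA(2) matrix_mul_assoc matrix_mul_lid matrix_mul_rid)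
  then show "matrix_inv A \<in> SO3" using SO3_transpose[OF A] by simp
next
  have "SO3 \<subseteq> {A :: real^3^3. invertible A}"
    using SO3_orthogonal by (auto simp: orthogonal_matrix_def invertible_def)
  then show "closedin (top_of_set {A. invertible A}) SO3"
    using compact_imp_closed[OF compact_SO3] by (simp add: closed_subset)
qed (auto simp: SO3_one SO3_mult)

lemma rotate_one [simp]: "rotate_polygon (mat 1) u = u"
  by (simp add: rotate_polygon_def vec_eq_iff)

lemma rotate_mult: "rotate_polygon (A ** B) u = rotate_polygon A (rotate_polygon B u)"
  by (simp add: rotate_polygon_def matrix_vector_mul_assoc)

lemma rotate_nth [simp]: "rotate_polygon A u $ i = A *v (u $ i)"
  by (simp add: rotate_polygon_def)

lemma rotate_transpose: "A \<in> SO3 \<Longrightarrow> rotate_polygon (transpose A) (rotate_polygon A u) = u"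
  unfolding vec_eq_iff rotate_nth by (simp only: SO3_transpose_cancel simp_thms)

lemma mem_polygon_class: "w \<in> polygon_class u \<longleftrightarrow> (\<exists>A\<in>SO3. w = rotate_polygon A u)"
  by (auto simp: polygon_class_def)

lemma polygon_class_self: "u \<in> polygon_class u"
  using SO3_one by (force simp: mem_polygon_class)

lemma polygon_class_eq: "polygon_class u = polygon_class w \<longleftrightarrow> (\<exists>A\<in>SO3. w = rotate_polygon A u)"
proof
  assume "polygon_class u = polygon_class w"
  then have "w \<in> polygon_class u" using polygon_class_self by metis
  then show "\<exists>A\<in>SO3. w = rotate_polygon A u" by (simp add: mem_polygon_class)
next
  have sub: "polygon_class (rotate_polygon A u) \<subseteq> polygon_class u" if "A \<in> SO3" for A u
  proof
    fix w assume "w \<in> polygon_class (rotate_polygon A u)"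
    then obtain B where "B \<in> SO3" "w = rotate_polygon (B ** A) u"
      by (auto simp: mem_polygon_class rotate_mult)
    then show "w \<in> polygon_class u" using SO3_mult[of B A] that by (auto simp: mem_polygon_class)
  qed
  assume "\<exists>A\<in>SO3. w = rotate_polygon A u"
  then obtain A where A: "A \<in> SO3" "w = rotate_polygon A u" by blast
  then have "u = rotate_polygon (transpose A) w" by (simp add: rotate_transpose)
  then show "polygon_class u = polygon_class w"
    using sub[OF A(1), of u] sub[OF SO3_transpose[OF A(1)], of w] A(2) by auto
qed

lemma polygon_class_rotate: "A \<in> SO3 \<Longrightarrow> polygon_class (rotate_polygon A u) = polygon_class u"
  using polygon_class_eq by blast

lemma rotate_polygons:
  assumes "A \<in> SO3" "u \<in> polygons r"
  shows "rotate_polygon A u \<in> polygons r"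
proof -
  have "(\<Sum>i\<in>UNIV. r $ i *\<^sub>R (A *v u $ i)) = A *v (\<Sum>i\<in>UNIV. r $ i *\<^sub>R u $ i)"
    by (simp add: linear_sum[OF matrix_vector_mul_linear] matrix_vector_mult_scaleR)
  then show ?thesis using assms by (simp add: polygons_def SO3_norm)
qed

lemma polygon_class_in_moduli: "polygon_class u \<in> moduli r \<longleftrightarrow> u \<in> polygons r"
proof
  assume "polygon_class u \<in> moduli r"
  then obtain w where w: "w \<in> polygons r" "polygon_class w = polygon_class u" by (auto simp: moduli_def)
  then show "u \<in> polygons r" using rotate_polygons by (auto simp: polygon_class_eq)
qed (simp add: moduli_def)

lemma lift_subset: "K \<subseteq> moduli r \<Longrightarrow> lift K \<subseteq> polygons r"
  using polygon_class_in_moduli by (auto simp: lift_def)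

lemma lift_rotate: "A \<in> SO3 \<Longrightarrow> rotate_polygon A u \<in> lift K \<longleftrightarrow> u \<in> lift K"
  by (simp add: lift_def polygon_class_rotate)

lemma compact_polygons: "compact (polygons r)"
proof -
  have eq: "polygons r = {u. \<forall>i. norm (u $ i) = 1} \<inter> {u. (\<Sum>i\<in>UNIV. r $ i *\<^sub>R u $ i) = 0}"
    by (auto simp: polygons_def)
  have 1: "closed {u :: real^3^'a. \<forall>i. norm (u $ i) = 1}"
    by (intro closed_Collect_all closed_Collect_eq[OF _ continuous_on_const] continuous_intros)
  have 2: "closed {u :: real^3^'a. (\<Sum>i\<in>UNIV. r $ i *\<^sub>R u $ i) = 0}"
    by (rule closed_Collect_eq[OF _ continuous_on_const]) (intro continuous_intros)
  have "closed (polygons r)" unfolding eq by (rule closed_Int[OF 1 2])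
  moreover have "bounded (polygons r)"
    unfolding bounded_iff
  proof (intro exI[of _ "real CARD('a)"] ballI)
    fix u assume "u \<in> polygons r"
    then show "norm u \<le> real CARD('a)"
      using L2_set_le_sum[of UNIV "\<lambda>i. norm (u $ i)"] by (simp add: norm_vec_def polygons_def)
  qed
  ultimately show ?thesis by (simp add: compact_eq_bounded_closed)
qed

lemma smooth_at_rotate: "smooth_at (\<lambda>z :: (real^3^3) \<times> (real^3^'n::finite). rotate_polygon (fst z) (snd z)) x"
proof -
  have "smooth_at (\<lambda>z :: (real^3^3) \<times> (real^3^'n). fst z $ a $ b) x" for a b
    by (intro smooth_at_vec_nth smooth_at_compose_linear[OF bounded_linear_fst] smooth_at_ident)
  moreover have "smooth_at (\<lambda>z :: (real^3^3) \<times> (real^3^'n). snd z $ i $ b) x" for i b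
    by (intro smooth_at_vec_nth smooth_at_compose_linear[OF bounded_linear_snd] smooth_at_ident)
  ultimately show ?thesis
    unfolding rotate_polygon_def matrix_vector_mult_def
    by (intro smooth_at_vec_lambda smooth_at_sum smooth_at_mult)
qed

lemma continuous_on_rotate:
  "continuous_on S (\<lambda>z :: (real^3^3) \<times> (real^3^'n::finite). rotate_polygon (fst z) (snd z))"
  by (intro continuous_at_imp_continuous_on ballI smooth_at_isCont smooth_at_rotate)

lemma continuous_on_rotate_fixed: "continuous_on S (rotate_polygon A)"
  unfolding rotate_polygon_def matrix_vector_mult_def by (intro continuous_intros)

lemma topspace_moduli: "topspace (moduli_top r) = moduli r"
  using quotient_map_polygon_class[of r] by (simp add: quotient_map_def moduli_def)

text \<open>The saturation of an open set is a union of rotated copies of it.\<close>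

lemma open_map_polygon_class: "open_map (top_of_set (polygons r)) (moduli_top r) polygon_class"
  unfolding open_map_def
proof (intro allI impI)
  fix U assume U: "openin (top_of_set (polygons r)) U"
  then have Up: "U \<subseteq> polygons r" by (meson openin_imp_subset)
  have "{u \<in> polygons r. polygon_class u \<in> polygon_class ` U} =
      (\<Union>A\<in>SO3. {u \<in> polygons r. rotate_polygon A u \<in> U})" (is "?L = ?R")
  proof
    show "?L \<subseteq> ?R"
    proof
      fix u assume "u \<in> ?L"
      then obtain w where w: "u \<in> polygons r" "w \<in> U" "polygon_class u = polygon_class w" by auto
      then obtain A where "A \<in> SO3" "w = rotate_polygon A u" by (auto simp: polygon_class_eq)
      then show "u \<in> ?R" using w by auto
    qed
    show "?R \<subseteq> ?L"
    proof
      fix u assume "u \<in> ?R"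
      then obtain A where "A \<in> SO3" "u \<in> polygons r" "rotate_polygon A u \<in> U" by blast
      then show "u \<in> ?L" using polygon_class_rotate[of A u] image_eqI[of "polygon_class u" polygon_class "rotate_polygon A u" U] by simp
    qed
  qed
  moreover have "openin (top_of_set (polygons r)) {u \<in> polygons r. rotate_polygon A u \<in> U}" if A: "A \<in> SO3" for A
  proof -
    have "openin (top_of_set (polygons r)) (polygons r \<inter> rotate_polygon A -` U)"
      by (rule continuous_openin_preimage[OF continuous_on_rotate_fixed _ U])
         (use rotate_polygons[OF A] in blast)
    then show ?thesis by (simp only: vimage_def Int_def mem_Collect_eq)
  qed
  ultimately have "openin (top_of_set (polygons r)) {u \<in> polygons r. polygon_class u \<in> polygon_class ` U}"
    by (simp only:) (rule openin_Union, blast)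
  then show "openin (moduli_top r) (polygon_class ` U)"
    using image_mono[OF Up] by (simp add: openin_moduli_top moduli_def)
qed

text \<open>The saturation of a closed set is closed, because the group is compact.\<close>

lemma closed_map_polygon_class: "closed_map (top_of_set (polygons r)) (moduli_top r) polygon_class"
  unfolding closed_map_def
proof (intro allI impI)
  fix C assume C: "closedin (top_of_set (polygons r)) C"
  then have Cp: "C \<subseteq> polygons r" and Cc: "compact C"
    using closedin_compact[OF compact_polygons] closedin_imp_subset by blast+
  have "{u \<in> polygons r. polygon_class u \<in> polygon_class ` C} =
      (\<lambda>z. rotate_polygon (fst z) (snd z)) ` (SO3 \<times> C)" (is "?L = ?R")
  proof
    show "?L \<subseteq> ?R"
    proof
      fix u assume "u \<in> ?L"
      then obtain w where w: "w \<in> C" "polygon_class w = polygon_class u" by auto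
      then obtain A where "A \<in> SO3" "u = rotate_polygon A w" by (auto simp: polygon_class_eq)
      then show "u \<in> ?R" using w(1) by force
    qed
    show "?R \<subseteq> ?L"
    proof
      fix u assume "u \<in> ?R"
      then obtain A w where Aw: "A \<in> SO3" "w \<in> C" "u = rotate_polygon A w" by auto
      then show "u \<in> ?L"
        using rotate_polygons[OF Aw(1), of w] polygon_class_rotate[OF Aw(1), of w] Cp by auto
    qed
  qed
  moreover have "compact ((\<lambda>z. rotate_polygon (fst z) (snd z)) ` (SO3 \<times> C))"
    by (intro compact_continuous_image continuous_on_rotate compact_Times compact_SO3 Cc)
  ultimately have "closedin (top_of_set (polygons r)) {u \<in> polygons r. polygon_class u \<in> polygon_class ` C}"
    by (metis (no_types, lifting) closed_subset compact_imp_closed mem_Collect_eq subsetI)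
  moreover have "polygon_class ` C \<subseteq> moduli r" using Cp by (auto simp: moduli_def)
  ultimately show "closedin (moduli_top r) (polygon_class ` C)"
    using quotient_map_polygon_class[of r] unfolding quotient_map_closedin topspace_moduli by simp
qed

lemma continuous_map_polygon_class:
  "continuous_map (top_of_set (polygons r)) (moduli_top r) polygon_class"
  by (rule quotient_imp_continuous_map[OF quotient_map_polygon_class])

lemma polygon_class_surj: "polygon_class ` topspace (top_of_set (polygons r)) = topspace (moduli_top r)"
  by (simp add: topspace_moduli moduli_def)

text \<open>Normality passes to the image under a closed map.\<close>

lemma Hausdorff_moduli: "Hausdorff_space (moduli_top r)"
proof (rule normal_t1_imp_Hausdorff_space)
  have "metrizable_space (top_of_set (polygons r))"
    by (simp add: metrizable_space_euclidean metrizable_space_subtopology)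
  then show "normal_space (moduli_top r)"
    by (intro normal_space_continuous_closed_map_image[OF _ continuous_map_polygon_class
          closed_map_polygon_class polygon_class_surj] metrizable_imp_normal_space)
  show "t1_space (moduli_top r)"
    unfolding t1_space_closedin_singleton topspace_moduli
  proof
    fix p assume "p \<in> moduli r"
    then obtain u where "u \<in> polygons r" "p = polygon_class u" by (auto simp: moduli_def)
    moreover have "closedin (top_of_set (polygons r)) {u}" if "u \<in> polygons r"
      using that by (intro closed_subset) auto
    ultimately show "closedin (moduli_top r) {p}"
      using closed_map_polygon_class[of r] unfolding closed_map_def by (metis image_insert image_empty)
  qed
qed

lemma second_countable_euclidean: "second_countable (euclidean :: 'a::euclidean_space topology)"
proof -
  obtain B :: "'a set set" where B: "countable B" "\<And>C. C \<in> B \<Longrightarrow> open C"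
    "\<And>S. open S \<Longrightarrow> \<exists>U. U \<subseteq> B \<and> S = \<Union>U"
    using univ_second_countable by blast
  show ?thesis
    unfolding second_countable_def
  proof (intro exI[of _ B] conjI B(1) ballI allI impI)
    show "openin euclidean V" if "V \<in> B" for V using B(2)[OF that] by simp
    show "\<exists>V\<in>B. x \<in> V \<and> V \<subseteq> U" if "openin euclidean U \<and> x \<in> U" for U x
      using B(3)[of U] that by auto
  qed
qed

lemma second_countable_moduli: "second_countable (moduli_top r)"
  by (rule second_countable_open_map_image[OF continuous_map_polygon_class open_map_polygon_class
        polygon_class_surj])
     (intro second_countable_subtopology second_countable_euclidean)

text \<open>The projection is open, hence so is its restriction to a saturated set.\<close>

lemma quotient_map_lift:
  assumes K: "K \<subseteq> moduli r"
  shows "quotient_map (top_of_set (lift K)) (subtopology (moduli_top r) K) polygon_class"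
proof -
  have lK: "lift K \<subseteq> polygons r" by (rule lift_subset[OF K])
  have e: "subtopology (top_of_set (polygons r)) (lift K) = top_of_set (lift K)"
    using lK by (simp add: subtopology_subtopology inf.absorb2)
  have im: "polygon_class ` lift K = K" using K by (auto simp: lift_def moduli_def)
  show ?thesis
  proof (rule continuous_open_imp_quotient_map)
    show "continuous_map (top_of_set (lift K)) (subtopology (moduli_top r) K) polygon_class"
      using continuous_map_from_subtopology[OF continuous_map_polygon_class, of r "lift K"]
      unfolding e by (auto intro: continuous_map_into_subtopology simp: lift_def)
    have "{u \<in> topspace (top_of_set (polygons r)). polygon_class u \<in> K} = lift K"
      using lK by (auto simp: lift_def)
    from open_map_restriction[OF open_map_polygon_class this]
    show "open_map (top_of_set (lift K)) (subtopology (moduli_top r) K) polygon_class" unfolding e .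
    show "polygon_class ` topspace (top_of_set (lift K)) = topspace (subtopology (moduli_top r) K)"
      using im K by (simp add: topspace_moduli Int_absorb1)
  qed
qed

lemma orbispace_chart_lift:
  fixes K :: "(real^3^'n::finite) set set"
  assumes K: "K \<subseteq> moduli r" and c: "compact (lift K)"
  shows "orbispace_chart (subtopology (moduli_top r) K) K (lift K) SO3 rotate_polygon polygon_class"
proof -
  let ?act = "\<lambda>(A :: real^3^3, u :: real^3^'n). rotate_polygon A u"
  have act: "?act = (\<lambda>z. rotate_polygon (fst z) (snd z))" by (auto simp: fun_eq_iff)
  have "continuous_on (SO3 \<times> lift K) (\<lambda>(A, u). (rotate_polygon A u, u))"
    unfolding case_prod_beta by (intro continuous_on_Pair continuous_on_rotate continuous_on_snd continuous_on_id)
  then have cm: "continuous_map (top_of_set (SO3 \<times> lift K)) (top_of_set (lift K \<times> lift K))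
      (\<lambda>(A, u). (rotate_polygon A u, u))"
    by (auto simp: lift_rotate)
  have "compact_space (top_of_set (SO3 \<times> lift K))"
    by (simp add: compact_space_subtopology compact_Times[OF compact_SO3 c])
  moreover have "kc_space (top_of_set (lift K \<times> lift K))"
    by (simp add: Hausdorff_imp_kc_space Hausdorff_space_subtopology)
  ultimately have "proper_map (top_of_set (SO3 \<times> lift K)) (top_of_set (lift K \<times> lift K))
      (\<lambda>(A, u). (rotate_polygon A u, u))"
    using cm by (rule continuous_imp_proper_map)
  moreover have "smooth_map (SO3 \<times> lift K) ?act"
    unfolding smooth_map_def act
  proof
    fix x :: "(real^3^3) \<times> (real^3^'n)"
    show "\<exists>U g. x \<in> U \<and> smooth_on g U \<and> (\<forall>y\<in>U \<inter> (SO3 \<times> lift K). g y = rotate_polygon (fst y) (snd y))"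
      by (intro exI[of _ UNIV] exI[of _ "\<lambda>z. rotate_polygon (fst z) (snd z)"])
         (simp add: smooth_at_imp_on smooth_at_rotate)
  qed
  moreover have "openin (subtopology (moduli_top r) K) K"
    using openin_topspace[of "subtopology (moduli_top r) K"] K by (simp add: topspace_moduli Int_absorb1)
  moreover have "quotient_map (top_of_set (lift K)) (subtopology (subtopology (moduli_top r) K) K) polygon_class"
    using quotient_map_lift[OF K] by (simp add: subtopology_subtopology)
  ultimately show ?thesis
    unfolding orbispace_chart_def using matrix_lie_group_SO3 lift_rotate
    by (auto simp: rotate_mult polygon_class_eq)
qed

section \<open>Degenerate polygons\<close>

lemma degenerate_iff:
  assumes "u $ i \<noteq> 0"
  shows "degenerate u \<longleftrightarrow> (\<forall>j. cross3 (u $ i) (u $ j) = 0)"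
proof -
  have "insert 0 (range (\<lambda>j. u $ j)) = insert 0 (insert (u $ i) (range (\<lambda>j. u $ j)))" by auto
  then show ?thesis
    unfolding degenerate_def cross_eq_0 using collinear_triples[of 0 "u $ i" "range (\<lambda>j. u $ j)"] assms
    by simp
qed

lemma polygon_side_nonzero: "u \<in> polygons r \<Longrightarrow> u $ i \<noteq> 0"
proof -
  assume "u \<in> polygons r"
  then have "norm (u $ i) = 1" by (simp add: polygons_def)
  then show ?thesis by auto
qed

lemma degenerate_rotate:
  assumes "A \<in> SO3" "u \<in> polygons r"
  shows "degenerate (rotate_polygon A u) \<longleftrightarrow> degenerate u"
proof -
  have "A *v x = 0 \<longleftrightarrow> x = 0" for x by (metis SO3_norm[OF assms(1)] norm_eq_zero)
  then show ?thesis
    using degenerate_iff[OF polygon_side_nonzero[OF assms(2)]]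
      degenerate_iff[OF polygon_side_nonzero[OF rotate_polygons[OF assms]]]
    by (simp add: SO3_cross[OF assms(1)])
qed

lemma polygon_class_in_moduli_nd:
  "polygon_class u \<in> moduli_nd r \<longleftrightarrow> u \<in> polygons r \<and> \<not> degenerate u"
proof
  assume "polygon_class u \<in> moduli_nd r"
  then obtain w where w: "w \<in> polygons r" "\<not> degenerate w" "polygon_class w = polygon_class u"
    by (auto simp: moduli_nd_def)
  then obtain A where "A \<in> SO3" "u = rotate_polygon A w" by (auto simp: polygon_class_eq)
  then show "u \<in> polygons r \<and> \<not> degenerate u" using w rotate_polygons degenerate_rotate by metis
qed (auto simp: moduli_nd_def)

text \<open>The sides of a degenerate polygon are \<open>\<plusminus>\<close> one of them, and the signs solve
  \<open>\<Sum>\<epsilon>\<^sub>i r\<^sub>i = 0\<close>.\<close>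

lemma generic_imp_nondegenerate:
  fixes r :: "real^'n::finite"
  assumes "generic r" "u \<in> polygons r"
  shows "\<not> degenerate u"
proof
  assume d: "degenerate u"
  define i :: 'n where "i = undefined"
  have n: "norm (u $ j) = 1" for j using assms(2) by (simp add: polygons_def)
  define e where "e j = u $ i \<bullet> u $ j" for j
  have c: "cross3 (u $ i) (u $ j) = 0" for j
    using d degenerate_iff[OF polygon_side_nonzero[OF assms(2)]] by blast
  have u: "u $ j = e j *\<^sub>R u $ i" for j
    using cross_self_cross[OF n, of i "u $ j"] c[of j] by (simp add: e_def)
  have "\<bar>e j\<bar> = 1" for j using arg_cong[OF u[of j], of norm] n by simp
  then have "e j \<in> {-1, 1}" for j by (metis abs_eq_iff abs_one insert_iff)
  then have "(\<Sum>j\<in>UNIV. e j * r $ j) \<noteq> 0" using assms(1) by (simp add: generic_def)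
  moreover have "(\<Sum>j\<in>UNIV. e j * r $ j) *\<^sub>R u $ i = (\<Sum>j\<in>UNIV. r $ j *\<^sub>R u $ j)"
    unfolding scaleR_sum_left by (rule sum.cong[OF refl]) (subst u, simp add: mult.commute)
  ultimately show False using assms(2) polygon_side_nonzero[OF assms(2), of i] by (simp add: polygons_def)
qed

unbundle cross3_syntax

section \<open>A slice of the rotation action\<close>

text \<open>An orthonormal frame built by cross products only, so that it follows every rotation of the vectors
  \<open>a, b\<close>.\<close>

definition frame :: "real^3 \<Rightarrow> real^3 \<Rightarrow> 3 \<Rightarrow> real^3" where
  "frame a b m = (if m = 1 then sgn a else if m = 2 then sgn (a \<times> b) else sgn (a \<times> b) \<times> sgn a)"

lemma frame_rotate: "A \<in> SO3 \<Longrightarrow> frame (A *v a) (A *v b) m = A *v frame a b m"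
  by (simp add: frame_def SO3_sgn SO3_cross)

lemma frame_orthonormal:
  assumes "a \<times> b \<noteq> 0"
  shows "frame a b m \<bullet> frame a b k = (if m = k then 1 else 0)"
proof -
  have nz: "a \<noteq> 0" using assms by auto
  have n: "norm (sgn a) = 1" "norm (sgn (a \<times> b)) = 1" using assms nz by (auto simp: norm_sgn)
  have o: "sgn a \<bullet> sgn (a \<times> b) = 0" "sgn (a \<times> b) \<bullet> sgn a = 0"
    by (auto simp: sgn_div_norm dot_cross_self)
  have "(norm (sgn (a \<times> b) \<times> sgn a))\<^sup>2 = 1"
    using norm_cross_dot[of "sgn (a \<times> b)" "sgn a"] n o by simp
  then have n3: "(sgn (a \<times> b) \<times> sgn a) \<bullet> (sgn (a \<times> b) \<times> sgn a) = 1"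
    by (simp add: power2_norm_eq_inner)
  show ?thesis
    using n o n3 exhaust_3[of m] exhaust_3[of k]
    by (auto simp: frame_def dot_square_norm dot_cross_self)
qed

lemma frame_expansion:
  assumes "a \<times> b \<noteq> 0"
  shows "(\<Sum>m\<in>UNIV. (frame a b m \<bullet> x) *\<^sub>R frame a b m) = x"
proof -
  let ?f = "frame a b"
  note on = frame_orthonormal[OF assms]
  define y where "y = x - (?f 1 \<bullet> x) *\<^sub>R ?f 1 - (?f 2 \<bullet> x) *\<^sub>R ?f 2"
  have y: "?f 1 \<bullet> y = 0" "?f 2 \<bullet> y = 0" "?f 3 \<bullet> y = ?f 3 \<bullet> x"
    by (simp_all add: y_def inner_diff_right on)
  have f3: "?f 3 = ?f 2 \<times> ?f 1" by (simp add: frame_def)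
  have "y \<times> ?f 3 = 0"
    unfolding f3 Lagrange using y by (simp add: inner_commute)
  then have "?f 3 \<times> y = 0" using cross_skew[of "?f 3" y] by simp
  moreover have "norm (?f 3) = 1" using on[of 3 3] by (simp add: norm_eq_sqrt_inner)
  ultimately have "y = (?f 3 \<bullet> y) *\<^sub>R ?f 3" using cross_self_cross[of "?f 3" y] by simp
  then have "x = (?f 1 \<bullet> x) *\<^sub>R ?f 1 + (?f 2 \<bullet> x) *\<^sub>R ?f 2 + (?f 3 \<bullet> x) *\<^sub>R ?f 3"
    unfolding y(3) unfolding y_def by (simp add: algebra_simps)
  then show ?thesis by (simp add: sum_3)
qed

text \<open>The matrix that carries one frame to another is orthogonal. Its determinant is \<open>1\<close> because in both
  frames the third vector is the same cross product of the other two.\<close>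

lemma frame_change_SO3:
  assumes ab: "a \<times> b \<noteq> 0" and cd: "c \<times> d \<noteq> 0"
  obtains A where "A \<in> SO3" "\<And>x. A *v x = (\<Sum>m\<in>UNIV. (frame a b m \<bullet> x) *\<^sub>R frame c d m)"
proof -
  let ?e = "frame a b" and ?f = "frame c d"
  define g where "g x = (\<Sum>m\<in>UNIV. (?e m \<bullet> x) *\<^sub>R ?f m)" for x
  have lin: "linear g"
    unfolding g_def by (rule linearI) (auto simp: inner_add_right algebra_simps sum.distrib scaleR_sum_right)
  have "g x \<bullet> g y = x \<bullet> y" for x y
  proof -
    have "g x \<bullet> g y = (\<Sum>m\<in>UNIV. (?e m \<bullet> x) * (?e m \<bullet> y))"
      unfolding g_def sum_3 by (simp add: inner_add_left inner_add_right frame_orthonormal[OF cd])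
    also have "\<dots> = (\<Sum>m\<in>UNIV. (?e m \<bullet> x) *\<^sub>R ?e m) \<bullet> y"
      by (simp add: inner_sum_left)
    finally show ?thesis unfolding frame_expansion[OF ab] .
  qed
  then have o: "orthogonal_matrix (matrix g)"
    using lin orthogonal_transformation_matrix[of g] unfolding orthogonal_transformation_def by blast
  have g: "matrix g *v x = g x" for x by (simp add: matrix_works lin)
  have ge: "g (?e m) = ?f m" for m
    using exhaust_3[of m] unfolding g_def sum_3 by (auto simp: frame_orthonormal[OF ab])
  have "?f 2 \<times> ?f 1 = det (matrix g) *\<^sub>R g (?e 2 \<times> ?e 1)"
    using cross_orthogonal_matrix[OF o, of "?e 2" "?e 1"] by (simp add: g ge)
  moreover have "?f 2 \<times> ?f 1 = ?f 3" "?e 2 \<times> ?e 1 = ?e 3" by (simp_all add: frame_def)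
  ultimately have "?f 3 = det (matrix g) *\<^sub>R ?f 3" by (simp add: ge)
  then have "?f 3 \<bullet> ?f 3 = det (matrix g) * (?f 3 \<bullet> ?f 3)" by (metis inner_scaleR_left)
  then have "det (matrix g) = 1" by (simp add: frame_orthonormal[OF cd])
  then show ?thesis
    using that[of "matrix g"] o g by (simp add: SO3_def rotation_matrix_def g_def)
qed

text \<open>The rotated copy of \<open>u\<close> whose sides \<open>i, j\<close> have the frame of the sides \<open>i, j\<close> of \<open>p\<close>.\<close>

definition align :: "'n::finite \<Rightarrow> 'n \<Rightarrow> real^3^'n \<Rightarrow> real^3^'n \<Rightarrow> real^3^'n" where
  "align i j p u = (\<chi> k. \<Sum>m\<in>UNIV. (frame (u $ i) (u $ j) m \<bullet> u $ k) *\<^sub>R frame (p $ i) (p $ j) m)"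

lemma align_rotate: "A \<in> SO3 \<Longrightarrow> align i j p (rotate_polygon A u) = align i j p u"
  by (simp add: align_def frame_rotate SO3_inner)

lemma align_is_rotation:
  assumes "p $ i \<times> p $ j \<noteq> 0" "u $ i \<times> u $ j \<noteq> 0"
  obtains A where "A \<in> SO3" "align i j p u = rotate_polygon A u"
proof -
  obtain A where A: "A \<in> SO3"
    "\<And>x. A *v x = (\<Sum>m\<in>UNIV. (frame (u $ i) (u $ j) m \<bullet> x) *\<^sub>R frame (p $ i) (p $ j) m)"
    by (rule frame_change_SO3[OF assms(2,1)]) (rule that)
  then have "align i j p u = rotate_polygon A u" by (simp add: align_def rotate_polygon_def)
  then show ?thesis using that A(1) by blast
qed

lemma align_self: "p $ i \<times> p $ j \<noteq> 0 \<Longrightarrow> align i j p p = p"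
  by (simp add: align_def frame_expansion vec_eq_iff)

lemma smooth_at_align:
  assumes "u $ i \<times> u $ j \<noteq> 0"
  shows "smooth_at (align i j p) u"
proof -
  have "smooth_at (\<lambda>u. u $ k) u" for k :: 'a by (intro smooth_at_vec_nth smooth_at_ident)
  moreover have "u $ i \<noteq> 0" using assms by auto
  ultimately have "smooth_at (\<lambda>u. frame (u $ i) (u $ j) m) u" for m
    using assms exhaust_3[of m] unfolding frame_def
    by (cases "m = 1"; cases "m = 2") (auto intro!: smooth_at_sgn smooth_at_cross)
  then show ?thesis
    unfolding align_def
    by (intro smooth_at_vec_lambda smooth_at_sum smooth_at_scaleR smooth_at_inner smooth_at_const
        smooth_at_vec_nth smooth_at_ident)
qed

text \<open>An infinitesimal rotation that fixes two independent vectors is \<open>0\<close>.\<close>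

lemma dim_orbit_tangent:
  assumes "u $ i \<times> u $ j \<noteq> 0"
  shows "dim (orbit_tangent u) = 3"
proof -
  let ?L = "\<lambda>\<xi>. \<chi> i. cross3 \<xi> (u $ i)"
  have lin: "linear ?L"
    by (rule linearI) (auto simp: vec_eq_iff cross_add_left cross_mult_left)
  have "inj ?L"
    unfolding linear_injective_0[OF lin]
  proof (intro allI impI)
    fix \<xi> assume "?L \<xi> = 0"
    then have "\<xi> \<times> u $ i = 0" "\<xi> \<times> u $ j = 0" by (auto simp: vec_eq_iff)
    then have "(\<xi> \<bullet> (u $ i \<times> u $ j)) *\<^sub>R (u $ i \<times> u $ j) = 0 \<and> \<xi> \<times> (u $ i \<times> u $ j) = 0"
      using dot_cross_self
      by (metis (no_types, opaque_lifting) Jacobi add_0 add.right_neutral cross_skew cross_triple cross_zero_right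
          inner_commute inner_zero_left scaleR_zero_left neg_equal_0_iff_equal)
    then have "\<xi> \<bullet> (u $ i \<times> u $ j) = 0" "\<xi> \<times> (u $ i \<times> u $ j) = 0" using assms by auto
    then show "\<xi> = 0" using norm_and_cross_eq_0 assms by blast
  qed
  then have "dim (range ?L) = DIM(real^3)"
    using dim_image_eq[OF lin, of UNIV] by (simp add: inj_on_subset)
  then show ?thesis by (simp add: orbit_tangent_def)
qed

lemma open_cross_nonzero: "open {u :: real^3^'n::finite. u $ i \<times> u $ j \<noteq> 0}"
  by (rule open_Collect_neq[OF _ continuous_on_const]) (intro continuous_on_cross continuous_intros)

text \<open>If \<open>w\<close> is in the kernel of the derivative of \<open>align\<close>, then all inner products and triple products
  of sides are constant to first order along \<open>w\<close>, because \<open>align\<close> preserves them. The first ones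
  make the motion of the sides \<open>i, j\<close> an infinitesimal rotation, and the others make every side follow it.\<close>

lemma kernel_derivative_align:
  assumes p: "p $ i \<times> p $ j \<noteq> 0" and L: "(align i j p has_derivative L) (at p)" and w: "L w = 0"
  shows "w \<in> orbit_tangent p"
proof -
  let ?Q = "{u :: real^3^'a. u $ i \<times> u $ j \<noteq> 0}"
  have op: "open ?Q"
    by (rule open_cross_nonzero)
  have Lk: "((\<lambda>u. align i j p u $ k) has_derivative (\<lambda>v. L v $ k)) (at p)" for k
    by (rule bounded_linear.has_derivative[OF bounded_linear_vec_nth L])
  have idk: "((\<lambda>u. u $ k) has_derivative (\<lambda>v. v $ k)) (at p)" for k :: 'a
    by (intro bounded_linear_imp_has_derivative bounded_linear_vec_nth)
  have inv: "(align i j p u $ k) \<bullet> (align i j p u $ l) = u $ k \<bullet> u $ l"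
    "(align i j p u $ k) \<bullet> ((align i j p u $ i) \<times> (align i j p u $ j)) = u $ k \<bullet> (u $ i \<times> u $ j)"
    if u: "u \<in> ?Q" for u k l
  proof -
    obtain A where A: "A \<in> SO3" "align i j p u = rotate_polygon A u"
      using align_is_rotation[OF p, of u] u by auto
    show "(align i j p u $ k) \<bullet> (align i j p u $ l) = u $ k \<bullet> u $ l"
      "(align i j p u $ k) \<bullet> ((align i j p u $ i) \<times> (align i j p u $ j)) = u $ k \<bullet> (u $ i \<times> u $ j)"
      unfolding A(2) rotate_nth SO3_cross[OF A(1)] by (simp_all add: SO3_inner[OF A(1)])
  qed
  have pQ: "p \<in> ?Q" using p by simp
  have gram: "p $ k \<bullet> w $ l + w $ k \<bullet> p $ l = 0" for k l
  proof -
    have 1: "((\<lambda>u. u $ k \<bullet> u $ l) has_derivative (\<lambda>v. (align i j p p $ k) \<bullet> (L v $ l) + (L v $ k) \<bullet> (align i j p p $ l))) (at p)"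
      by (rule has_derivative_transform_within_open[OF has_derivative_inner[OF Lk Lk] op pQ inv(1)])
    have 2: "((\<lambda>u. u $ k \<bullet> u $ l) has_derivative (\<lambda>v. p $ k \<bullet> v $ l + v $ k \<bullet> p $ l)) (at p)"
      by (rule has_derivative_inner[OF idk idk])
    show ?thesis using fun_cong[OF has_derivative_unique[OF 1 2], of w] w by simp
  qed
  have bc: "bounded_bilinear (cross3)"
    using bilinear_cross bilinear_conv_bounded_bilinear by blast
  have triple: "p $ k \<bullet> (p $ i \<times> w $ j + w $ i \<times> p $ j) + w $ k \<bullet> (p $ i \<times> p $ j) = 0" for k
  proof -
    have 1: "((\<lambda>u. u $ k \<bullet> (u $ i \<times> u $ j)) has_derivative
        (\<lambda>v. (align i j p p $ k) \<bullet> ((align i j p p $ i) \<times> (L v $ j) + (L v $ i) \<times> (align i j p p $ j)) +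
             (L v $ k) \<bullet> ((align i j p p $ i) \<times> (align i j p p $ j)))) (at p)"
      by (rule has_derivative_transform_within_open[OF
            has_derivative_inner[OF Lk bounded_bilinear.FDERIV[OF bc Lk Lk]] op pQ inv(2)])
    have 2: "((\<lambda>u. u $ k \<bullet> (u $ i \<times> u $ j)) has_derivative
        (\<lambda>v. p $ k \<bullet> (p $ i \<times> v $ j + v $ i \<times> p $ j) + v $ k \<bullet> (p $ i \<times> p $ j))) (at p)"
      by (rule has_derivative_inner[OF idk bounded_bilinear.FDERIV[OF bc idk idk]])
    show ?thesis using fun_cong[OF has_derivative_unique[OF 1 2], of w] w by simp
  qed
  let ?a = "p $ i" and ?b = "p $ j"
  have "?a \<bullet> w $ i = 0" "?b \<bullet> w $ j = 0" using gram[of i i] gram[of j j] by (simp_all add: inner_commute)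
  moreover have "(?a + ?b) \<bullet> (w $ i + w $ j) = 0"
    using gram[of i j] gram[of i i] gram[of j j] by (simp add: inner_add_left inner_add_right inner_commute)
  ultimately obtain \<xi> where \<xi>: "w $ i = \<xi> \<times> ?a" "w $ j = \<xi> \<times> ?b"
    by (rule rigid_motion_of_triangle[OF p])
  have "w $ k = \<xi> \<times> p $ k" for k
  proof -
    define z where "z = w $ k - \<xi> \<times> p $ k"
    have sk: "x \<bullet> (\<xi> \<times> y) + (\<xi> \<times> x) \<bullet> y = 0" for x y :: "real^3"
      by (simp add: cross3_simps)
    have za: "z \<bullet> ?a = 0" "z \<bullet> ?b = 0"
      using gram[of k i] gram[of k j] sk[of "p $ k" ?a] sk[of "p $ k" ?b] \<xi>
      by (simp_all add: z_def inner_diff_left)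
    have jac: "?a \<times> (\<xi> \<times> ?b) + (\<xi> \<times> ?a) \<times> ?b = \<xi> \<times> (?a \<times> ?b)"
      using Jacobi[of \<xi> ?a ?b] cross_skew[of ?b \<xi>] cross_skew[of ?b "\<xi> \<times> ?a"] by (simp add: algebra_simps)
    have zn: "z \<bullet> (?a \<times> ?b) = 0"
      using triple[of k] sk[of "p $ k" "?a \<times> ?b"] unfolding \<xi> jac z_def by (simp add: inner_diff_left)
    have "z \<times> (?a \<times> ?b) = 0" by (simp add: Lagrange za)
    then have "z = 0" using zn p norm_and_cross_eq_0 by blast
    then show ?thesis by (simp add: z_def)
  qed
  then show ?thesis by (auto simp: orbit_tangent_def vec_eq_iff)
qed

lemma rank_nullity_on:
  fixes L :: "'a::euclidean_space \<Rightarrow> 'b::euclidean_space"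
  assumes L: "linear L" and T: "subspace T"
  shows "dim (L ` T) + dim {x \<in> T. L x = 0} = dim T"
proof -
  let ?K = "{x \<in> T. L x = 0}"
  let ?C = "{x \<in> T. \<forall>k\<in>?K. orthogonal k x}"
  have K: "subspace ?K"
    using T by (auto simp: subspace_def linear_0[OF L] linear_add[OF L] linear_scale[OF L])
  have C: "subspace ?C"
    using T by (auto simp: subspace_def orthogonal_def inner_add_right)
  have dC: "dim ?C + dim ?K = dim T"
    by (rule dim_subspace_orthogonal_to_vectors[OF K T]) blast
  have sC: "span ?C = ?C" using C by (rule span_eq_iff[THEN iffD2])
  have "inj_on L ?C"
    unfolding linear_inj_on_iff_eq_0[OF L C]
  proof (intro ballI impI)
    fix x assume x: "x \<in> ?C" "L x = 0"
    then have "orthogonal x x" by simp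
    then show "x = 0" by (simp add: orthogonal_def)
  qed
  then have "dim (L ` ?C) = dim ?C"
    by (intro dim_image_eq[OF L]) (simp only: sC)
  moreover have "L ` ?C = L ` T"
  proof
    show "L ` T \<subseteq> L ` ?C"
    proof
      fix y assume "y \<in> L ` T"
      then obtain x where x: "x \<in> T" "y = L x" by blast
      obtain k c where kc: "k \<in> span ?K" "\<And>z. z \<in> span ?K \<Longrightarrow> orthogonal c z" "x = k + c"
        by (rule orthogonal_subspace_decomp_exists[of ?K x]) blast
      have sK: "span ?K = ?K" using K by (rule span_eq_iff[THEN iffD2])
      have k: "k \<in> T" "L k = 0" using kc(1) unfolding sK by auto
      have "c = x - k" using kc(3) by simp
      then have "c \<in> T" "L c = y" using x k T by (auto simp: subspace_diff linear_diff[OF L])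
      moreover have "\<forall>z\<in>?K. orthogonal z c" using kc(2) unfolding sK by (simp add: orthogonal_commute)
      ultimately show "y \<in> L ` ?C" by blast
    qed
  qed auto
  ultimately show ?thesis using dC by simp
qed

text \<open>Near a nondegenerate polygon, the aligned polygons form a transversal to the rotation orbits in any
  rotation invariant manifold. The retraction onto it is \<open>\<rho>\<close> followed by \<open>align\<close>: this is idempotent
  because rotations, and so \<open>align\<close>, preserve \<open>M\<close>. The dimension drops by \<open>3\<close>, because the kernel of
  the derivative of \<open>align\<close> is the tangent space of the orbit.\<close>

lemma aligned_retract:
  assumes ret: "smooth_retract_at \<rho> M p"
    and inv: "\<And>A u. A \<in> SO3 \<Longrightarrow> u \<in> M \<Longrightarrow> rotate_polygon A u \<in> M"
    and p: "p $ i \<times> p $ j \<noteq> 0"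
  defines "S \<equiv> {u \<in> M. u $ i \<times> u $ j \<noteq> 0 \<and> align i j p u = u}"
  shows "smooth_retract_at (\<lambda>u. align i j p (\<rho> u)) S p"
    and "((\<lambda>u. align i j p (\<rho> u)) has_derivative
      (\<lambda>v. frechet_derivative (align i j p) (at p) (frechet_derivative \<rho> (at p) v))) (at p)"
    and "dim (range (\<lambda>v. frechet_derivative (align i j p) (at p) (frechet_derivative \<rho> (at p) v))) =
      dim (range (frechet_derivative \<rho> (at p))) - 3"
proof -
  let ?\<sigma> = "align i j p"
  let ?L = "frechet_derivative ?\<sigma> (at p)" and ?A = "frechet_derivative \<rho> (at p)"
  have \<rho>: "p \<in> M" "smooth_at \<rho> p" "eventually (\<lambda>u. \<rho> u \<in> M) (nhds p)"
    "eventually (\<lambda>u. u \<in> M \<longrightarrow> \<rho> u = u) (nhds p)" "\<rho> p = p"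
    using ret smooth_retract_at_fixed[OF ret] by (auto simp: smooth_retract_at_def)
  have s\<sigma>: "smooth_at ?\<sigma> p" by (rule smooth_at_align[OF p])
  have dL: "(?\<sigma> has_derivative ?L) (at p)" by (rule smooth_at_has_derivative[OF s\<sigma>])
  have dA: "(\<rho> has_derivative ?A) (at p)" by (rule smooth_at_has_derivative[OF \<rho>(2)])
  have rot: "?\<sigma> u \<in> S" if u: "u \<in> M" "u $ i \<times> u $ j \<noteq> 0" for u
  proof -
    obtain A where A: "A \<in> SO3" "?\<sigma> u = rotate_polygon A u" using align_is_rotation[OF p u(2)] .
    have "A *v (u $ i \<times> u $ j) \<noteq> 0" using u(2) SO3_norm[OF A(1)] by (metis norm_eq_zero)
    then have "(rotate_polygon A u) $ i \<times> (rotate_polygon A u) $ j \<noteq> 0" by (simp add: SO3_cross[OF A(1)])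
    moreover have "?\<sigma> (rotate_polygon A u) = rotate_polygon A u"
      using align_rotate[OF A(1), of i j p u] A(2) by simp
    ultimately show ?thesis using inv[OF A(1) u(1)] by (simp add: S_def A(2))
  qed
  show "smooth_retract_at (\<lambda>u. ?\<sigma> (\<rho> u)) S p"
    unfolding smooth_retract_at_def
  proof (intro conjI)
    show "p \<in> S" using \<rho>(1) p by (simp add: S_def align_self)
    show "smooth_at (\<lambda>u. ?\<sigma> (\<rho> u)) p"
      by (rule smooth_at_compose[OF \<rho>(2)]) (simp add: \<rho>(5) s\<sigma>)
    have "filterlim (\<lambda>u. (\<rho> u $ i) \<times> (\<rho> u $ j)) (nhds ((\<rho> p $ i) \<times> (\<rho> p $ j))) (nhds p)"
      by (intro tendsto_nhds_nhds smooth_at_cross smooth_at_vec_nth \<rho>(2))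
    then have "eventually (\<lambda>u. (\<rho> u $ i) \<times> (\<rho> u $ j) \<noteq> 0) (nhds p)"
      by (rule tendsto_imp_eventually_ne) (simp add: \<rho>(5) p)
    then show "eventually (\<lambda>u. ?\<sigma> (\<rho> u) \<in> S) (nhds p)"
      using \<rho>(3) by eventually_elim (rule rot)
    show "eventually (\<lambda>u. u \<in> S \<longrightarrow> ?\<sigma> (\<rho> u) = u) (nhds p)"
      using \<rho>(4) by eventually_elim (simp add: S_def)
  qed
  show "((\<lambda>u. ?\<sigma> (\<rho> u)) has_derivative (\<lambda>v. ?L (?A v))) (at p)"
    using has_derivative_compose[OF dA, of ?\<sigma> ?L] dL \<rho>(5) by simp
  have linA: "linear ?A" using dA has_derivative_linear by blast
  have linL: "linear ?L" using dL has_derivative_linear by blast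
  \<comment> \<open>the orbit of \<open>p\<close> is in \<open>M\<close>, where \<open>\<rho>\<close> is the identity, and \<open>align\<close> is constant on it\<close>
  have orb: "(\<chi> k. n \<times> (p $ k)) \<in> range ?A \<and> ?L (\<chi> k. n \<times> (p $ k)) = 0" if n: "norm n = 1" for n
  proof -
    define \<gamma> where "\<gamma> t = rotate_polygon (matrix (rotation t n)) p" for t
    define w where "w = (\<chi> k. n \<times> (p $ k))"
    have \<gamma>: "\<gamma> t = (\<chi> k. rotation t n (p $ k))" for t
      by (simp add: \<gamma>_def rotate_polygon_def rotation_matrix_mult)
    have \<gamma>0: "\<gamma> 0 = p" by (simp add: \<gamma>)
    have "\<gamma> = (\<lambda>t. cos t *\<^sub>R p + sin t *\<^sub>R w + (1 - cos t) *\<^sub>R (\<chi> k. (n \<bullet> p $ k) *\<^sub>R n))"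
      by (simp add: \<gamma> w_def rotation_def fun_eq_iff vec_eq_iff)
    then have d: "(\<gamma> has_vector_derivative w) (at 0)"
      by (auto intro!: derivative_eq_intros)
    have M: "\<gamma> t \<in> M" for t unfolding \<gamma>_def by (rule inv[OF rotation_SO3[OF n] \<rho>(1)])
    have "filterlim \<gamma> (nhds (\<gamma> 0)) (nhds 0)"
      using has_vector_derivative_continuous[OF d] unfolding continuous_within tendsto_at_iff_tendsto_nhds .
    then have lim: "filterlim \<gamma> (nhds p) (nhds 0)" unfolding \<gamma>0 .
    have "eventually (\<lambda>t. \<gamma> t \<in> M \<longrightarrow> \<rho> (\<gamma> t) = \<gamma> t) (nhds 0)"
      using filterlim_iff[THEN iffD1, OF lim, rule_format, OF \<rho>(4)] .
    then have ev: "eventually (\<lambda>t. \<rho> (\<gamma> t) = \<gamma> t) (nhds 0)"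
      by (rule eventually_mono) (simp add: M)
    have "((\<lambda>t. \<rho> (\<gamma> t)) has_vector_derivative ?A w) (at 0)"
      using d dA \<gamma>0 linA unfolding has_vector_derivative_def
      using has_derivative_compose[of \<gamma> "\<lambda>t. t *\<^sub>R w" 0 UNIV \<rho> ?A] by (simp add: linear_scale)
    then have "?A w = w" using has_vector_derivative_unique_eventually[OF _ d ev] by blast
    moreover have "((\<lambda>t. ?\<sigma> (\<gamma> t)) has_vector_derivative ?L w) (at 0)"
      using d dL \<gamma>0 linL unfolding has_vector_derivative_def
      using has_derivative_compose[of \<gamma> "\<lambda>t. t *\<^sub>R w" 0 UNIV ?\<sigma> ?L] by (simp add: linear_scale)
    then have "?L w = 0"
      unfolding \<gamma>_def align_rotate[OF rotation_SO3[OF n]]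
      by (rule vector_derivative_unique_at[OF _ has_vector_derivative_const])
    ultimately show ?thesis unfolding w_def by (metis rangeI)
  qed
  have "{x \<in> range ?A. ?L x = 0} = orbit_tangent p"
  proof
    show "{x \<in> range ?A. ?L x = 0} \<subseteq> orbit_tangent p"
      using kernel_derivative_align[OF p dL] by blast
    show "orbit_tangent p \<subseteq> {x \<in> range ?A. ?L x = 0}"
    proof
      fix x assume "x \<in> orbit_tangent p"
      then obtain \<xi> where \<xi>: "x = (\<chi> k. \<xi> \<times> (p $ k))" by (auto simp: orbit_tangent_def)
      show "x \<in> {x \<in> range ?A. ?L x = 0}"
      proof (cases "\<xi> = 0")
        case True
        have "x = 0" by (simp add: \<xi> True) (simp add: zero_vec_def)
        then show ?thesis using linear_0[OF linA] linear_0[OF linL] by (metis (mono_tags) mem_Collect_eq rangeI)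
      next
        case False
        let ?w = "\<chi> k. sgn \<xi> \<times> (p $ k)"
        have x: "x = norm \<xi> *\<^sub>R ?w"
          using False by (simp add: \<xi> vec_eq_iff sgn_div_norm cross_mult_left)
        have "?w \<in> range ?A \<and> ?L ?w = 0" by (rule orb) (simp add: norm_sgn False)
        then show ?thesis
          unfolding x using linear_scale[OF linA] linear_scale[OF linL]
          by (auto simp: image_iff) (metis)
      qed
    qed
  qed
  then have "dim (?L ` range ?A) + 3 = dim (range ?A)"
    using rank_nullity_on[OF linL linear_subspace_image[OF linA subspace_UNIV]] dim_orbit_tangent[OF p] by simp
  then show "dim (range (\<lambda>v. ?L (?A v))) = dim (range ?A) - 3"
    by (simp add: image_image)
qed

text \<open>Near the class of \<open>p\<close>, every class meets the slice of aligned polygons in exactly one point, namely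
  \<open>align i j p u\<close> for any representative \<open>u\<close>. So a chart \<open>D\<close> of the slice with inverse \<open>g\<close> gives
  the chart \<open>D \<circ> align i j p\<close> of the quotient, and \<open>g\<close> is the smooth lift of the inverse of that
  chart.\<close>

lemma moduli_submanifold_of_retract:
  assumes N: "N \<subseteq> moduli_nd r"
    and M: "lift N = {u \<in> M. \<not> degenerate u}" "M \<subseteq> polygons r"
    and inv: "\<And>A u. A \<in> SO3 \<Longrightarrow> u \<in> M \<Longrightarrow> rotate_polygon A u \<in> M"
    and ret: "\<And>u. u \<in> M \<Longrightarrow> smooth_retract_at \<rho> M u"
    and rank: "\<And>u. u \<in> M \<Longrightarrow> dim (range (frechet_derivative \<rho> (at u))) = m"
  shows "moduli_submanifold r (m - 3) N"
  unfolding moduli_submanifold_def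
proof (intro conjI N ballI)
  show "Hausdorff_space (subtopology (moduli_top r) N)"
    by (rule Hausdorff_space_subtopology[OF Hausdorff_moduli])
  show "second_countable (subtopology (moduli_top r) N)"
    by (rule second_countable_subtopology[OF second_countable_moduli])
  fix c assume c: "c \<in> N"
  have Nm: "N \<subseteq> moduli r" using N by (auto simp: moduli_nd_def moduli_def)
  obtain p where p: "p \<in> polygons r" "c = polygon_class p" using c Nm by (auto simp: moduli_def)
  have pM: "p \<in> M" "\<not> degenerate p" using c p(2) M(1) by (auto simp: lift_def)
  define i :: 'a where "i = undefined"
  obtain j where ij: "p $ i \<times> p $ j \<noteq> 0"
    using degenerate_iff[OF polygon_side_nonzero[OF p(1), of i]] pM(2) by blast
  let ?\<sigma> = "align i j p"
  define S where "S = {u \<in> M. u $ i \<times> u $ j \<noteq> 0 \<and> ?\<sigma> u = u}"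
  define D where "D v = frechet_derivative ?\<sigma> (at p) (frechet_derivative \<rho> (at p) v)" for v
  note R = aligned_retract[OF ret[OF pM(1)] inv ij, folded S_def D_def]
  obtain U1 V g where ch: "openin (top_of_set S) U1" "p \<in> U1" "openin (top_of_set (range D)) V"
    "homeomorphism U1 V D g" "smooth_map V g"
    using smooth_retract_chart[OF R(1)] R(2) by (metis (no_types, lifting) D_def[abs_def])
  have U1S: "U1 \<subseteq> S" using ch(1) openin_imp_subset by blast
  have bD: "bounded_linear D" using R(2) D_def[abs_def] has_derivative_bounded_linear by metis
  define U where "U = polygon_class ` U1"
  define \<phi> where "\<phi> q = D (?\<sigma> (SOME u. u \<in> q))" for q
  define \<psi> where "\<psi> y = polygon_class (g y)" for y
  have \<phi>: "\<phi> (polygon_class u) = D (?\<sigma> u)" for u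
  proof -
    have "(SOME w. w \<in> polygon_class u) \<in> polygon_class u"
      using polygon_class_self by (rule someI)
    then show ?thesis unfolding \<phi>_def by (auto simp: mem_polygon_class align_rotate)
  qed
  have indep_nd: "\<not> degenerate u" if "u \<in> M" "u $ i \<times> u $ j \<noteq> 0" for u
    using degenerate_iff[OF polygon_side_nonzero, of u r i] that M(2) by blast
  have U1N: "polygon_class u \<in> N" "u \<in> polygons r" "u \<in> M" "?\<sigma> u = u" "u $ i \<times> u $ j \<noteq> 0" if "u \<in> U1" for u
    using that U1S indep_nd M by (auto simp: S_def lift_def)
  have UN: "U \<subseteq> N" using U1N(1) by (auto simp: U_def)
  have lU: "u \<in> lift U \<longleftrightarrow> u \<in> lift N \<and> u $ i \<times> u $ j \<noteq> 0 \<and> ?\<sigma> u \<in> U1" for u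
  proof
    assume "u \<in> lift U"
    then obtain w where w: "w \<in> U1" "polygon_class w = polygon_class u" by (auto simp: lift_def U_def)
    then obtain A where A: "A \<in> SO3" "u = rotate_polygon A w" by (auto simp: polygon_class_eq)
    have "?\<sigma> u \<in> U1" using align_rotate[OF A(1), of i j p w] U1N(4)[OF w(1)] w(1) A(2) by simp
    moreover have "u $ i \<times> u $ j \<noteq> 0"
      using U1N(5)[OF w(1)] SO3_norm[OF A(1)] unfolding A(2) rotate_nth SO3_cross[OF A(1)]
      by (metis norm_eq_zero)
    moreover have "u \<in> lift N" using U1N(1)[OF w(1)] w(2) by (simp add: lift_def)
    ultimately show "u \<in> lift N \<and> u $ i \<times> u $ j \<noteq> 0 \<and> ?\<sigma> u \<in> U1" by blast
  next
    assume u: "u \<in> lift N \<and> u $ i \<times> u $ j \<noteq> 0 \<and> ?\<sigma> u \<in> U1"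
    then obtain A where A: "A \<in> SO3" "?\<sigma> u = rotate_polygon A u"
      using align_is_rotation[OF ij] by metis
    then have "polygon_class (?\<sigma> u) = polygon_class u" by (simp add: polygon_class_rotate)
    then show "u \<in> lift U" using u unfolding lift_def U_def by (metis imageI mem_Collect_eq)
  qed
  have smooth: "smooth_on ?\<sigma> {u. u $ i \<times> u $ j \<noteq> 0}"
    by (rule smooth_at_imp_on[OF open_cross_nonzero]) (simp add: smooth_at_align)
  have op: "openin (subtopology (moduli_top r) N) U"
  proof -
    obtain O1 where O1: "open O1" "U1 = S \<inter> O1" using ch(1) by (auto simp: openin_open)
    have inS: "?\<sigma> u \<in> S" if u: "u \<in> lift N" "u $ i \<times> u $ j \<noteq> 0" for u
    proof -
      obtain A where A: "A \<in> SO3" "?\<sigma> u = rotate_polygon A u" using align_is_rotation[OF ij u(2)] .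
      have "A *v (u $ i \<times> u $ j) \<noteq> 0" using u(2) SO3_norm[OF A(1)] by (metis norm_eq_zero)
      then have "?\<sigma> u $ i \<times> ?\<sigma> u $ j \<noteq> 0" by (simp add: A(2) SO3_cross[OF A(1)])
      moreover have "?\<sigma> (?\<sigma> u) = ?\<sigma> u" using align_rotate[OF A(1), of i j p u] A(2) by simp
      moreover have "?\<sigma> u \<in> M" using inv[OF A(1)] u(1) M(1) A(2) by simp
      ultimately show ?thesis by (simp add: S_def)
    qed
    have key: "?\<sigma> u \<in> U1 \<longleftrightarrow> ?\<sigma> u \<in> O1" if "u \<in> lift N" "u $ i \<times> u $ j \<noteq> 0" for u
      unfolding O1(2) using inS[OF that] by simp
    have "{u \<in> topspace (top_of_set (lift N)). polygon_class u \<in> U} = lift N \<inter> lift U"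
      by (auto simp: lift_def)
    also have "\<dots> = lift N \<inter> ({u. u $ i \<times> u $ j \<noteq> 0} \<inter> ?\<sigma> -` O1)"
    proof (rule set_eqI)
      fix u
      show "u \<in> lift N \<inter> lift U \<longleftrightarrow> u \<in> lift N \<inter> ({u. u $ i \<times> u $ j \<noteq> 0} \<inter> ?\<sigma> -` O1)"
        unfolding Int_iff lU vimage_eq mem_Collect_eq by (simp only: key simp_thms cong: conj_cong)
    qed
    finally have eq: "{u \<in> topspace (top_of_set (lift N)). polygon_class u \<in> U} =
      lift N \<inter> ({u. u $ i \<times> u $ j \<noteq> 0} \<inter> ?\<sigma> -` O1)" .
    have "openin (top_of_set (lift N)) {u \<in> topspace (top_of_set (lift N)). polygon_class u \<in> U}"
      unfolding eq
    proof (rule openin_open_Int)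
      have "continuous_on {u. u $ i \<times> u $ j \<noteq> 0} ?\<sigma>"
        by (rule smooth_on_imp_continuous_on[OF smooth])
      then show "open ({u. u $ i \<times> u $ j \<noteq> 0} \<inter> ?\<sigma> -` O1)"
        by (rule continuous_open_preimage[OF _ open_cross_nonzero O1(1)])
    qed
    moreover have "U \<subseteq> topspace (subtopology (moduli_top r) N)"
      using UN Nm by (simp add: topspace_moduli Int_absorb1)
    ultimately show ?thesis
      using quotient_map_lift[OF Nm] unfolding quotient_map_def by blast
  qed
  have Vg: "g y \<in> U1" "D (g y) = y" if "y \<in> V" for y
    using ch(4) that by (auto simp: homeomorphism_def)
  have gD: "D u \<in> V" "g (D u) = u" if "u \<in> U1" for u
    using ch(4) that by (auto simp: homeomorphism_def)
  have Um: "U \<subseteq> moduli r" using UN Nm by blast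
  have cont\<sigma>: "continuous_on (lift U) (\<lambda>u. D (?\<sigma> u))"
  proof -
    have "continuous_on {u. u $ i \<times> u $ j \<noteq> 0} ?\<sigma>"
      by (rule smooth_on_imp_continuous_on[OF smooth])
    then have "continuous_on (lift U) ?\<sigma>" by (rule continuous_on_subset) (auto simp: lU)
    then show ?thesis by (rule bounded_linear.continuous_on[OF bD])
  qed
  have hom: "homeomorphic_maps (subtopology (moduli_top r) U) (top_of_set V) \<phi> \<psi>"
    unfolding homeomorphic_maps_def
  proof (intro conjI ballI)
    have "continuous_map (top_of_set (lift U)) (top_of_set V) (\<phi> \<circ> polygon_class)"
      using cont\<sigma> gD(1) lU by (auto simp: \<phi> o_def)
    then show "continuous_map (subtopology (moduli_top r) U) (top_of_set V) \<phi>"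
      by (rule continuous_compose_quotient_map[OF quotient_map_lift[OF Um]])
    have "continuous_map (top_of_set V) (top_of_set (polygons r)) g"
      using ch(4) Vg(1) U1N(2) by (auto simp: homeomorphism_def)
    from continuous_map_compose[OF this continuous_map_polygon_class]
    have "continuous_map (top_of_set V) (moduli_top r) \<psi>" by (simp add: \<psi>_def[abs_def] o_def)
    then show "continuous_map (top_of_set V) (subtopology (moduli_top r) U) \<psi>"
      by (rule continuous_map_into_subtopology) (use Vg(1) in \<open>auto simp: \<psi>_def U_def\<close>)
    fix q assume "q \<in> topspace (subtopology (moduli_top r) U)"
    then obtain u where u: "u \<in> U1" "q = polygon_class u" by (auto simp: U_def)
    then show "\<psi> (\<phi> q) = q" by (simp add: \<phi> \<psi>_def U1N(4) gD(2))
  next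
    fix y assume "y \<in> topspace (top_of_set V)"
    then have y: "y \<in> V" by simp
    then show "\<phi> (\<psi> y) = y" by (simp add: \<phi> \<psi>_def U1N(4)[OF Vg(1)[OF y]] Vg(2))
  qed
  have sm: "smooth_map (lift U) (\<phi> \<circ> polygon_class)"
    unfolding smooth_map_def
  proof
    fix u assume u: "u \<in> lift U"
    have "smooth_on (\<lambda>u. D (?\<sigma> u)) {u. u $ i \<times> u $ j \<noteq> 0}"
      using smooth by (auto simp: smooth_on_iff intro: smooth_at_compose_linear[OF bD])
    then show "\<exists>W h. u \<in> W \<and> smooth_on h W \<and> (\<forall>y\<in>W \<inter> lift U. h y = (\<phi> \<circ> polygon_class) y)"
      using u lU \<phi> by (intro exI[of _ "{u. u $ i \<times> u $ j \<noteq> 0}"] exI[of _ "\<lambda>u. D (?\<sigma> u)"]) auto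
  qed
  have sub: "subspace (range D)"
    by (rule linear_subspace_image[OF bounded_linear.linear[OF bD] subspace_UNIV])
  have dm: "dim (range D) = m - 3"
    using R(3) rank[OF pM(1)] by (simp add: D_def[abs_def])
  have cU: "c \<in> U" using ch(2) p(2) by (simp add: U_def)
  have sec: "\<forall>y\<in>V. \<exists>V' s. openin (top_of_set V) V' \<and> y \<in> V' \<and> smooth_map V' s \<and>
      (\<forall>z\<in>V'. s z \<in> polygons r \<and> polygon_class (s z) = \<psi> z)"
  proof
    fix y assume "y \<in> V"
    then show "\<exists>V' s. openin (top_of_set V) V' \<and> y \<in> V' \<and> smooth_map V' s \<and>
        (\<forall>z\<in>V'. s z \<in> polygons r \<and> polygon_class (s z) = \<psi> z)"
      using ch(5) Vg(1) U1N(2) by (intro exI[of _ V] exI[of _ g]) (auto simp: \<psi>_def)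
  qed
  show "\<exists>U E V \<phi> \<psi>. openin (subtopology (moduli_top r) N) U \<and> c \<in> U \<and>
        subspace E \<and> dim (E :: (real^3^'a) set) = m - 3 \<and> openin (top_of_set E) V \<and>
        homeomorphic_maps (subtopology (moduli_top r) U) (top_of_set V) \<phi> \<psi> \<and>
        smooth_map (lift U) (\<phi> \<circ> polygon_class) \<and>
        (\<forall>y\<in>V. \<exists>V' s. openin (top_of_set V) V' \<and> y \<in> V' \<and> smooth_map V' s \<and>
           (\<forall>z\<in>V'. s z \<in> polygons r \<and> polygon_class (s z) = \<psi> z))"
    using op cU sub dm ch(3) hom sm sec by blast
qed

unbundle no cross3_syntax

section \<open>Fibres of the bending flows\<close>

lemma edge_rotate: "edge r t (rotate_polygon A u) = A *v edge r t u"
  unfolding rotate_polygon_def by (rule edge_map[OF matrix_vector_mul_linear])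

lemma isometry_class_rotate:
  assumes "A \<in> SO3" "u \<in> isometry_class r t p"
  shows "rotate_polygon A u \<in> isometry_class r t p"
proof -
  have "isometric r t p (rotate_polygon A u)"
    unfolding rotate_polygon_def
    by (rule isometric_map[OF matrix_vector_mul_linear SO3_norm[OF assms(1)]])
       (use assms(2) in \<open>simp add: isometry_class_def\<close>)
  then show ?thesis using assms(2) by (simp add: isometry_class_def edge_rotate)
qed

lemma bending_lift_rotate:
  assumes "A \<in> SO3"
  shows "bending_lift r e (rotate_polygon A u) = bending_lift r e u"
proof -
  have "diagonal_vector r e (rotate_polygon A u) = A *v diagonal_vector r e u"
    by (simp add: diagonal_vector_def linear_sum[OF matrix_vector_mul_linear] matrix_vector_mult_scaleR
        split: prod.splits)
  then show ?thesis by (simp add: bending_lift_def SO3_norm[OF assms])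
qed

lemma bending_polygon_class: "bending r e (polygon_class u) = bending_lift r e u"
proof -
  have "bending_lift r e ` polygon_class u = (\<lambda>_. bending_lift r e u) ` polygon_class u"
    by (rule image_cong) (auto simp: mem_polygon_class bending_lift_rotate)
  then show ?thesis by (simp add: bending_def image_constant[OF polygon_class_self])
qed

lemma lift_bending_fiber:
  fixes d :: "nat \<Rightarrow> 'n::{finite,linorder} \<times> 'n"
  shows "lift (bending_fiber r d c) =
    {u \<in> polygons r. \<forall>k\<in>{1..CARD('n) - 3}. bending_lift r (d k) u = c k}"
  by (auto simp: lift_def bending_fiber_def bending_polygon_class polygon_class_in_moduli)

lemma smooth_manifold_of_retract:
  fixes M :: "'a::euclidean_space set"
  assumes ret: "\<And>u. u \<in> M \<Longrightarrow> smooth_retract_at \<rho> M u"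
    and rank: "\<And>u. u \<in> M \<Longrightarrow> dim (range (frechet_derivative \<rho> (at u))) = m"
  shows "smooth_manifold m M"
  unfolding smooth_manifold_def
proof
  fix u assume u: "u \<in> M"
  let ?A = "frechet_derivative \<rho> (at u)"
  have sm: "smooth_at \<rho> u" using ret[OF u] by (simp add: smooth_retract_at_def)
  have dA: "(\<rho> has_derivative ?A) (at u)" by (rule smooth_at_has_derivative[OF sm])
  have bA: "bounded_linear ?A" by (rule has_derivative_bounded_linear[OF dA])
  obtain U V g where ch: "openin (top_of_set M) U" "u \<in> U" "openin (top_of_set (range ?A)) V"
    "homeomorphism U V ?A g" "smooth_map V g"
    by (rule smooth_retract_chart[OF ret[OF u] dA]) (rule that)
  have sub: "subspace (range ?A)"
    by (rule linear_subspace_image[OF bounded_linear.linear[OF bA] subspace_UNIV])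
  have smA: "smooth_map U ?A"
    unfolding smooth_map_def
    by (intro ballI exI[of _ UNIV] exI[of _ ?A]) (simp add: smooth_at_imp_on smooth_at_linear[OF bA])
  show "\<exists>U E V f g. openin (top_of_set M) U \<and> u \<in> U \<and>
        subspace E \<and> dim (E :: 'a set) = m \<and> openin (top_of_set E) V \<and>
        homeomorphism U V f g \<and> smooth_map U f \<and> smooth_map V g"
    by (rule exI[of _ U], rule exI[of _ "range ?A"], rule exI[of _ V], rule exI[of _ ?A], rule exI[of _ g])
       (intro conjI ch sub smA rank[OF u])
qed

lemma tangent_isometry_class:
  assumes v: "v \<in> tangent_space M u" and M: "M \<subseteq> isometry_class r t p"
  shows "flexes_tree r t u v"
proof -
  obtain \<gamma> e where \<gamma>: "0 < e" "\<gamma> ` {-e<..<e} \<subseteq> M" "\<gamma> 0 = u" "(\<gamma> has_vector_derivative v) (at 0)"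
    using v by (auto simp: tangent_space_def)
  have "eventually (\<lambda>s. s \<in> {-e<..<e}) (nhds 0)"
    using \<gamma>(1) by (intro eventually_nhds_in_open) auto
  then have "eventually (\<lambda>s. isometric r t p (\<gamma> s)) (nhds 0)"
  proof (rule eventually_mono)
    fix s :: real assume "s \<in> {-e<..<e}"
    then have "\<gamma> s \<in> isometry_class r t p" using \<gamma>(2) M by blast
    then show "isometric r t p (\<gamma> s)" by (simp add: isometry_class_def)
  qed
  from flexes_tree_velocity[OF \<gamma>(4) this] show ?thesis unfolding \<gamma>(3) .
qed

text \<open>The directions of the orbit satisfy the equations for velocities too, and so does every
  representative of a coset.\<close>

lemma reduced_form_vanishes:
  assumes t: "proper t" "leaves t = UNIV" and u: "u \<in> polygons r"
    and M: "lift K \<subseteq> isometry_class r t p" "u \<in> lift K"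
    and XY: "X \<in> moduli_tangent K u" "Y \<in> moduli_tangent K u"
  shows "reduced_form r u X Y = 0"
proof -
  have e: "edge r t u = 0" using M by (auto simp: isometry_class_def)
  have tang: "flexes_tree r t u x" if x: "X \<in> moduli_tangent K u" "x \<in> X" for X x
  proof -
    obtain v \<xi> where v: "v \<in> tangent_space (lift K) u" "x = v + (\<chi> i. cross3 \<xi> (u $ i))"
      using x by (auto simp: moduli_tangent_def orbit_tangent_def)
    show ?thesis
      unfolding v(2) by (rule flexes_tree_add[OF tangent_isometry_class[OF v(1) M(1)] flexes_tree_rotation])
  qed
  have "symplectic_form r u x y = 0" if "x \<in> X" "y \<in> Y" for x y
    using tang[OF XY(1) that(1)] tang[OF XY(2) that(2)] u e
    by (intro symplectic_form_vanishes[OF t]) (auto simp: polygons_def)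
  moreover have "X \<noteq> {}" "Y \<noteq> {}"
    using XY by (auto simp: moduli_tangent_def orbit_tangent_def)
  moreover from this obtain x y where "x \<in> X" "y \<in> Y" by blast
  ultimately have "{symplectic_form r u x y |x y. x \<in> X \<and> y \<in> Y} = {0}"
    by (auto, blast)
  then show ?thesis by (simp add: reduced_form_def)
qed

theorem theorem3:
  fixes r :: "real^'n::{finite,linorder}"
    and d :: "nat \<Rightarrow> 'n \<times> 'n"
    and N :: "(real^3^'n::{finite,linorder}) set set"
  assumes "CARD('n) \<ge> 4"
    and "\<forall>i. r $ i > 0"
    and "bending_system d"
    and "singular_fiber r d N"
  shows "(generic r \<longrightarrow> (\<exists>m. moduli_submanifold r m N)) \<and>
    (\<not> generic r \<longrightarrow>
       orbispace_chart (subtopology (moduli_top r) N) N (lift N) SO3 rotate_polygon polygon_class \<and>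
       (\<exists>m. smooth_manifold m (lift N))) \<and>
    (\<exists>m. moduli_submanifold r m (N \<inter> moduli_nd r)) \<and>
    (\<forall>u\<in>lift (N \<inter> moduli_nd r).
       \<forall>X\<in>moduli_tangent (N \<inter> moduli_nd r) u. \<forall>Y\<in>moduli_tangent (N \<inter> moduli_nd r) u.
         reduced_form r u X Y = 0)"
proof -
  have r: "\<And>i. r $ i > 0" using assms(2) by blast
  obtain c where c: "N = bending_fiber r d c" and "\<exists>p\<in>N. singular_point r d p"
    using assms(4) by (auto simp: singular_fiber_def)
  then obtain q where q: "q \<in> N" "q \<in> moduli r" by (auto simp: singular_point_def)
  then obtain p where p: "p \<in> polygons r" "q = polygon_class p" by (auto simp: moduli_def)
  have pN: "p \<in> lift N" using q(1) p(2) by (simp add: lift_def)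
  have Nm: "N \<subseteq> moduli r" by (auto simp: c bending_fiber_def)
  obtain t and l :: 'n where t: "proper t" "leaves t = UNIV"
    "leaves ` nodes t = insert UNIV (insert (- {l}) ((\<lambda>k. {fst (d k)..<snd (d k)}) ` {1..CARD('n) - 3}))"
    using bending_system_triangulation[OF assms(3,1)] .
  define M where "M = isometry_class r t p"
  define \<rho> where "\<rho> u = (\<chi> j. fit r t p 0 u j)" for u
  have M: "lift N = M"
    unfolding M_def isometry_class_bending[OF t r p(1)] using pN by (auto simp: c lift_bending_fiber)
  have Mp: "M \<subseteq> polygons r" unfolding M[symmetric] by (rule lift_subset[OF Nm])
  have pe: "edge r t p = 0" using pN unfolding M M_def by (simp add: isometry_class_def)
  have ret: "smooth_retract_at \<rho> M u" if "u \<in> M" for u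
    unfolding \<rho>_def M_def by (rule fit_closed_retract[OF r t(1,2) pe]) (use that in \<open>simp add: M_def\<close>)
  have con: "connected M" unfolding M_def by (rule connected_isometry_class[OF r t(1)])
  obtain m where rank: "\<And>u. u \<in> M \<Longrightarrow> dim (range (frechet_derivative \<rho> (at u))) = m"
    by (rule smooth_retract_rank_constant[OF con ret]) (assumption, rule that)
  have inv: "rotate_polygon A u \<in> M" if "A \<in> SO3" "u \<in> M" for A u
    using isometry_class_rotate that unfolding M_def by blast
  have lnd: "lift (N \<inter> moduli_nd r) = {u \<in> M. \<not> degenerate u}"
    unfolding M[symmetric] using lift_subset[OF Nm] by (auto simp: lift_def polygon_class_in_moduli_nd)
  have nd: "moduli_submanifold r (m - 3) (N \<inter> moduli_nd r)"
    by (rule moduli_submanifold_of_retract[OF _ lnd Mp inv ret rank]) auto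
  have gen: "N \<inter> moduli_nd r = N" if "generic r"
  proof -
    have "moduli r \<subseteq> moduli_nd r"
      using generic_imp_nondegenerate[OF that] by (auto simp: moduli_def moduli_nd_def)
    then show ?thesis using Nm by blast
  qed
  have "closed {u :: real^3^'n::{finite,linorder}. \<forall>k\<in>{1..CARD('n) - 3}. bending_lift r (d k) u = c k}"
    unfolding Collect_ball_eq bending_lift_def diagonal_vector_def case_prod_beta
    by (intro closed_INT ballI closed_Collect_eq[OF _ continuous_on_const] continuous_intros) auto
  then have "compact (polygons r \<inter> {u. \<forall>k\<in>{1..CARD('n) - 3}. bending_lift r (d k) u = c k})"
    by (rule compact_Int_closed[OF compact_polygons])
  moreover have "polygons r \<inter> {u. \<forall>k\<in>{1..CARD('n) - 3}. bending_lift r (d k) u = c k} = lift N"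
    unfolding c lift_bending_fiber by blast
  ultimately have comp: "compact (lift N)" by simp
  have orb: "orbispace_chart (subtopology (moduli_top r) N) N (lift N) SO3 rotate_polygon polygon_class"
    by (rule orbispace_chart_lift[OF Nm comp])
  have man: "smooth_manifold m (lift N)"
    unfolding M by (rule smooth_manifold_of_retract[OF ret rank])
  have iso: "reduced_form r u X Y = 0" if "u \<in> lift (N \<inter> moduli_nd r)"
    "X \<in> moduli_tangent (N \<inter> moduli_nd r) u" "Y \<in> moduli_tangent (N \<inter> moduli_nd r) u" for u X Y
    by (rule reduced_form_vanishes[OF t(1,2) _ _ that])
       (use that(1) Mp in \<open>auto simp: lnd M_def\<close>)
  show ?thesis using gen nd orb man iso by metis
qed

end
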